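(* For every $\rho>0$ there exist $\delta_\rho>0$ and a ball $U^\rho:=B_{\delta_\rho}(0):=\{\eta\in Y':|\eta|<\delta_\rho\}$ such that 1. the first Bloch eigenvalue $\eta\mapsto\lambda_1^\rho(\eta)$ of $\mathcal{A}^\rho$ is analytic for $\eta\in U^\rho$; 2. there is a choice of corresponding eigenfunctions $\phi_1^\rho(\cdot,\eta)$ such that $\eta\in U^\rho\mapsto\phi_1^\rho(\cdot,\eta)\in H^2_\sharp(Y)$ is analytic.
   Context: $Y=[0,2\pi)^d$, $Y'=[-\frac12,\frac12)^d$. $A(y)$ is a $d\times d$ matrix with real, bounded, measurable entries on $\mathbb{R}^d$ that is symmetric, $Y$-periodic ($A(y+2\pi p)=A(y)$ for all $p\in\mathbb{Z}^d$, a.e. $y$), and elliptic: there is $\alpha>0$ with $A(y)\xi\cdot\xi\ge\alpha|\xi|^2$ for all $\xi\in\mathbb{R}^d$, a.e. $y$. $H^s_\sharp(Y)$ is the Sobolev space of (complex-valued) $Y$-periodic functions, identified with $H^s$ of the torus $\mathbb{R}^d/2\pi\mathbb{Z}^d$. $\mathcal{A}^\rho=\rho^2\Delta^2-\nabla\cdot A(y)\nabla$. For $\eta\in Y'$ the shifted operator is $\mathcal{A}^\rho(\eta)=\rho^2(\nabla+i\eta)^4-(\nabla+i\eta)\cdot A(y)(\nabla+i\eta)$, acting on $Y$-periodic functions and associated with the form $a^\rho[\eta](u,v)=\int_Y A(\nabla+i\eta)u\cdot\overline{(\nabla+i\eta)v}\,dy+\rho^2\int_Y(\nabla+i\eta)^2u\,\overline{(\nabla+i\eta)^2v}\,dy$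 on $H^2_\sharp(Y)$, where $(\nabla+i\eta)^2u=\Delta u+2i\eta\cdot\nabla u-|\eta|^2u$. The Bloch eigenvalues $\lambda_1^\rho(\eta)\le\lambda_2^\rho(\eta)\le\cdots$ are the eigenvalues of $\mathcal{A}^\rho(\eta)$ in $L^2_\sharp(Y)$, repeated with multiplicity, and $\phi_m^\rho(\cdot,\eta)\in H^2_\sharp(Y)$ are corresponding eigenfunctions. *)

theory Defs
  imports "HOL-Analysis.Analysis"
begin

text \<open>Periodicity with respect to the lattice of integer multiples of \<open>2 * pi\<close>, the basic cell
  \<open>Y\<close> and the dual cell \<open>Y'\<close>.  Functions are representatives of classes modulo equality almost
  everywhere, so periodicity is only required almost everywhere.\<close>

definition periodic :: "(real^'d \<Rightarrow> 'b) \<Rightarrow> bool" where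
  "periodic f \<longleftrightarrow>
     (\<forall>p::int^'d. AE y in lebesgue. f (y + (\<chi> i. 2 * pi * of_int (p $ i))) = f y)"

definition cell :: "(real^'d) set" where
  "cell = {y. \<forall>i. 0 \<le> y $ i \<and> y $ i < 2 * pi}"

definition dual_cell :: "(real^'d) set" where
  "dual_cell = {\<eta>. \<forall>i. - (1/2) \<le> \<eta> $ i \<and> \<eta> $ i < 1/2}"

definition partial_deriv :: "'d \<Rightarrow> (real^'d \<Rightarrow> complex) \<Rightarrow> real^'d \<Rightarrow> complex" where
  "partial_deriv j f y = vector_derivative (\<lambda>t. f (y + t *\<^sub>R axis j 1)) (at 0)"

text \<open>Infinitely differentiable: all iterated partial derivatives exist and are continuous.\<close>

definition smooth :: "(real^'d \<Rightarrow> complex) \<Rightarrow> bool" where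
  "smooth f \<longleftrightarrow>
     (\<forall>js. continuous_on UNIV (foldr partial_deriv js f) \<and>
        (\<forall>j y. (\<lambda>t. foldr partial_deriv js f (y + t *\<^sub>R axis j 1)) differentiable at 0))"

definition L2_per :: "(real^'d \<Rightarrow> complex) set" where
  "L2_per = {u \<in> borel_measurable lebesgue.
     periodic u \<and> set_integrable lebesgue cell (\<lambda>y. (cmod (u y))\<^sup>2)}"

definition L2_inner :: "(real^'d \<Rightarrow> complex) \<Rightarrow> (real^'d \<Rightarrow> complex) \<Rightarrow> complex" where
  "L2_inner u v = (LINT y:cell|lebesgue. u y * cnj (v y))"

text \<open>Weak derivatives on the torus: the test functions are smooth and periodic, and there is no
  boundary term.\<close>

definition has_weak_partial ::
    "'d \<Rightarrow> (real^'d \<Rightarrow> complex) \<Rightarrow> (real^'d \<Rightarrow> complex) \<Rightarrow> bool" where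
  "has_weak_partial j u g \<longleftrightarrow> g \<in> L2_per \<and>
     (\<forall>\<phi>. smooth \<phi> \<and> periodic \<phi> \<longrightarrow>
        (LINT y:cell|lebesgue. u y * partial_deriv j \<phi> y)
          = - (LINT y:cell|lebesgue. g y * \<phi> y))"

text \<open>A representative of the weak derivative, which is unique up to null sets.\<close>

definition weak_partial :: "'d \<Rightarrow> (real^'d \<Rightarrow> complex) \<Rightarrow> real^'d \<Rightarrow> complex" where
  "weak_partial j u = (SOME g. has_weak_partial j u g)"

primrec sobolev :: "nat \<Rightarrow> (real^'d \<Rightarrow> complex) set" where
  "sobolev 0 = L2_per"
| "sobolev (Suc s) = {u \<in> L2_per. \<forall>j. \<exists>g\<in>sobolev s. has_weak_partial j u g}"

primrec sobolev_norm_sq :: "nat \<Rightarrow> (real^'d \<Rightarrow> complex) \<Rightarrow> real" where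
  "sobolev_norm_sq 0 u = (LINT y:cell|lebesgue. (cmod (u y))\<^sup>2)"
| "sobolev_norm_sq (Suc s) u =
     (LINT y:cell|lebesgue. (cmod (u y))\<^sup>2) + (\<Sum>j\<in>UNIV. sobolev_norm_sq s (weak_partial j u))"

definition sobolev_norm :: "nat \<Rightarrow> (real^'d \<Rightarrow> complex) \<Rightarrow> real" where
  "sobolev_norm s u = sqrt (sobolev_norm_sq s u)"

text \<open>\<open>shifted_grad\<close> gives the components of \<open>(\<nabla> + i\<eta>) u\<close>, and \<open>shifted_laplacian\<close> is
  \<open>(\<nabla> + i\<eta>)\<^sup>2 u = \<Delta>u + 2i\<eta>\<cdot>\<nabla>u - |\<eta>|\<^sup>2 u\<close>.\<close>

definition shifted_grad ::
    "real^'d \<Rightarrow> 'd \<Rightarrow> (real^'d \<Rightarrow> complex) \<Rightarrow> real^'d \<Rightarrow> complex" where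
  "shifted_grad \<eta> j u y = weak_partial j u y + \<i> * of_real (\<eta> $ j) * u y"

definition shifted_laplacian ::
    "real^'d \<Rightarrow> (real^'d \<Rightarrow> complex) \<Rightarrow> real^'d \<Rightarrow> complex" where
  "shifted_laplacian \<eta> u y =
     (\<Sum>j\<in>UNIV. weak_partial j (weak_partial j u) y)
     + 2 * \<i> * (\<Sum>j\<in>UNIV. of_real (\<eta> $ j) * weak_partial j u y)
     - of_real ((norm \<eta>)\<^sup>2) * u y"

definition bloch_form ::
    "(real^'d \<Rightarrow> real^'d^'d) \<Rightarrow> real \<Rightarrow> real^'d \<Rightarrow>
       (real^'d \<Rightarrow> complex) \<Rightarrow> (real^'d \<Rightarrow> complex) \<Rightarrow> complex" where
  "bloch_form A \<rho> \<eta> u v =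
     (LINT y:cell|lebesgue. (\<Sum>i\<in>UNIV.
        (\<Sum>j\<in>UNIV. of_real (A y $ i $ j) * shifted_grad \<eta> j u y) * cnj (shifted_grad \<eta> i v y)))
     + of_real (\<rho>\<^sup>2) *
       (LINT y:cell|lebesgue. shifted_laplacian \<eta> u y * cnj (shifted_laplacian \<eta> v y))"

text \<open>The graph of the operator in \<open>L\<^sup>2\<close> associated with the form: \<open>u\<close> lies in its domain and is
  mapped to \<open>f\<close>.\<close>

definition bloch_operator ::
    "(real^'d \<Rightarrow> real^'d^'d) \<Rightarrow> real \<Rightarrow> real^'d \<Rightarrow>
       (real^'d \<Rightarrow> complex) \<Rightarrow> (real^'d \<Rightarrow> complex) \<Rightarrow> bool" where
  "bloch_operator A \<rho> \<eta> u f \<longleftrightarrow>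
     u \<in> sobolev 2 \<and> f \<in> L2_per \<and> (\<forall>v\<in>sobolev 2. bloch_form A \<rho> \<eta> u v = L2_inner f v)"

definition bloch_eigenfunction ::
    "(real^'d \<Rightarrow> real^'d^'d) \<Rightarrow> real \<Rightarrow> real^'d \<Rightarrow> real \<Rightarrow> (real^'d \<Rightarrow> complex) \<Rightarrow> bool" where
  "bloch_eigenfunction A \<rho> \<eta> \<mu> u \<longleftrightarrow>
     bloch_operator A \<rho> \<eta> u (\<lambda>y. of_real \<mu> * u y) \<and> \<not> (AE y in lebesgue. u y = 0)"

text \<open>The \<open>m\<close>-th eigenvalue (\<open>m \<ge> 1\<close>) in increasing order and repeated with multiplicity is the
  least \<open>\<mu>\<close> such that the eigenvalues not exceeding \<open>\<mu>\<close> have total multiplicity at least \<open>m\<close>, that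
  is, such that they admit \<open>m\<close> eigenfunctions which are linearly independent modulo null sets.\<close>

definition bloch_eigenvalue ::
    "(real^'d \<Rightarrow> real^'d^'d) \<Rightarrow> real \<Rightarrow> nat \<Rightarrow> real^'d \<Rightarrow> real" where
  "bloch_eigenvalue A \<rho> m \<eta> = Inf {\<mu>. \<exists>u :: nat \<Rightarrow> real^'d \<Rightarrow> complex.
     (\<forall>k<m. \<exists>\<nu>\<le>\<mu>. bloch_eigenfunction A \<rho> \<eta> \<nu> (u k)) \<and>
     (\<forall>c :: nat \<Rightarrow> complex.
        (AE y in lebesgue. (\<Sum>k<m. c k * u k y) = 0) \<longrightarrow> (\<forall>k<m. c k = 0))}"

text \<open>Real analyticity of functions of several real variables: local expansion into a power series
  indexed by multi-indices.  In the second definition the values lie in the periodic Sobolev space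
  and the series converges unconditionally in its norm, just as \<open>has_sum\<close> in the first.\<close>

definition monomial :: "real^'d \<Rightarrow> ('d \<Rightarrow> nat) \<Rightarrow> real" where
  "monomial x \<alpha> = (\<Prod>i\<in>UNIV. (x $ i) ^ \<alpha> i)"

definition real_analytic_on :: "(real^'d \<Rightarrow> real) \<Rightarrow> (real^'d) set \<Rightarrow> bool" where
  "real_analytic_on f S \<longleftrightarrow>
     (\<forall>x0\<in>S. \<exists>r>0. \<exists>c :: ('d \<Rightarrow> nat) \<Rightarrow> real. \<forall>x\<in>ball x0 r.
        ((\<lambda>\<alpha>. monomial (x - x0) \<alpha> * c \<alpha>) has_sum f x) UNIV)"

definition sobolev_analytic_on ::
    "nat \<Rightarrow> (real^'d \<Rightarrow> real^'d \<Rightarrow> complex) \<Rightarrow> (real^'d) set \<Rightarrow> bool" where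
  "sobolev_analytic_on s f S \<longleftrightarrow>
     (\<forall>x0\<in>S. \<exists>r>0. \<exists>c :: ('d \<Rightarrow> nat) \<Rightarrow> real^'d \<Rightarrow> complex. (\<forall>\<alpha>. c \<alpha> \<in> sobolev s) \<and>
        (\<forall>x\<in>ball x0 r. f x \<in> sobolev s \<and>
           ((\<lambda>F. sobolev_norm s (\<lambda>y. f x y - (\<Sum>\<alpha>\<in>F. of_real (monomial (x - x0) \<alpha>) * c \<alpha> y)))
              \<longlongrightarrow> 0) (finite_subsets_at_top UNIV)))"

end

theory Submission
  imports Defs
begin

text \<open>
  A periodic function is described by its Fourier coefficients.  Dividing the coefficients by
  \<open>|k|\<^sup>2\<close> (by \<open>1\<close> at \<open>k = 0\<close>) identifies the Hilbert space of square-summable families \<open>x\<close> with the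
  periodic Sobolev space of order two (\<open>sobolev_2_iff\<close>), and under this identification the shifted
  form is \<open>a[\<eta>](u, v) = \<langle>B(\<eta>) x, y\<rangle>\<close> with bounded operators \<open>B(\<eta>)\<close> that are polynomials in \<open>\<eta>\<close>
  (\<open>bloch_form_eq\<close>).  At \<open>\<eta> = 0\<close> the constants lie in the kernel of \<open>B(0)\<close>, and on functions of mean
  zero \<open>B(0) \<ge> \<rho>\<^sup>2\<close>: the second-order part is nonnegative, and the weight is chosen so that
  \<open>\<parallel>\<Delta> u\<parallel> = \<parallel>x\<parallel>\<close>.  Hence \<open>0\<close> is a simple eigenvalue at the bottom of the spectrum, with a gap that can
  be used without any compactness or spectral theorem.

  For small \<open>\<eta>\<close> an eigenfunction is sought as \<open>1 + w\<close> with \<open>w\<close> of mean zero.  Testing the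
  eigenvalue equation with the constant gives \<open>\<lambda> = \<langle>B(\<eta>) (1 + w), 1\<rangle>\<close>; inserting this into the
  mean-zero part of the equation leaves a quadratic equation for \<open>w\<close> alone, which is solved by
  the iteration \<open>w \<mapsto> w - \<tau> (B(\<eta>) (1 + w) - \<lambda> w)\<close> (with the weights and the projection in place).  It is a
  contraction because \<open>1 - \<tau> B(0)\<close> is one on mean-zero functions and everything else is \<open>O(\<eta>)\<close>.

  Analyticity comes from running the iteration with the norm \<open>\<Sum>\<^sub>\<alpha> \<parallel>c\<^sub>\<alpha>\<parallel> r\<^bsup>|\<alpha>|\<^esup>\<close> of power series
  about a point \<open>x0\<close>.  This norm is submultiplicative, so the same contraction estimate holds in
  it and the limit has a power series about \<open>x0\<close> (\<open>analytic_fixed_point\<close>).  The iterates themselves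
  do not depend on \<open>x0\<close>, so one function \<open>w\<close> has expansions about all points near the origin.

  Finally \<open>\<lambda>(\<eta>)\<close> is the least eigenvalue.  All eigenvalues are nonnegative, and an eigenvalue below
  \<open>\<lambda>(\<eta>)\<close> would be small.  Its eigenfunction cannot have mean zero, by the gap; scaled to the form
  \<open>1 + v\<close>, the gap makes \<open>v\<close> small, and the uniqueness of the fixed point returns the eigenvalue
  \<open>\<lambda>(\<eta>)\<close> (\<open>simple_eigenvalue_analytic\<close>).

  The Fourier description rests on the totality of the plane waves (\<open>plane_waves_total\<close>, from the
  Stone--Weierstrass theorem), on the Riesz--Fischer theorem (\<open>synthesis\<close>), and on the
  characterisation of weak derivatives by Fourier coefficients (\<open>has_weak_partial_iff\<close>).
\<close>

section \<open>Square-summable families as a Hilbert space\<close>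

typedef 'i ell2 = "{x :: 'i \<Rightarrow> complex. (\<lambda>i. (cmod (x i))\<^sup>2) summable_on UNIV}"
  morphisms coord Abs_ell2
  by (rule exI[of _ "\<lambda>_. 0"]) simp

lemma coord_summable: "(\<lambda>i. (cmod (coord x i))\<^sup>2) summable_on UNIV"
  using coord[of x] by simp

lemma ell2_eqI: "(\<And>i. coord x i = coord y i) \<Longrightarrow> x = y"
  using coord_inject by blast

lemma coord_Abs: "(\<lambda>i. (cmod (x i))\<^sup>2) summable_on UNIV \<Longrightarrow> coord (Abs_ell2 x) = x"
  by (simp add: Abs_ell2_inverse)

lemma square_summable_add:
  fixes x y :: "'i \<Rightarrow> complex"
  assumes "(\<lambda>i. (cmod (x i))\<^sup>2) summable_on A" "(\<lambda>i. (cmod (y i))\<^sup>2) summable_on A"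
  shows "(\<lambda>i. (cmod (x i + y i))\<^sup>2) summable_on A"
proof (rule summable_on_comparison_test)
  show "(\<lambda>i. 2 * (cmod (x i))\<^sup>2 + 2 * (cmod (y i))\<^sup>2) summable_on A"
    by (intro summable_on_add summable_on_cmult_right assms)
  show "(cmod (x i + y i))\<^sup>2 \<le> 2 * (cmod (x i))\<^sup>2 + 2 * (cmod (y i))\<^sup>2" for i
  proof -
    have "(cmod (x i + y i))\<^sup>2 \<le> (cmod (x i) + cmod (y i))\<^sup>2"
      by (intro power_mono norm_triangle_ineq) auto
    also have "\<dots> \<le> 2 * (cmod (x i))\<^sup>2 + 2 * (cmod (y i))\<^sup>2"
      using sum_squares_bound[of "cmod (x i)" "cmod (y i)"] by (simp add: power2_sum)
    finally show ?thesis .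
  qed
qed auto

lemma square_summable_mult:
  fixes x :: "'i \<Rightarrow> complex"
  assumes "(\<lambda>i. (cmod (x i))\<^sup>2) summable_on A" "\<And>i. cmod (m i) \<le> C"
  shows "(\<lambda>i. (cmod (m i * x i))\<^sup>2) summable_on A"
proof (rule summable_on_comparison_test)
  show "(\<lambda>i. C\<^sup>2 * (cmod (x i))\<^sup>2) summable_on A"
    by (intro summable_on_cmult_right assms)
  show "(cmod (m i * x i))\<^sup>2 \<le> C\<^sup>2 * (cmod (x i))\<^sup>2" for i
    unfolding norm_mult power_mult_distrib
    by (intro mult_right_mono power_mono assms) auto
qed auto

lemma square_summable_cnj_mult:
  fixes x y :: "'i \<Rightarrow> complex"
  assumes "(\<lambda>i. (cmod (x i))\<^sup>2) summable_on A" "(\<lambda>i. (cmod (y i))\<^sup>2) summable_on A"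
  shows "(\<lambda>i. x i * cnj (y i)) summable_on A"
proof -
  have "(\<lambda>i. norm (x i * cnj (y i))) summable_on A"
  proof (rule summable_on_comparison_test)
    show "(\<lambda>i. (cmod (x i))\<^sup>2 + (cmod (y i))\<^sup>2) summable_on A"
      by (intro summable_on_add assms)
    show "norm (x i * cnj (y i)) \<le> (cmod (x i))\<^sup>2 + (cmod (y i))\<^sup>2" for i
    proof -
      have "0 \<le> cmod (x i) * cmod (y i)" by simp
      then show ?thesis
        using sum_squares_bound[of "cmod (x i)" "cmod (y i)"] unfolding norm_mult complex_mod_cnj
        by linarith
    qed
  qed auto
  then show ?thesis by (rule abs_summable_summable)
qed

definition cinner :: "'i ell2 \<Rightarrow> 'i ell2 \<Rightarrow> complex" where
  "cinner x y = (\<Sum>\<^sub>\<infinity>i. coord x i * cnj (coord y i))"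

text \<open>The class \<open>real_inner\<close> only provides real scalars; complex multiples act through \<open>cscale\<close>, and the
real inner product is the real part of \<open>cinner\<close>.\<close>

definition cscale :: "complex \<Rightarrow> 'i ell2 \<Rightarrow> 'i ell2" where
  "cscale c x = Abs_ell2 (\<lambda>i. c * coord x i)"

lemma coord_cscale [simp]: "coord (cscale c x) i = c * coord x i"
  unfolding cscale_def
  by (subst coord_Abs) (use square_summable_mult[OF coord_summable, of "\<lambda>_. c" "cmod c" x] in auto)

instantiation ell2 :: (type) real_inner
begin

definition "0 = Abs_ell2 (\<lambda>i. 0)"
definition "x + y = Abs_ell2 (\<lambda>i. coord x i + coord y i)"
definition "- x = cscale (-1) x" for x :: "'a ell2"
definition "x - y = x + (- y)" for x y :: "'a ell2"
definition "r *\<^sub>R x = cscale (of_real r) x" for x :: "'a ell2"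
definition "inner x y = Re (cinner x y)" for x y :: "'a ell2"
definition "norm x = sqrt (inner x x)" for x :: "'a ell2"
definition "sgn x = inverse (norm x) *\<^sub>R x" for x :: "'a ell2"
definition "dist x y = norm (x - y)" for x y :: "'a ell2"
definition "(uniformity :: ('a ell2 \<times> 'a ell2) filter) = (INF e\<in>{0 <..}. principal {(x, y). dist x y < e})"
definition "open U = (\<forall>x\<in>U. \<forall>\<^sub>F (x', y) in uniformity. x' = x \<longrightarrow> y \<in> U)" for U :: "'a ell2 set"

lemma coord_zero: "coord 0 i = 0"
  unfolding zero_ell2_def by (subst coord_Abs) auto

lemma coord_add: "coord (x + y) i = coord x i + coord y i"
  unfolding plus_ell2_def by (subst coord_Abs) (auto intro: square_summable_add coord_summable)

lemma cinner_summable: "(\<lambda>i. coord x i * cnj (coord y i)) summable_on UNIV"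
  by (intro square_summable_cnj_mult coord_summable)

lemma cinner_add_left: "cinner (x + y) z = cinner x z + cinner y z"
  unfolding cinner_def by (simp add: coord_add ring_distribs infsum_add cinner_summable)

lemma cinner_cscale_left: "cinner (cscale c x) z = c * cinner x z"
  unfolding cinner_def by (simp add: mult.assoc infsum_cmult_right')

lemma cinner_self: "cinner x x = of_real (\<Sum>\<^sub>\<infinity>i. (cmod (coord x i))\<^sup>2)"
proof -
  have "cinner x x = (\<Sum>\<^sub>\<infinity>i. of_real ((cmod (coord x i))\<^sup>2))"
    unfolding cinner_def by (simp add: complex_norm_square flip: of_real_power)
  also have "\<dots> = of_real (\<Sum>\<^sub>\<infinity>i. (cmod (coord x i))\<^sup>2)"
    by (intro infsumI has_sum_of_real has_sum_infsum coord_summable)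
  finally show ?thesis .
qed

lemma cinner_commute: "cinner y x = cnj (cinner x y)"
  unfolding cinner_def infsum_cnj[symmetric] by (simp add: mult.commute)

instance
proof
  fix x y z :: "'a ell2" and r s :: real
  show "x + y + z = x + (y + z)" "x + y = y + x" "0 + x = x" "- x + x = 0"
    "r *\<^sub>R (x + y) = r *\<^sub>R x + r *\<^sub>R y" "(r + s) *\<^sub>R x = r *\<^sub>R x + s *\<^sub>R x"
    "r *\<^sub>R s *\<^sub>R x = (r * s) *\<^sub>R x" "1 *\<^sub>R x = x"
    by (auto intro!: ell2_eqI simp: coord_add coord_zero uminus_ell2_def scaleR_ell2_def algebra_simps)
  show "x - y = x + - y" by (simp add: minus_ell2_def)
  show "inner x y = inner y x"
    unfolding inner_ell2_def using cinner_commute[of x y] by simp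
  show "inner (x + y) z = inner x z + inner y z" "inner (r *\<^sub>R x) y = r * inner x y"
    unfolding inner_ell2_def by (simp_all add: cinner_add_left scaleR_ell2_def cinner_cscale_left)
  show "0 \<le> inner x x"
    unfolding inner_ell2_def cinner_self by (simp add: infsum_nonneg)
  show "(inner x x = 0) = (x = 0)"
  proof
    assume "inner x x = 0"
    then have "(\<Sum>\<^sub>\<infinity>i. (cmod (coord x i))\<^sup>2) = 0"
      unfolding inner_ell2_def cinner_self by simp
    then have "(cmod (coord x i))\<^sup>2 = 0" for i
      using nonneg_infsum_le_0D[OF _ coord_summable, of x i] by auto
    then show "x = 0" by (auto intro!: ell2_eqI simp: coord_zero)
  qed (simp add: inner_ell2_def cinner_def coord_zero)
qed (rule norm_ell2_def sgn_ell2_def dist_ell2_def uniformity_ell2_def open_ell2_def)+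

end

declare coord_zero [simp] coord_add [simp]

lemma coord_uminus [simp]: "coord (- x) i = - coord x i"
  by (simp add: uminus_ell2_def)

lemma coord_diff [simp]: "coord (x - y) i = coord x i - coord y i"
  using coord_add[of x "- y" i] by simp

lemma coord_scaleR [simp]: "coord (r *\<^sub>R x) i = of_real r * coord x i"
  by (simp add: scaleR_ell2_def)

lemma coord_sum [simp]: "coord (sum f A) i = (\<Sum>a\<in>A. coord (f a) i)"
  by (induction A rule: infinite_finite_induct) auto

lemma norm_ell2_sq: "(norm x)\<^sup>2 = (\<Sum>\<^sub>\<infinity>i. (cmod (coord x i))\<^sup>2)"
  by (simp add: power2_norm_eq_inner inner_ell2_def cinner_self)

text \<open>The complex inner product can be recovered from the real one, so the Parseval identity only has
to be proved for real parts.\<close>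

lemma cinner_eq: "cinner x y = Complex (inner x y) (inner x (cscale \<i> y))"
proof -
  have "cinner x (cscale \<i> y) = - \<i> * cinner x y"
    using cinner_commute[of x "cscale \<i> y"] cinner_commute[of x y] by (simp add: cinner_cscale_left)
  then show ?thesis by (simp add: inner_ell2_def complex_eq_iff)
qed

lemma sum_coord_le_norm:
  assumes "finite S" shows "(\<Sum>i\<in>S. (cmod (coord x i))\<^sup>2) \<le> (norm x)\<^sup>2"
  unfolding norm_ell2_sq by (intro finite_sum_le_infsum coord_summable assms) auto

lemma coord_le_norm: "cmod (coord x i) \<le> norm x"
  using sum_coord_le_norm[of "{i}" x] power2_le_imp_le by auto

text \<open>Membership and norm bound follow from the finite partial sums; this is how elements are
constructed below.\<close>

lemma ell2_normI:
  assumes "\<And>S. finite S \<Longrightarrow> (\<Sum>i\<in>S. (cmod (f i))\<^sup>2) \<le> C\<^sup>2" "C \<ge> 0"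
  shows "coord (Abs_ell2 f) = f" "norm (Abs_ell2 f) \<le> C"
proof -
  have *: "(\<lambda>i. (cmod (f i))\<^sup>2) summable_on UNIV"
    by (rule nonneg_bounded_partial_sums_imp_summable_on[of _ _ "C\<^sup>2"])
      (use assms in \<open>auto intro!: eventually_finite_subsets_at_top_weakI\<close>)
  then show c: "coord (Abs_ell2 f) = f" by (rule coord_Abs)
  have "(norm (Abs_ell2 f))\<^sup>2 \<le> C\<^sup>2"
    unfolding norm_ell2_sq c by (rule infsum_le_finite_sums[OF *]) (use assms in auto)
  then show "norm (Abs_ell2 f) \<le> C"
    using assms(2) by (rule power2_le_imp_le)
qed

instance ell2 :: (type) complete_space
proof
  fix X :: "nat \<Rightarrow> 'a ell2" assume X: "Cauchy X"
  have "Cauchy (\<lambda>n. coord (X n) i)" for i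
  proof (rule CauchyI)
    fix e :: real assume "0 < e"
    then obtain M where "\<forall>m\<ge>M. \<forall>n\<ge>M. norm (X m - X n) < e"
      using CauchyD[OF X, of e] by auto
    then have "\<forall>m\<ge>M. \<forall>n\<ge>M. cmod (coord (X m) i - coord (X n) i) < e"
      using coord_le_norm[of "X m - X n" i for m n, unfolded coord_diff] by (meson le_less_trans)
    then show "\<exists>M. \<forall>m\<ge>M. \<forall>n\<ge>M. cmod (coord (X m) i - coord (X n) i) < e" by blast
  qed
  then have "\<exists>l. (\<lambda>n. coord (X n) i) \<longlonglongrightarrow> l" for i
    using Cauchy_convergent convergent_def by blast
  then obtain l where l: "\<And>i. (\<lambda>n. coord (X n) i) \<longlonglongrightarrow> l i" by metis
  have key: "\<exists>M. \<forall>n\<ge>M. \<forall>S. finite S \<longrightarrow> (\<Sum>i\<in>S. (cmod (coord (X n) i - l i))\<^sup>2) \<le> e\<^sup>2" if e: "e > 0" for e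
  proof -
    obtain M where M: "\<forall>m\<ge>M. \<forall>n\<ge>M. norm (X m - X n) < e"
      using CauchyD[OF X e] by auto
    have "(\<Sum>i\<in>S. (cmod (coord (X n) i - l i))\<^sup>2) \<le> e\<^sup>2" if "n \<ge> M" "finite S" for n S
    proof (rule tendsto_le[OF sequentially_bot tendsto_const])
      show "(\<lambda>m. \<Sum>i\<in>S. (cmod (coord (X n) i - coord (X m) i))\<^sup>2)
          \<longlonglongrightarrow> (\<Sum>i\<in>S. (cmod (coord (X n) i - l i))\<^sup>2)"
        by (intro tendsto_intros l)
      show "\<forall>\<^sub>F m in sequentially. (\<Sum>i\<in>S. (cmod (coord (X n) i - coord (X m) i))\<^sup>2) \<le> e\<^sup>2"
      proof (rule eventually_sequentiallyI)
        fix m assume "M \<le> m"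
        then have "norm (X n - X m) \<le> e" using M that by (simp add: less_imp_le)
        then have "(norm (X n - X m))\<^sup>2 \<le> e\<^sup>2" by (intro power_mono) auto
        then show "(\<Sum>i\<in>S. (cmod (coord (X n) i - coord (X m) i))\<^sup>2) \<le> e\<^sup>2"
          using sum_coord_le_norm[OF that(2), of "X n - X m"] by simp
      qed
    qed
    then show ?thesis by blast
  qed
  define L where "L = Abs_ell2 l"
  have cL: "coord L = l"
  proof -
    obtain M where "\<forall>S. finite S \<longrightarrow> (\<Sum>i\<in>S. (cmod (coord (X M) i - l i))\<^sup>2) \<le> 1\<^sup>2"
      using key[of 1] by auto
    then have *: "coord (Abs_ell2 (\<lambda>i. coord (X M) i - l i)) = (\<lambda>i. coord (X M) i - l i)"
      by (intro ell2_normI(1)[of _ 1]) auto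
    have "coord (X M - Abs_ell2 (\<lambda>i. coord (X M) i - l i)) = l"
      by (auto simp: *)
    then show ?thesis unfolding L_def by (metis coord_inverse)
  qed
  have "X \<longlonglongrightarrow> L"
  proof (rule LIMSEQ_I)
    fix r :: real assume "r > 0"
    then obtain M where M: "\<And>n S. n \<ge> M \<Longrightarrow> finite S \<Longrightarrow> (\<Sum>i\<in>S. (cmod (coord (X n) i - l i))\<^sup>2) \<le> (r/2)\<^sup>2"
      using key[of "r/2"] by auto
    have "norm (X n - L) < r" if "n \<ge> M" for n
    proof -
      have "norm (Abs_ell2 (\<lambda>i. coord (X n) i - l i)) \<le> r/2"
        by (rule ell2_normI(2)) (use M[OF that] \<open>r > 0\<close> in auto)
      moreover have "(\<lambda>i. coord (X n) i - l i) = coord (X n - L)" by (auto simp: cL)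
      ultimately show ?thesis using \<open>r > 0\<close> by (simp add: coord_inverse)
    qed
    then show "\<exists>no. \<forall>n\<ge>no. norm (X n - L) < r" by blast
  qed
  then show "convergent X" by (auto simp: convergent_def)
qed

instance ell2 :: (type) banach ..

text \<open>Every constant-coefficient differential operator becomes such a Fourier multiplier.\<close>

definition diag :: "('i \<Rightarrow> complex) \<Rightarrow> 'i ell2 \<Rightarrow>\<^sub>L 'i ell2" where
  "diag m = Blinfun (\<lambda>x. Abs_ell2 (\<lambda>i. m i * coord x i))"

lemma
  assumes "\<And>i. cmod (m i) \<le> C"
  shows coord_diag: "coord (blinfun_apply (diag m) x) i = m i * coord x i"
    and norm_diag_le: "norm (diag m) \<le> C"
proof -
  have C: "C \<ge> 0" using assms order_trans norm_ge_zero by blast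
  have le: "(\<Sum>i\<in>S. (cmod (m i * coord x i))\<^sup>2) \<le> (C * norm x)\<^sup>2" if "finite S" for S x
  proof -
    have "(\<Sum>i\<in>S. (cmod (m i * coord x i))\<^sup>2) \<le> (\<Sum>i\<in>S. C\<^sup>2 * (cmod (coord x i))\<^sup>2)"
      unfolding norm_mult power_mult_distrib
      by (intro sum_mono mult_right_mono power_mono assms) auto
    also have "\<dots> \<le> C\<^sup>2 * (norm x)\<^sup>2"
      unfolding sum_distrib_left[symmetric] by (intro mult_left_mono sum_coord_le_norm that) auto
    finally show ?thesis by (simp add: power_mult_distrib)
  qed
  note * = ell2_normI[OF le]
  have cA: "coord (Abs_ell2 (\<lambda>i. m i * coord x i)) i = m i * coord x i" for x i
    using *(1)[of x] C by simp
  have nA: "norm (Abs_ell2 (\<lambda>i. m i * coord x i)) \<le> norm x * C" for x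
    using *(2)[of x] C by (simp add: mult.commute)
  have bl: "bounded_linear (\<lambda>x. Abs_ell2 (\<lambda>i. m i * coord x i))"
  proof (rule bounded_linear_intro)
    show "norm (Abs_ell2 (\<lambda>i. m i * coord x i)) \<le> norm x * C" for x by (rule nA)
  next
    fix x y
    show "Abs_ell2 (\<lambda>i. m i * coord (x + y) i)
        = Abs_ell2 (\<lambda>i. m i * coord x i) + Abs_ell2 (\<lambda>i. m i * coord y i)"
      by (rule ell2_eqI) (use cA[of "x + y"] cA[of x] cA[of y] in \<open>simp add: algebra_simps\<close>)
  next
    fix r x
    show "Abs_ell2 (\<lambda>i. m i * coord (r *\<^sub>R x) i) = r *\<^sub>R Abs_ell2 (\<lambda>i. m i * coord x i)"
      by (rule ell2_eqI) (use cA[of "r *\<^sub>R x"] cA[of x] in \<open>simp add: algebra_simps\<close>)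
  qed
  show "coord (blinfun_apply (diag m) x) i = m i * coord x i"
    unfolding diag_def using C by (simp add: bounded_linear_Blinfun_apply[OF bl] *(1))
  show "norm (diag m) \<le> C"
    unfolding diag_def using C
    by (intro norm_blinfun_bound) (auto simp: bounded_linear_Blinfun_apply[OF bl] intro!: *(2))
qed

section \<open>Orthonormal bases of square-integrable functions\<close>

definition L2_space :: "'a measure \<Rightarrow> ('a \<Rightarrow> complex) set" where
  "L2_space M = {u \<in> borel_measurable M. integrable M (\<lambda>x. (cmod (u x))\<^sup>2)}"

definition L2_ip :: "'a measure \<Rightarrow> ('a \<Rightarrow> complex) \<Rightarrow> ('a \<Rightarrow> complex) \<Rightarrow> complex" where
  "L2_ip M u v = (LINT x|M. u x * cnj (v x))"

definition L2_sq :: "'a measure \<Rightarrow> ('a \<Rightarrow> complex) \<Rightarrow> real" where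
  "L2_sq M u = (LINT x|M. (cmod (u x))\<^sup>2)"

lemma L2_spaceD [measurable_dest]: "u \<in> L2_space M \<Longrightarrow> u \<in> borel_measurable M"
  by (simp add: L2_space_def)

lemma L2_space_sq: "u \<in> L2_space M \<Longrightarrow> integrable M (\<lambda>x. (cmod (u x))\<^sup>2)"
  by (simp add: L2_space_def)

lemma L2_spaceI: "u \<in> borel_measurable M \<Longrightarrow> integrable M (\<lambda>x. (cmod (u x))\<^sup>2) \<Longrightarrow> u \<in> L2_space M"
  by (simp add: L2_space_def)

lemma borel_measurable_cnj [measurable (raw)]:
  "u \<in> borel_measurable M \<Longrightarrow> (\<lambda>x. cnj (u x)) \<in> borel_measurable M"
  by (rule borel_measurable_continuous_on[OF continuous_on_cnj[OF continuous_on_id]])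

text \<open>The weight replaces the Cauchy--Schwarz inequality: choosing \<open>t\<close> to balance the two terms gives
the same decay rates.\<close>

lemma mult_le_weighted_squares:
  fixes a b t :: real assumes "t > 0" shows "a * b \<le> (t * a\<^sup>2 + b\<^sup>2 / t) / 2"
proof -
  have "0 \<le> (sqrt t * a - b / sqrt t)\<^sup>2" by simp
  also have "\<dots> = t * a\<^sup>2 + b\<^sup>2 / t - 2 * (a * b)"
    using assms by (simp add: power2_diff power_mult_distrib power_divide)
  finally show ?thesis by simp
qed

lemma L2_space_bounded_mult:
  assumes u: "u \<in> L2_space M" and [measurable]: "a \<in> borel_measurable M"
    and a: "AE x in M. cmod (a x) \<le> C"
  shows "(\<lambda>x. a x * u x) \<in> L2_space M" "L2_sq M (\<lambda>x. a x * u x) \<le> C\<^sup>2 * L2_sq M u"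
proof -
  note [measurable] = L2_spaceD[OF u]
  have le: "AE x in M. (cmod (a x * u x))\<^sup>2 \<le> C\<^sup>2 * (cmod (u x))\<^sup>2"
    using a by eventually_elim (auto simp: norm_mult power_mult_distrib intro!: mult_right_mono power_mono)
  have int: "integrable M (\<lambda>x. (cmod (a x * u x))\<^sup>2)"
    by (rule Bochner_Integration.integrable_bound[OF integrable_mult_right[OF L2_space_sq[OF u], of "C\<^sup>2"]])
      (use le in auto)
  then show "(\<lambda>x. a x * u x) \<in> L2_space M" by (intro L2_spaceI) auto
  have "L2_sq M (\<lambda>x. a x * u x) \<le> (LINT x|M. C\<^sup>2 * (cmod (u x))\<^sup>2)"
    unfolding L2_sq_def by (intro integral_mono_AE int integrable_mult_right L2_space_sq u le)
  then show "L2_sq M (\<lambda>x. a x * u x) \<le> C\<^sup>2 * L2_sq M u" by (simp add: L2_sq_def)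
qed

lemma L2_space_cmult: "u \<in> L2_space M \<Longrightarrow> (\<lambda>x. c * u x) \<in> L2_space M"
  by (rule L2_space_bounded_mult(1)[where C = "cmod c"]) auto

lemma L2_space_add:
  assumes "u \<in> L2_space M" "v \<in> L2_space M" shows "(\<lambda>x. u x + v x) \<in> L2_space M"
proof (rule L2_spaceI)
  note [measurable] = L2_spaceD[OF assms(1)] L2_spaceD[OF assms(2)]
  show "(\<lambda>x. u x + v x) \<in> borel_measurable M" by measurable
  show "integrable M (\<lambda>x. (cmod (u x + v x))\<^sup>2)"
  proof (rule Bochner_Integration.integrable_bound)
    show "integrable M (\<lambda>x. 2 * (cmod (u x))\<^sup>2 + 2 * (cmod (v x))\<^sup>2)"
      by (intro Bochner_Integration.integrable_add integrable_mult_right L2_space_sq assms)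
    have "(cmod (u x + v x))\<^sup>2 \<le> 2 * (cmod (u x))\<^sup>2 + 2 * (cmod (v x))\<^sup>2" for x
    proof -
      have "(cmod (u x + v x))\<^sup>2 \<le> (cmod (u x) + cmod (v x))\<^sup>2"
        by (intro power_mono norm_triangle_ineq) auto
      also have "\<dots> \<le> 2 * (cmod (u x))\<^sup>2 + 2 * (cmod (v x))\<^sup>2"
        using sum_squares_bound[of "cmod (u x)" "cmod (v x)"] by (simp add: power2_sum)
      finally show ?thesis .
    qed
    then show "AE x in M. norm ((cmod (u x + v x))\<^sup>2) \<le> norm (2 * (cmod (u x))\<^sup>2 + 2 * (cmod (v x))\<^sup>2)"
      by auto
  qed measurable
qed

lemma L2_space_zero [simp]: "(\<lambda>x. 0) \<in> L2_space M"
  by (simp add: L2_space_def)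

lemma L2_space_diff:
  assumes "u \<in> L2_space M" "v \<in> L2_space M" shows "(\<lambda>x. u x - v x) \<in> L2_space M"
  using L2_space_add[OF assms(1) L2_space_cmult[OF assms(2), of "-1"]] by simp

lemma L2_space_sum:
  "(\<And>k. k \<in> S \<Longrightarrow> u k \<in> L2_space M) \<Longrightarrow> (\<lambda>x. \<Sum>k\<in>S. u k x) \<in> L2_space M"
  by (induction S rule: infinite_finite_induct) (auto intro: L2_space_add)

lemma L2_space_cnj: "u \<in> L2_space M \<Longrightarrow> (\<lambda>x. cnj (u x)) \<in> L2_space M"
  by (auto simp: L2_space_def)

lemma L2_ip_integrable:
  assumes u: "u \<in> L2_space M" and v: "v \<in> L2_space M"
  shows "integrable M (\<lambda>x. u x * cnj (v x))"
proof (rule Bochner_Integration.integrable_bound)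
  note [measurable] = L2_spaceD[OF u] L2_spaceD[OF v]
  show "integrable M (\<lambda>x. (cmod (u x))\<^sup>2 + (cmod (v x))\<^sup>2)"
    by (intro Bochner_Integration.integrable_add L2_space_sq assms)
  show "(\<lambda>x. u x * cnj (v x)) \<in> borel_measurable M" by measurable
  have "cmod (u x) * cmod (v x) \<le> (cmod (u x))\<^sup>2 + (cmod (v x))\<^sup>2" for x
    using sum_squares_bound[of "cmod (u x)" "cmod (v x)"]
      mult_nonneg_nonneg[OF norm_ge_zero[of "u x"] norm_ge_zero[of "v x"]] by linarith
  then show "AE x in M. norm (u x * cnj (v x)) \<le> norm ((cmod (u x))\<^sup>2 + (cmod (v x))\<^sup>2)"
    by (auto simp: norm_mult)
qed

lemma L2_ip_self: "L2_ip M u u = of_real (L2_sq M u)"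
  by (simp add: L2_ip_def L2_sq_def complex_norm_square[symmetric] flip: of_real_power)

lemma L2_ip_commute: "L2_ip M v u = cnj (L2_ip M u v)"
proof -
  have "(\<lambda>x. v x * cnj (u x)) = (\<lambda>x. cnj (u x * cnj (v x)))" by auto
  then show ?thesis unfolding L2_ip_def by (simp only: Bochner_Integration.integral_cnj)
qed

lemma L2_ip_add_left:
  "\<lbrakk>u \<in> L2_space M; v \<in> L2_space M; w \<in> L2_space M\<rbrakk>
    \<Longrightarrow> L2_ip M (\<lambda>x. u x + v x) w = L2_ip M u w + L2_ip M v w"
  by (simp add: L2_ip_def ring_distribs Bochner_Integration.integral_add L2_ip_integrable)

lemma L2_ip_cmult_left: "L2_ip M (\<lambda>x. c * u x) w = c * L2_ip M u w"
  by (simp add: L2_ip_def mult.assoc)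

lemma L2_ip_diff_left:
  "\<lbrakk>u \<in> L2_space M; v \<in> L2_space M; w \<in> L2_space M\<rbrakk>
    \<Longrightarrow> L2_ip M (\<lambda>x. u x - v x) w = L2_ip M u w - L2_ip M v w"
  by (simp add: L2_ip_def ring_distribs Bochner_Integration.integral_diff L2_ip_integrable)

lemma L2_ip_sum_left:
  assumes "\<And>k. k \<in> S \<Longrightarrow> u k \<in> L2_space M" "w \<in> L2_space M"
  shows "L2_ip M (\<lambda>x. \<Sum>k\<in>S. u k x) w = (\<Sum>k\<in>S. L2_ip M (u k) w)"
  using assms
proof (induction S rule: infinite_finite_induct)
  case (insert k S)
  then show ?case by (simp add: L2_ip_add_left L2_space_sum)
qed (auto simp: L2_ip_def)

lemma L2_ip_diff_right:
  "\<lbrakk>u \<in> L2_space M; v \<in> L2_space M; w \<in> L2_space M\<rbrakk>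
    \<Longrightarrow> L2_ip M w (\<lambda>x. u x - v x) = L2_ip M w u - L2_ip M w v"
  by (subst (1 2 3) L2_ip_commute) (simp add: L2_ip_diff_left)

lemma L2_sq_nonneg: "L2_sq M u \<ge> 0"
  by (simp add: L2_sq_def)

lemma L2_sq_cong: "(AE x in M. u x = v x) \<Longrightarrow> u \<in> L2_space M \<Longrightarrow> v \<in> L2_space M \<Longrightarrow> L2_sq M u = L2_sq M v"
  unfolding L2_sq_def by (intro integral_cong_AE) (auto dest!: L2_spaceD)

lemma L2_ip_bound:
  assumes u: "u \<in> L2_space M" and v: "v \<in> L2_space M" and t: "t > 0"
  shows "cmod (L2_ip M u v) \<le> (t * L2_sq M u + L2_sq M v / t) / 2"
proof -
  note int = L2_ip_integrable[OF u v]
  have "cmod (L2_ip M u v) \<le> (LINT x|M. cmod (u x) * cmod (v x))"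
    unfolding L2_ip_def using integral_norm_bound[of M "\<lambda>x. u x * cnj (v x)"] by (simp add: norm_mult)
  also have "\<dots> \<le> (LINT x|M. (t * (cmod (u x))\<^sup>2 + (cmod (v x))\<^sup>2 / t) / 2)"
    using integrable_norm[OF int]
    by (intro integral_mono mult_le_weighted_squares t)
      (auto simp: norm_mult intro!: integrable_divide Bochner_Integration.integrable_add
        integrable_mult_right L2_space_sq u v)
  also have "\<dots> = (t * L2_sq M u + L2_sq M v / t) / 2"
    using L2_space_sq[OF u] L2_space_sq[OF v] by (simp add: L2_sq_def)
  finally show ?thesis .
qed

lemma (in finite_measure) L1_bound:
  assumes u: "u \<in> L2_space M" and t: "t > 0"
  shows "integrable M (\<lambda>x. cmod (u x))" "(LINT x|M. cmod (u x)) \<le> t * L2_sq M u + measure M (space M) / t"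
proof -
  note [measurable] = L2_spaceD[OF u]
  have int: "integrable M (\<lambda>x. t * (cmod (u x))\<^sup>2 + 1 / t)"
    by (intro Bochner_Integration.integrable_add integrable_mult_right L2_space_sq u integrable_const)
  have le: "cmod (u x) \<le> t * (cmod (u x))\<^sup>2 + 1 / t" for x
  proof -
    have "cmod (u x) * 1 \<le> (t * (cmod (u x))\<^sup>2 + 1\<^sup>2 / t) / 2"
      by (rule mult_le_weighted_squares[OF t])
    moreover have "0 \<le> t * (cmod (u x))\<^sup>2" "0 \<le> 1 / t" using t by auto
    moreover have "y \<le> a + b" if "y * 1 \<le> (a + b) / 2" "0 \<le> a" "0 \<le> b" for y a b :: real
      using that by (simp add: field_simps)
    ultimately show ?thesis by (simp only: power_one)
  qed
  show i: "integrable M (\<lambda>x. cmod (u x))"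
    by (rule Bochner_Integration.integrable_bound[OF int]) (use le order_trans[OF norm_ge_zero le] in auto)
  have "(LINT x|M. cmod (u x)) \<le> (LINT x|M. t * (cmod (u x))\<^sup>2 + 1 / t)"
    by (rule integral_mono[OF i int le])
  also have "\<dots> = t * L2_sq M u + measure M (space M) / t"
    using L2_space_sq[OF u] by (simp add: L2_sq_def Bochner_Integration.integral_add)
  finally show "(LINT x|M. cmod (u x)) \<le> t * L2_sq M u + measure M (space M) / t" .
qed

text \<open>This is the completeness of the space of square-integrable functions.  On a finite measure space the
successive differences are summable in the mean, hence almost everywhere, so the sequence
converges pointwise; Fatou's lemma transfers the rate to the limit.  The limit is given
explicitly as \<open>lim\<close>, so that it inherits the periodicity of the functions \<open>f n\<close> at every point.\<close>

lemma (in finite_measure) L2_limit: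
  assumes f: "\<And>n. f n \<in> L2_space M"
    and rate: "\<And>m n. n \<le> m \<Longrightarrow> L2_sq M (\<lambda>x. f n x - f m x) \<le> (1/4) ^ n"
  defines "g \<equiv> \<lambda>x. lim (\<lambda>n. f n x)"
  shows "g \<in> L2_space M" "L2_sq M (\<lambda>x. f n x - g x) \<le> (1/4) ^ n"
proof -
  note [measurable] = L2_spaceD[OF f]
  have [measurable]: "g \<in> borel_measurable M"
    unfolding g_def by (intro borel_measurable_lim_metric) measurable
  let ?d = "\<lambda>n x. cmod (f n x - f (Suc n) x)"
  have d2: "(\<lambda>x. f n x - f (Suc n) x) \<in> L2_space M" for n by (intro L2_space_diff f)
  have dint: "(\<integral>\<^sup>+x. ennreal (?d n x) \<partial>M) \<le> ennreal ((1 + measure M (space M)) * (1/2) ^ n)" for n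
  proof -
    have p: "(2::real)^n > 0" by simp
    have "(LINT x|M. ?d n x) \<le> 2^n * L2_sq M (\<lambda>x. f n x - f (Suc n) x) + measure M (space M) / 2^n"
      by (rule L1_bound(2)[OF d2 p])
    also have "\<dots> \<le> 2^n * (1/4)^n + measure M (space M) / 2^n"
      by (intro add_right_mono mult_left_mono rate) auto
    also have "2^n * (1/4)^n = (1/2::real)^n" by (simp flip: power_mult_distrib)
    finally have "(LINT x|M. ?d n x) \<le> (1 + measure M (space M)) * (1/2) ^ n"
      by (simp add: add_divide_distrib power_one_over)
    then show ?thesis
      by (subst nn_integral_eq_integral[OF L1_bound(1)[OF d2 zero_less_one]]) (auto intro!: ennreal_leI)
  qed
  have "(\<integral>\<^sup>+x. (\<Sum>n. ennreal (?d n x)) \<partial>M) = (\<Sum>n. \<integral>\<^sup>+x. ennreal (?d n x) \<partial>M)"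
    by (rule nn_integral_suminf) measurable
  also have "\<dots> \<le> (\<Sum>n. ennreal ((1 + measure M (space M)) * (1/2) ^ n))"
    by (intro suminf_le dint) auto
  also have "\<dots> = ennreal (\<Sum>n. (1 + measure M (space M)) * (1/2) ^ n)"
    by (intro suminf_ennreal2 summable_mult summable_geometric) (auto intro!: mult_nonneg_nonneg add_nonneg_nonneg)
  also have "\<dots> < \<infinity>" by simp
  finally have "AE x in M. (\<Sum>n. ennreal (?d n x)) \<noteq> \<infinity>"
    by (intro nn_integral_PInf_AE) auto
  then have conv: "AE x in M. (\<lambda>n. f n x) \<longlonglongrightarrow> g x"
  proof eventually_elim
    case (elim x)
    then have "summable (\<lambda>n. ?d n x)"
      by (intro summable_suminf_not_top) (auto simp: top_ennreal_def[symmetric])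
    then have "summable (\<lambda>n. f n x - f (Suc n) x)" by (rule summable_norm_cancel)
    then have "convergent (\<lambda>n. \<Sum>k<n. f k x - f (Suc k) x)" by (simp add: summable_iff_convergent)
    moreover have "(\<Sum>k<n. f k x - f (Suc k) x) = f 0 x - f n x" for n
      by (induction n) auto
    ultimately have "convergent (\<lambda>n. f 0 x - f n x)" by simp
    then obtain L where "(\<lambda>n. f 0 x - f n x) \<longlonglongrightarrow> L" by (auto simp: convergent_def)
    from tendsto_diff[OF tendsto_const[of "f 0 x"] this] have L: "(\<lambda>n. f n x) \<longlonglongrightarrow> f 0 x - L" by simp
    then show ?case unfolding g_def limI[OF L] .
  qed
  have fatou: "(\<integral>\<^sup>+x. ennreal ((cmod (f n x - g x))\<^sup>2) \<partial>M) \<le> ennreal ((1/4)^n)" for n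
  proof -
    have "(\<integral>\<^sup>+x. ennreal ((cmod (f n x - g x))\<^sup>2) \<partial>M)
        \<le> (\<integral>\<^sup>+x. liminf (\<lambda>m. ennreal ((cmod (f n x - f m x))\<^sup>2)) \<partial>M)"
    proof (rule nn_integral_mono_AE)
      show "AE x in M. ennreal ((cmod (f n x - g x))\<^sup>2) \<le> liminf (\<lambda>m. ennreal ((cmod (f n x - f m x))\<^sup>2))"
        using conv
      proof eventually_elim
        case (elim x)
        have "(\<lambda>m. ennreal ((cmod (f n x - f m x))\<^sup>2)) \<longlonglongrightarrow> ennreal ((cmod (f n x - g x))\<^sup>2)"
          by (intro tendsto_ennrealI tendsto_intros elim)
        from lim_imp_Liminf[OF _ this] show ?case by simp
      qed
    qed
    also have "\<dots> \<le> liminf (\<lambda>m. \<integral>\<^sup>+x. ennreal ((cmod (f n x - f m x))\<^sup>2) \<partial>M)"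
      by (rule nn_integral_liminf) measurable
    also have "\<dots> \<le> ennreal ((1/4)^n)"
    proof (rule Liminf_le)
      have "(\<integral>\<^sup>+x. ennreal ((cmod (f n x - f m x))\<^sup>2) \<partial>M) \<le> ennreal ((1/4)^n)" if "n \<le> m" for m
      proof -
        have "(\<integral>\<^sup>+x. ennreal ((cmod (f n x - f m x))\<^sup>2) \<partial>M) = ennreal (L2_sq M (\<lambda>x. f n x - f m x))"
          unfolding L2_sq_def by (intro nn_integral_eq_integral L2_space_sq L2_space_diff f) auto
        then show ?thesis using rate[OF that] by (simp add: ennreal_leI)
      qed
      then show "\<forall>\<^sub>F m in sequentially. (\<integral>\<^sup>+x. ennreal ((cmod (f n x - f m x))\<^sup>2) \<partial>M) \<le> ennreal ((1/4)^n)"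
        by (rule eventually_sequentiallyI)
    qed simp
    finally show ?thesis .
  qed
  have diff: "(\<lambda>x. f n x - g x) \<in> L2_space M" for n
  proof (rule L2_spaceI)
    show "integrable M (\<lambda>x. (cmod (f n x - g x))\<^sup>2)"
      by (intro integrableI_bounded) (use fatou[of n] in \<open>auto intro: le_less_trans\<close>)
  qed measurable
  from L2_space_diff[OF f this, of 0 0] show "g \<in> L2_space M" by simp
  have "ennreal (L2_sq M (\<lambda>x. f n x - g x)) \<le> ennreal ((1/4)^n)"
    using fatou[of n] unfolding L2_sq_def
    by (subst (asm) nn_integral_eq_integral[OF L2_space_sq[OF diff]]) auto
  then show "L2_sq M (\<lambda>x. f n x - g x) \<le> (1/4)^n" by simp
qed

lemma exhausting_finite_sets:
  fixes x :: "'i ell2"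
  obtains S :: "nat \<Rightarrow> 'i set" where "\<And>n. finite (S n)" "incseq S"
    "\<And>n. (norm x)\<^sup>2 - (\<Sum>k\<in>S n. (cmod (coord x k))\<^sup>2) \<le> (1/4) ^ n"
proof -
  have "\<exists>S. finite S \<and> (norm x)\<^sup>2 - (\<Sum>k\<in>S. (cmod (coord x k))\<^sup>2) \<le> (1/4) ^ n" for n
  proof -
    have "\<exists>F. finite F \<and> F \<subseteq> UNIV \<and> dist (\<Sum>k\<in>F. (cmod (coord x k))\<^sup>2) (\<Sum>\<^sub>\<infinity>k. (cmod (coord x k))\<^sup>2) \<le> (1/4) ^ n"
      by (rule infsum_finite_approximation[OF coord_summable]) simp
    then show ?thesis unfolding norm_ell2_sq dist_real_def by (metis abs_le_D2 minus_diff_eq)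
  qed
  then obtain S where S: "\<And>n. finite (S n)"
    "\<And>n. (norm x)\<^sup>2 - (\<Sum>k\<in>S n. (cmod (coord x k))\<^sup>2) \<le> (1/4) ^ n" by metis
  show ?thesis
  proof (rule that[of "\<lambda>n. \<Union>j\<le>n. S j"])
    show fin: "finite (\<Union>j\<le>n. S j)" for n using S by auto
    show "incseq (\<lambda>n. \<Union>j\<le>n. S j)" by (force simp: incseq_def)
    show "(norm x)\<^sup>2 - (\<Sum>k\<in>(\<Union>j\<le>n. S j). (cmod (coord x k))\<^sup>2) \<le> (1/4) ^ n" for n
      using S(2)[of n] sum_mono2[OF fin[of n], of "S n" "\<lambda>k. (cmod (coord x k))\<^sup>2"] by force
  qed
qed

locale orthonormal_basis = finite_measure M for M :: "'a measure" +
  fixes e :: "'i \<Rightarrow> 'a \<Rightarrow> complex"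
  assumes e_L2: "e k \<in> L2_space M"
    and orthonormal: "L2_ip M (e k) (e l) = (if k = l then 1 else 0)"
    and total: "\<lbrakk>u \<in> L2_space M; \<And>k. L2_ip M u (e k) = 0\<rbrakk> \<Longrightarrow> AE x in M. u x = 0"
begin

text \<open>The functions are not restricted to the space of \<open>M\<close>: for plane waves the partial sums are defined, and
periodic, on the whole of \<open>real^'d\<close>.\<close>

definition partial_sum :: "('i \<Rightarrow> complex) \<Rightarrow> 'i set \<Rightarrow> 'a \<Rightarrow> complex" where
  "partial_sum c S x = (\<Sum>k\<in>S. c k * e k x)"

definition coeffs :: "('a \<Rightarrow> complex) \<Rightarrow> 'i ell2" where
  "coeffs u = Abs_ell2 (\<lambda>k. L2_ip M u (e k))"

lemma partial_sum_L2: "partial_sum c S \<in> L2_space M"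
  unfolding partial_sum_def[abs_def] by (intro L2_space_sum L2_space_cmult e_L2)

lemma ip_partial_sum:
  assumes "finite S" shows "L2_ip M (partial_sum c S) (e l) = (if l \<in> S then c l else 0)"
proof -
  have "L2_ip M (partial_sum c S) (e l) = (\<Sum>k\<in>S. c k * (if k = l then 1 else 0))"
    unfolding partial_sum_def[abs_def]
    by (simp add: L2_ip_sum_left L2_space_cmult e_L2 L2_ip_cmult_left orthonormal)
  also have "\<dots> = (if l \<in> S then c l else 0)"
    using assms by (simp add: if_distrib cong: if_cong)
  finally show ?thesis .
qed

lemma ip_partial_sum_right:
  assumes "u \<in> L2_space M"
  shows "L2_ip M (partial_sum c S) u = (\<Sum>k\<in>S. c k * cnj (L2_ip M u (e k)))"
  unfolding partial_sum_def[abs_def]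
  by (simp add: L2_ip_sum_left L2_space_cmult e_L2 L2_ip_cmult_left assms L2_ip_commute[of M "e _" u])

lemma L2_sq_partial_sum:
  assumes "finite S" shows "L2_sq M (partial_sum c S) = (\<Sum>k\<in>S. (cmod (c k))\<^sup>2)"
proof -
  have "L2_ip M (partial_sum c S) (partial_sum c S) = (\<Sum>k\<in>S. c k * cnj (c k))"
    unfolding ip_partial_sum_right[OF partial_sum_L2]
    by (intro sum.cong) (simp_all add: ip_partial_sum assms)
  also have "\<dots> = of_real (\<Sum>k\<in>S. (cmod (c k))\<^sup>2)"
    by (simp add: complex_norm_square del: of_real_power)
  finally show ?thesis unfolding L2_ip_self of_real_eq_iff .
qed

text \<open>Bessel's inequality in exact form; nonnegativity of the left side makes the coefficients
square-summable.\<close>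

lemma L2_sq_residual:
  assumes u: "u \<in> L2_space M" and S: "finite S"
  shows "L2_sq M (\<lambda>x. u x - partial_sum (\<lambda>k. L2_ip M u (e k)) S x)
    = L2_sq M u - (\<Sum>k\<in>S. (cmod (L2_ip M u (e k)))\<^sup>2)"
proof -
  let ?c = "\<lambda>k. L2_ip M u (e k)" and ?p = "partial_sum (\<lambda>k. L2_ip M u (e k)) S"
  let ?s = "\<Sum>k\<in>S. (cmod (?c k))\<^sup>2"
  note p = partial_sum_L2[of ?c S]
  have pu: "L2_ip M ?p u = of_real ?s"
    unfolding ip_partial_sum_right[OF u] by (simp add: complex_norm_square del: of_real_power)
  have up: "L2_ip M u ?p = of_real ?s"
    using L2_ip_commute[of M u ?p] pu by simp
  have "L2_ip M (\<lambda>x. u x - ?p x) (\<lambda>x. u x - ?p x) = L2_ip M u u - L2_ip M u ?p - (L2_ip M ?p u - L2_ip M ?p ?p)"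
    by (simp add: L2_ip_diff_left L2_ip_diff_right u p L2_space_diff)
  also have "\<dots> = of_real (L2_sq M u - ?s)"
    unfolding pu up L2_ip_self L2_sq_partial_sum[OF S] by simp
  finally show ?thesis unfolding L2_ip_self of_real_eq_iff .
qed

lemma coord_coeffs:
  assumes u: "u \<in> L2_space M" shows "coord (coeffs u) k = L2_ip M u (e k)"
proof -
  have "(\<Sum>k\<in>S. (cmod (L2_ip M u (e k)))\<^sup>2) \<le> (sqrt (L2_sq M u))\<^sup>2" if "finite S" for S
    using L2_sq_residual[OF u that] L2_sq_nonneg[of M "\<lambda>x. u x - partial_sum (\<lambda>k. L2_ip M u (e k)) S x"]
    by (simp add: L2_sq_nonneg)
  from ell2_normI(1)[OF this] show ?thesis unfolding coeffs_def by (simp add: L2_sq_nonneg)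
qed

text \<open>The Riesz--Fischer theorem.  The partial sums over finite sets that exhaust the norm of \<open>x\<close> at a
geometric rate form a sequence to which \<open>L2_limit\<close> applies.\<close>

lemma synthesis:
  fixes x :: "'i ell2"
  obtains S :: "nat \<Rightarrow> 'i set" where "\<And>n. finite (S n)"
    "(\<lambda>a. lim (\<lambda>n. partial_sum (coord x) (S n) a)) \<in> L2_space M"
    "coeffs (\<lambda>a. lim (\<lambda>n. partial_sum (coord x) (S n) a)) = x"
    "L2_sq M (\<lambda>a. lim (\<lambda>n. partial_sum (coord x) (S n) a)) = (norm x)\<^sup>2"
proof -
  obtain S where S: "\<And>n. finite (S n)" "incseq S"
    "\<And>n. (norm x)\<^sup>2 - (\<Sum>k\<in>S n. (cmod (coord x k))\<^sup>2) \<le> (1/4) ^ n"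
    by (rule exhausting_finite_sets[of x], rule that)
  define f where "f n = partial_sum (coord x) (S n)" for n
  define g where "g a = lim (\<lambda>n. f n a)" for a
  have f: "f n \<in> L2_space M" for n unfolding f_def by (rule partial_sum_L2)
  have tail: "(\<Sum>k\<in>T. (cmod (coord x k))\<^sup>2) \<le> (1/4) ^ n" if "finite T" "T \<inter> S n = {}" for T n
  proof -
    have "(\<Sum>k\<in>T \<union> S n. (cmod (coord x k))\<^sup>2) \<le> (norm x)\<^sup>2"
      by (rule sum_coord_le_norm) (use S that in auto)
    then show ?thesis using S(3)[of n] that S(1)[of n] by (simp add: sum.union_disjoint)
  qed
  have rate: "L2_sq M (\<lambda>a. f n a - f m a) \<le> (1/4) ^ n" if "n \<le> m" for m n
  proof -
    have sub: "S n \<subseteq> S m" using S(2) that by (auto simp: incseq_def)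
    have "f n a - f m a = (-1) * partial_sum (coord x) (S m - S n) a" for a
      unfolding f_def partial_sum_def using sum_diff[OF S(1)[of m] sub, of "\<lambda>k. coord x k * e k a"] by simp
    then have "L2_sq M (\<lambda>a. f n a - f m a) = L2_sq M (partial_sum (coord x) (S m - S n))"
      unfolding L2_sq_def by (simp add: norm_minus_commute)
    also have "\<dots> \<le> (1/4) ^ n"
      unfolding L2_sq_partial_sum[OF finite_Diff[OF S(1)]] by (rule tail) (use S in auto)
    finally show ?thesis .
  qed
  note lim = L2_limit[of f, OF f rate, folded g_def]
  have g: "g \<in> L2_space M" using lim(1) by (simp add: g_def[abs_def])
  have fg: "L2_sq M (\<lambda>a. f n a - g a) \<le> (1/4) ^ n" for n using lim(2) by (simp add: g_def)
  have half: "(\<lambda>n. 2 * (1/2::real) ^ n) \<longlonglongrightarrow> 0" 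
    using tendsto_mult_right_zero[OF LIMSEQ_power_zero[of "1/2::real"], of 2] by simp
  have "coord (coeffs g) k = coord x k" for k
  proof -
    have "cmod (coord x k - L2_ip M g (e k)) \<le> 2 * (1/2) ^ n" for n
    proof -
      have p: "(2::real)^n > 0" by simp
      have "cmod (L2_ip M (\<lambda>a. f n a - g a) (e k)) \<le> (2^n * L2_sq M (\<lambda>a. f n a - g a) + L2_sq M (e k) / 2^n) / 2"
        by (rule L2_ip_bound[OF L2_space_diff[OF f g] e_L2 p])
      also have "L2_sq M (e k) = 1"
        using orthonormal[of k k] unfolding L2_ip_self by simp
      also have "(2^n * L2_sq M (\<lambda>a. f n a - g a) + 1 / 2^n) / 2 \<le> (2^n * (1/4)^n + 1 / 2^n) / 2"
        by (intro divide_right_mono add_right_mono mult_left_mono fg) auto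
      also have "2^n * (1/4)^n = (1/2::real)^n" by (simp flip: power_mult_distrib)
      finally have 1: "cmod (L2_ip M (f n) (e k) - L2_ip M g (e k)) \<le> (1/2)^n"
        by (simp add: L2_ip_diff_left f g e_L2 power_one_over)
      have 2: "cmod (coord x k - L2_ip M (f n) (e k)) \<le> (1/2)^n"
      proof (cases "k \<in> S n")
        case False
        then have "(cmod (coord x k))\<^sup>2 \<le> (1/4)^n" using tail[of "{k}" n] by simp
        also have "(1/4)^n = ((1/2::real)^n)\<^sup>2"
          by (simp only: power2_eq_square flip: power_mult_distrib) simp
        finally have "(cmod (coord x k))\<^sup>2 \<le> ((1/2)^n)\<^sup>2" .
        then have "cmod (coord x k) \<le> (1/2)^n" by (rule power2_le_imp_le) simp
        then show ?thesis using False unfolding f_def by (simp add: ip_partial_sum S(1))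
      qed (simp add: f_def ip_partial_sum S(1))
      show ?thesis using norm_triangle_ineq[of "coord x k - L2_ip M (f n) (e k)" "L2_ip M (f n) (e k) - L2_ip M g (e k)"] 1 2
        by simp
    qed
    then have "cmod (coord x k - L2_ip M g (e k)) \<le> 0"
      by (intro LIMSEQ_le_const[OF half]) auto
    then show ?thesis by (simp add: coord_coeffs[OF g])
  qed
  then have cg: "coeffs g = x" by (intro ell2_eqI) auto
  have "\<bar>L2_sq M g - (norm x)\<^sup>2\<bar> \<le> 2 * (1/2) ^ n" for n
  proof -
    have "L2_sq M (\<lambda>a. g a - f n a) = L2_sq M g - (\<Sum>k\<in>S n. (cmod (coord x k))\<^sup>2)"
      using L2_sq_residual[OF g S(1)[of n]] unfolding coord_coeffs[OF g, symmetric] cg f_def .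
    moreover have "L2_sq M (\<lambda>a. g a - f n a) = L2_sq M (\<lambda>a. f n a - g a)"
      by (simp add: L2_sq_def norm_minus_commute)
    moreover have "(1/4::real)^n \<le> (1/2)^n" by (intro power_mono) auto
    ultimately show ?thesis
      using fg[of n] S(3)[of n] L2_sq_nonneg[of M "\<lambda>a. f n a - g a"] sum_coord_le_norm[OF S(1)[of n], of x]
      by (simp add: abs_if)
  qed
  then have "\<bar>L2_sq M g - (norm x)\<^sup>2\<bar> \<le> 0"
    by (intro LIMSEQ_le_const[OF half]) auto
  then have "L2_sq M g = (norm x)\<^sup>2" by simp
  with S(1) g cg show ?thesis
    by (intro that[of S]) (simp_all add: g_def[abs_def] f_def)
qed

lemma coeffs_add: "u \<in> L2_space M \<Longrightarrow> v \<in> L2_space M \<Longrightarrow> coeffs (\<lambda>x. u x + v x) = coeffs u + coeffs v"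
  by (rule ell2_eqI) (simp add: coord_coeffs L2_space_add L2_ip_add_left e_L2)

lemma coeffs_diff: "u \<in> L2_space M \<Longrightarrow> v \<in> L2_space M \<Longrightarrow> coeffs (\<lambda>x. u x - v x) = coeffs u - coeffs v"
  by (rule ell2_eqI) (simp add: coord_coeffs L2_space_diff L2_ip_diff_left e_L2)

lemma coeffs_cmult: "u \<in> L2_space M \<Longrightarrow> coeffs (\<lambda>x. c * u x) = cscale c (coeffs u)"
  by (rule ell2_eqI) (simp add: coord_coeffs L2_space_cmult L2_ip_cmult_left)

lemma coeffs_sum:
  "(\<And>k. k \<in> S \<Longrightarrow> u k \<in> L2_space M) \<Longrightarrow> coeffs (\<lambda>x. \<Sum>k\<in>S. u k x) = (\<Sum>k\<in>S. coeffs (u k))"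
  by (rule ell2_eqI) (simp add: coord_coeffs L2_space_sum L2_ip_sum_left e_L2)

lemma coeffs_eq_iff:
  assumes "u \<in> L2_space M" "v \<in> L2_space M"
  shows "coeffs u = coeffs v \<longleftrightarrow> (AE x in M. u x = v x)"
proof
  assume eq: "coeffs u = coeffs v"
  have "AE x in M. u x - v x = 0"
    by (rule total) (use assms eq in \<open>simp_all add: L2_space_diff L2_ip_diff_left e_L2 flip: coord_coeffs\<close>)
  then show "AE x in M. u x = v x" by simp
next
  assume "AE x in M. u x = v x"
  then have "L2_ip M u (e k) = L2_ip M v (e k)" for k
    unfolding L2_ip_def using L2_spaceD[OF assms(1)] L2_spaceD[OF assms(2)] L2_spaceD[OF e_L2[of k]]
    by (intro integral_cong_AE) (auto elim: eventually_mono)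
  then show "coeffs u = coeffs v" by (simp add: coeffs_def)
qed

theorem parseval_norm: assumes u: "u \<in> L2_space M" shows "L2_sq M u = (norm (coeffs u))\<^sup>2"
proof -
  obtain S where S: "(\<lambda>a. lim (\<lambda>n. partial_sum (coord (coeffs u)) (S n) a)) \<in> L2_space M"
    "coeffs (\<lambda>a. lim (\<lambda>n. partial_sum (coord (coeffs u)) (S n) a)) = coeffs u"
    "L2_sq M (\<lambda>a. lim (\<lambda>n. partial_sum (coord (coeffs u)) (S n) a)) = (norm (coeffs u))\<^sup>2"
    by (rule synthesis[of "coeffs u"], rule that)
  have "AE x in M. u x = (\<lambda>a. lim (\<lambda>n. partial_sum (coord (coeffs u)) (S n) a)) x"
    using coeffs_eq_iff[OF u S(1)] S(2) by simp
  from L2_sq_cong[OF this u S(1)] S(3) show ?thesis by simp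
qed

text \<open>By polarisation of \<open>parseval_norm\<close>; the imaginary part is the real part after replacing \<open>v\<close> by
\<open>\<i> v\<close>.\<close>

theorem parseval:
  assumes u: "u \<in> L2_space M" and v: "v \<in> L2_space M"
  shows "L2_ip M u v = cinner (coeffs u) (coeffs v)"
proof -
  have Re: "Re (L2_ip M u v) = inner (coeffs u) (coeffs v)" if u: "u \<in> L2_space M" and v: "v \<in> L2_space M" for u v
  proof -
    have "L2_ip M (\<lambda>x. u x - v x) (\<lambda>x. u x - v x) = L2_ip M u u - L2_ip M u v - (L2_ip M v u - L2_ip M v v)"
      by (simp add: L2_ip_diff_left L2_ip_diff_right u v L2_space_diff)
    then have "L2_sq M (\<lambda>x. u x - v x) = L2_sq M u - 2 * Re (L2_ip M u v) + L2_sq M v"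
      unfolding L2_ip_self L2_ip_commute[of M v u] by (simp add: complex_eq_iff)
    moreover have "L2_sq M (\<lambda>x. u x - v x) = (norm (coeffs u - coeffs v))\<^sup>2"
      using parseval_norm[OF L2_space_diff[OF u v]] coeffs_diff[OF u v] by simp
    ultimately show ?thesis
      unfolding parseval_norm[OF u] parseval_norm[OF v] power2_norm_eq_inner
      by (simp add: inner_diff_left inner_diff_right inner_commute)
  qed
  have "Im (L2_ip M u v) = Re (L2_ip M u (\<lambda>x. \<i> * v x))"
    unfolding L2_ip_commute[of M _ "\<lambda>x. \<i> * v x"] L2_ip_cmult_left L2_ip_commute[of M u v] by simp
  then show ?thesis
    using Re[OF u v] Re[OF u L2_space_cmult[OF v, of \<i>]]
    by (simp add: cinner_eq coeffs_cmult v complex_eq_iff)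
qed

end

section \<open>The period cell and periodic functions\<close>

abbreviation torus :: "(real^'d) measure" where "torus \<equiv> lebesgue_on cell"

lemma cell_borel: "(cell :: (real^'d) set) \<in> sets borel"
proof -
  have "(cell :: (real^'d) set) = (\<Inter>i. {y. 0 \<le> y $ i} \<inter> {y. y $ i < 2 * pi})"
    by (auto simp: cell_def)
  also have "\<dots> \<in> sets borel"
  proof (intro sets.finite_INT sets.Int)
    fix i
    show "{y::real^'d. 0 \<le> y $ i} \<in> sets borel"
      by (intro borel_closed closed_Collect_le continuous_intros)
    show "{y::real^'d. y $ i < 2 * pi} \<in> sets borel"
      by (intro borel_open open_Collect_less continuous_intros)
  qed auto
  finally show ?thesis .
qed

lemma cell_lebesgue [measurable, simp]: "(cell :: (real^'d) set) \<in> sets lebesgue"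
  using cell_borel by auto

lemma cell_subset_cbox: "(cell :: (real^'d) set) \<subseteq> cbox 0 (\<chi> i. 2 * pi)"
  by (auto simp: cell_def mem_box_cart less_imp_le)

lemma bounded_cell: "bounded (cell :: (real^'d) set)"
  using cell_subset_cbox bounded_cbox bounded_subset by blast

lemma cell_lmeasurable: "(cell :: (real^'d) set) \<in> lmeasurable"
  by (intro bounded_set_imp_lmeasurable bounded_cell cell_lebesgue)

definition cell_volume :: "'d::finite itself \<Rightarrow> real" where
  "cell_volume _ = measure lebesgue (cell :: (real^'d) set)"

lemma cell_volume_pos: "cell_volume TYPE('d::finite) > 0"
proof -
  have "box 0 (\<chi> i. (1::real)) \<subseteq> (cell :: (real^'d) set)"
  proof
    fix y :: "real^'d" assume "y \<in> box 0 (\<chi> i. (1::real))"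
    then have "0 < y $ i" "y $ i < 1" for i by (auto simp: mem_box_cart)
    moreover have "1 < 2 * pi" using pi_ge_two by linarith
    ultimately show "y \<in> cell" unfolding cell_def by (smt (verit, best) mem_Collect_eq)
  qed
  then have "measure lebesgue (box 0 (\<chi> i. (1::real)) :: (real^'d) set) \<le> cell_volume TYPE('d)"
    unfolding cell_volume_def by (intro measure_mono_fmeasurable cell_lmeasurable) auto
  moreover have "measure lebesgue (box 0 (\<chi> i. (1::real)) :: (real^'d) set) > 0"
  proof -
    have "(0 :: real^'d) \<bullet> b \<le> (\<chi> i. (1::real)) \<bullet> b" "((\<chi> i. (1::real)) - (0 :: real^'d)) \<bullet> b > 0"
      if "b \<in> Basis" for b
      using that by (auto simp: Basis_vec_def inner_axis)
    then have "measure lborel (box 0 (\<chi> i. (1::real)) :: (real^'d) set) > 0"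
      by (subst measure_lborel_box_eq) (auto intro!: prod_pos)
    then show ?thesis by simp
  qed
  ultimately show ?thesis by linarith
qed

interpretation torus: finite_measure "torus :: (real^'d) measure"
  by (rule finite_measureI) (use cell_lmeasurable in
    \<open>auto simp: emeasure_restrict_space fmeasurable_def less_top[symmetric]\<close>)

lemma set_integral_cell: "(LINT y:cell|lebesgue. f y) = integral\<^sup>L torus f"
  for f :: "real^'d \<Rightarrow> 'b::{banach,second_countable_topology}"
  unfolding set_lebesgue_integral_def by (simp add: integral_restrict_space)

lemma set_integrable_cell: "set_integrable lebesgue cell f \<longleftrightarrow> integrable torus f"
  for f :: "real^'d \<Rightarrow> 'b::{banach,second_countable_topology}"
  unfolding set_integrable_def by (simp add: integrable_restrict_space)

lemma measurable_torus: "f \<in> measurable lebesgue N \<Longrightarrow> f \<in> measurable torus N"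
  by (rule measurable_restrict_space1)

lemma continuous_imp_measurable_lebesgue:
  fixes f :: "real^'d \<Rightarrow> 'b::topological_space"
  assumes "continuous_on UNIV f" shows "f \<in> borel_measurable lebesgue"
  using borel_measurable_continuous_onI[OF assms] by (simp add: measurable_completion)

lemma continuous_bounded_on_cell:
  fixes f :: "real^'d \<Rightarrow> 'b::real_normed_vector"
  assumes "continuous_on UNIV f"
  obtains C where "\<And>y. y \<in> cell \<Longrightarrow> norm (f y) \<le> C"
proof -
  have "compact (f ` cbox 0 (\<chi> i. 2 * pi))"
    by (intro compact_continuous_image continuous_on_subset[OF assms]) auto
  then obtain C where "\<forall>z \<in> f ` cbox 0 (\<chi> i. 2 * pi). norm z \<le> C"
    using compact_imp_bounded bounded_iff by metis
  then show ?thesis using cell_subset_cbox that by blast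
qed

lemma continuous_integrable_torus:
  fixes f :: "real^'d \<Rightarrow> 'b::{banach,second_countable_topology}"
  assumes "continuous_on UNIV f" shows "integrable torus f"
proof -
  obtain C where C: "\<And>y. y \<in> cell \<Longrightarrow> norm (f y) \<le> C" by (rule continuous_bounded_on_cell[OF assms], rule that)
  show ?thesis
    by (rule torus.integrable_const_bound[of _ C])
      (use C in \<open>auto intro!: measurable_torus continuous_imp_measurable_lebesgue assms simp: space_restrict_space\<close>)
qed

lemma continuous_L2_torus:
  fixes f :: "real^'d \<Rightarrow> complex"
  assumes "continuous_on UNIV f" shows "f \<in> L2_space torus"
  by (intro L2_spaceI measurable_torus continuous_imp_measurable_lebesgue continuous_integrable_torus
      continuous_intros assms)

definition lattice :: "int^'d \<Rightarrow> real^'d" where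
  "lattice p = (\<chi> i. 2 * pi * of_int (p $ i))"

definition strictly_periodic :: "(real^'d \<Rightarrow> 'b) \<Rightarrow> bool" where
  "strictly_periodic f \<longleftrightarrow> (\<forall>p y. f (y + lattice p) = f y)"

lemma strictly_periodic_imp_periodic: "strictly_periodic f \<Longrightarrow> periodic f"
  by (simp add: strictly_periodic_def periodic_def lattice_def)

text \<open>The points where a continuous function agrees with its translate form a closed set of full measure.\<close>

lemma continuous_periodic_strict:
  fixes f :: "real^'d \<Rightarrow> complex"
  assumes f: "continuous_on UNIV f" and per: "periodic f" shows "strictly_periodic f"
  unfolding strictly_periodic_def
proof (intro allI)
  fix p y
  have "closed {y. f (y + lattice p) = f y}"
    by (intro closed_Collect_eq continuous_on_compose2[OF f] continuous_intros f) auto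
  moreover have "AE y in lebesgue. y \<in> {y. f (y + lattice p) = f y}"
    using per by (simp add: periodic_def lattice_def)
  ultimately have "y \<in> {y. f (y + lattice p) = f y}" by (rule mem_closed_if_AE_lebesgue)
  then show "f (y + lattice p) = f y" by simp
qed

lemma lborel_integral_translate:
  fixes f :: "'a::euclidean_space \<Rightarrow> 'b::{banach,second_countable_topology}"
  assumes "f \<in> borel_measurable borel"
  shows "(LINT x|lborel. f (x + c)) = integral\<^sup>L lborel f"
proof -
  have "integral\<^sup>L lborel f = integral\<^sup>L (distr lborel borel ((+) c)) f" by (simp add: lborel_distr_plus)
  also have "\<dots> = (LINT x|lborel. f (c + x))" by (rule integral_distr) (use assms in auto)
  finally show ?thesis by (simp add: add.commute)
qed

lemma torus_integral_lborel:
  fixes f :: "real^'d \<Rightarrow> complex"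
  assumes "continuous_on UNIV f"
  shows "integral\<^sup>L torus f = (LINT y|lborel. indicat_real cell y *\<^sub>R f y)"
proof -
  have "integral\<^sup>L torus f = (LINT y|lebesgue. indicat_real cell y *\<^sub>R f y)"
    by (simp add: integral_restrict_space)
  also have "\<dots> = (LINT y|lborel. indicat_real cell y *\<^sub>R f y)"
    using cell_borel borel_measurable_continuous_onI[OF assms]
    by (intro integral_completion borel_measurable_scaleR borel_measurable_indicator) auto
  finally show ?thesis .
qed

text \<open>The translated cell differs from the cell by a slab that has been moved by a full period: with
\<open>A\<close> the part of the cell below height \<open>t\<close> and \<open>B\<close> the rest, the translated cell is the disjoint
union of \<open>B\<close> and of \<open>A\<close> moved by \<open>2 * pi\<close>.\<close>

lemma torus_integral_shift:
  fixes f :: "real^'d \<Rightarrow> complex"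
  assumes f: "continuous_on UNIV f" and per: "strictly_periodic f" and t: "0 \<le> t" "t \<le> 2 * pi"
  shows "(LINT y|torus. f (y + t *\<^sub>R axis j 1)) = integral\<^sup>L torus f"
proof -
  note [measurable] = borel_measurable_continuous_onI[OF f] cell_borel
  let ?a = "axis j 1 :: real^'d"
  have ax: "(y + s *\<^sub>R ?a) $ i = y $ i + (if i = j then s else 0)" for y s i
    by (simp add: axis_def)
  define B where "B = {y::real^'d. y \<in> cell \<and> t \<le> y $ j}"
  define A where "A = {y::real^'d. y \<in> cell \<and> y $ j < t}"
  have [measurable]: "{y::real^'d. t \<le> y $ j} \<in> sets borel" "{y::real^'d. y $ j < t} \<in> sets borel"
    by (auto intro!: borel_closed borel_open closed_Collect_le open_Collect_less continuous_intros)
  have "B = cell \<inter> {y. t \<le> y $ j}" "A = cell \<inter> {y. y $ j < t}" by (auto simp: A_def B_def)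
  then have [measurable]: "A \<in> sets borel" "B \<in> sets borel" by auto
  have per': "f (y + (2 * pi) *\<^sub>R ?a) = f y" for y
  proof -
    have "(2 * pi) *\<^sub>R ?a = lattice (axis j 1)"
      by (auto simp: lattice_def vec_eq_iff axis_def)
    then show ?thesis using per by (simp add: strictly_periodic_def)
  qed
  have int: "integrable lborel (\<lambda>y. indicat_real S y *\<^sub>R f y)" if S: "S \<in> sets borel" "S \<subseteq> cell" for S
  proof -
    obtain C where C: "\<And>y. y \<in> cell \<Longrightarrow> norm (f y) \<le> C" by (rule continuous_bounded_on_cell[OF f], rule that)
    have "emeasure lborel S < \<infinity>"
      by (rule emeasure_bounded_finite[OF bounded_subset[OF bounded_cell S(2)]])
    then show ?thesis
      using S C by (intro integrableI_bounded_set_indicator[where B = C]) (auto intro!: AE_I2)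
  qed
  have "(LINT y|torus. f (y + t *\<^sub>R ?a)) = (LINT y|lborel. indicat_real cell y *\<^sub>R f (y + t *\<^sub>R ?a))"
    by (rule torus_integral_lborel) (intro continuous_on_compose2[OF f] continuous_intros, auto)
  also have "\<dots> = (LINT y|lborel. (\<lambda>y. indicat_real cell (y - t *\<^sub>R ?a) *\<^sub>R f y) (y + t *\<^sub>R ?a))"
    by simp
  also have "\<dots> = (LINT y|lborel. indicat_real cell (y - t *\<^sub>R ?a) *\<^sub>R f y)"
    by (rule lborel_integral_translate) measurable
  also have "\<dots> = (LINT y|lborel. indicat_real A (y - (2 * pi) *\<^sub>R ?a) *\<^sub>R f y + indicat_real B y *\<^sub>R f y)"
    
  proof -
    have "(\<lambda>y. indicat_real cell (y - t *\<^sub>R ?a) *\<^sub>R f y)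
      = (\<lambda>y. indicat_real A (y - (2 * pi) *\<^sub>R ?a) *\<^sub>R f y + indicat_real B y *\<^sub>R f y)"
  proof
    fix y :: "real^'d"
    have sub: "y - s *\<^sub>R ?a = y + (-s) *\<^sub>R ?a" for s by simp
    have cell_iff: "y - s *\<^sub>R ?a \<in> cell \<longleftrightarrow> (\<forall>i. i \<noteq> j \<longrightarrow> 0 \<le> y $ i \<and> y $ i < 2 * pi) \<and> s \<le> y $ j \<and> y $ j < 2 * pi + s" for s
      unfolding sub cell_def mem_Collect_eq ax by (auto split: if_splits)
    have j: "(y - s *\<^sub>R ?a) $ j = y $ j - s" for s unfolding sub ax by simp
    have "indicat_real cell (y - t *\<^sub>R ?a) = indicat_real A (y - (2 * pi) *\<^sub>R ?a) + indicat_real B y"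
      using t cell_iff[of t] cell_iff[of "2 * pi"] cell_iff[of 0] unfolding A_def B_def
      by (auto simp: indicator_def j)
    then show "indicat_real cell (y - t *\<^sub>R ?a) *\<^sub>R f y
        = indicat_real A (y - (2 * pi) *\<^sub>R ?a) *\<^sub>R f y + indicat_real B y *\<^sub>R f y"
      by (simp add: scaleR_add_left)
  qed
    then show ?thesis by simp
  qed
  also have "\<dots> = (LINT y|lborel. indicat_real A (y - (2 * pi) *\<^sub>R ?a) *\<^sub>R f y) + (LINT y|lborel. indicat_real B y *\<^sub>R f y)"
  proof (rule Bochner_Integration.integral_add)
    show "integrable lborel (\<lambda>y. indicat_real B y *\<^sub>R f y)" by (rule int) (auto simp: B_def)
    have "integrable (distr lborel borel ((+) (- (2 * pi) *\<^sub>R ?a))) (\<lambda>y. indicat_real A y *\<^sub>R f y)"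
      unfolding lborel_distr_plus by (rule int) (auto simp: A_def)
    then have "integrable lborel (\<lambda>y. indicat_real A (- (2 * pi) *\<^sub>R ?a + y) *\<^sub>R f (- (2 * pi) *\<^sub>R ?a + y))"
      by (subst (asm) integrable_distr_eq) auto
    moreover have "f (- (2 * pi) *\<^sub>R ?a + y) = f y" for y
      using per'[of "- (2 * pi) *\<^sub>R ?a + y"] by simp
    ultimately show "integrable lborel (\<lambda>y. indicat_real A (y - (2 * pi) *\<^sub>R ?a) *\<^sub>R f y)"
      by (simp add: algebra_simps)
  qed
  also have "(LINT y|lborel. indicat_real A (y - (2 * pi) *\<^sub>R ?a) *\<^sub>R f y)
      = (LINT y|lborel. indicat_real A y *\<^sub>R f y)"
    using lborel_integral_translate[of "\<lambda>y. indicat_real A (y - (2 * pi) *\<^sub>R ?a) *\<^sub>R f y" "(2 * pi) *\<^sub>R ?a"]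
    by (simp add: per')
  also have "\<dots> + (LINT y|lborel. indicat_real B y *\<^sub>R f y)
      = (LINT y|lborel. indicat_real A y *\<^sub>R f y + indicat_real B y *\<^sub>R f y)"
    by (rule Bochner_Integration.integral_add[symmetric]; rule int) (auto simp: A_def B_def)
  also have "\<dots> = (LINT y|lborel. indicat_real cell y *\<^sub>R f y)"
    by (rule Bochner_Integration.integral_cong) (auto simp: A_def B_def indicator_def)
  finally show ?thesis by (simp add: torus_integral_lborel[OF f])
qed

text \<open>Integrals over the cell are invariant under translation, so all difference quotients have integral
zero; the mean value inequality dominates them.  This replaces integration by parts and gives
the orthogonality of plane waves.\<close>

lemma torus_integral_derivative:
  fixes f f' :: "real^'d \<Rightarrow> complex"
  assumes f: "continuous_on UNIV f" and f': "continuous_on UNIV f'" and per: "strictly_periodic f"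
    and deriv: "\<And>y. ((\<lambda>t. f (y + t *\<^sub>R axis j 1)) has_vector_derivative f' y) (at 0)"
  shows "integral\<^sup>L torus f' = 0"
proof -
  let ?a = "axis j 1 :: real^'d"
  have deriv_t: "((\<lambda>t. f (y + t *\<^sub>R ?a)) has_vector_derivative f' (y + t *\<^sub>R ?a)) (at t)" for y t
  proof -
    have "((\<lambda>s. f (y + t *\<^sub>R ?a + s *\<^sub>R ?a)) \<circ> (\<lambda>s. s - t) has_vector_derivative 1 *\<^sub>R f' (y + t *\<^sub>R ?a)) (at t)"
      by (rule vector_diff_chain_at) (auto intro!: derivative_eq_intros deriv)
    then show ?thesis by (simp add: o_def algebra_simps)
  qed
  define Q where "Q = (\<lambda>p. fst p + snd p *\<^sub>R ?a) ` (cbox 0 (\<chi> i. 2 * pi) \<times> {0..1::real})"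
  have "compact Q"
    unfolding Q_def by (intro compact_continuous_image compact_Times continuous_intros) auto
  then have "compact (f' ` Q)"
    by (intro compact_continuous_image continuous_on_subset[OF f']) auto
  then obtain C where C: "\<forall>z \<in> f' ` Q. norm z \<le> C"
    using compact_imp_bounded bounded_iff by metis
  define h where "h n = 1 / real (Suc n)" for n
  have h: "0 < h n" "h n \<le> 1" for n by (auto simp: h_def)
  have h0: "h \<longlonglongrightarrow> 0" unfolding h_def by (rule LIMSEQ_Suc[OF lim_1_over_n])
  let ?q = "\<lambda>n y. (f (y + h n *\<^sub>R ?a) - f y) /\<^sub>R h n"
  have shift_cont: "continuous_on UNIV (\<lambda>y. f (y + s *\<^sub>R ?a))" for s
    by (intro continuous_on_compose2[OF f] continuous_intros) auto
  have q0: "integral\<^sup>L torus (?q n) = 0" for n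
  proof -
    have "integral\<^sup>L torus (?q n) = (integral\<^sup>L torus (\<lambda>y. f (y + h n *\<^sub>R ?a)) - integral\<^sup>L torus f) /\<^sub>R h n"
      by (simp add: Bochner_Integration.integral_diff continuous_integrable_torus f shift_cont)
    also have "integral\<^sup>L torus (\<lambda>y. f (y + h n *\<^sub>R ?a)) = integral\<^sup>L torus f"
      by (rule torus_integral_shift[OF f per]) (use h[of n] pi_ge_two in linarith)+
    finally show ?thesis by simp
  qed
  have "(\<lambda>n. integral\<^sup>L torus (?q n)) \<longlonglongrightarrow> integral\<^sup>L torus f'"
  proof (rule integral_dominated_convergence[where w = "\<lambda>_. C"])
    show "f' \<in> borel_measurable torus"
      by (intro measurable_torus continuous_imp_measurable_lebesgue f')
    show "?q n \<in> borel_measurable torus" for n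
      by (intro measurable_torus continuous_imp_measurable_lebesgue continuous_intros shift_cont f)
    show "AE y in torus. (\<lambda>n. ?q n y) \<longlonglongrightarrow> f' y"
    proof (rule AE_I2)
      fix y
      show "(\<lambda>n. ?q n y) \<longlonglongrightarrow> f' y"
      proof (rule LIMSEQ_I)
        fix r :: real assume "r > 0"
        then obtain d where d: "d > 0" "\<And>t. \<lbrakk>0 < norm (t - 0); norm (t - 0) < d\<rbrakk> \<Longrightarrow>
            norm (f (y + t *\<^sub>R ?a) - f (y + 0 *\<^sub>R ?a) - (t - 0) *\<^sub>R f' y) / norm (t - 0) < r"
          using deriv[of y] unfolding has_vector_derivative_def has_derivative_at' by metis
        obtain N where N: "\<And>n. n \<ge> N \<Longrightarrow> norm (h n - 0) < d"
          using LIMSEQ_D[OF h0 d(1)] by auto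
        have "norm (?q n y - f' y) < r" if "n \<ge> N" for n
        proof -
          have "?q n y - f' y = (f (y + h n *\<^sub>R ?a) - f y - h n *\<^sub>R f' y) /\<^sub>R h n"
            using h[of n] by (simp add: scaleR_diff_right)
          then show ?thesis
            using d(2)[of "h n"] N[OF that] h[of n] by (simp add: divide_inverse mult.commute)
        qed
        then show "\<exists>N. \<forall>n\<ge>N. norm (?q n y - f' y) < r" by blast
      qed
    qed
    show "AE y in torus. norm (?q n y) \<le> C" for n
    proof (rule AE_I2)
      fix y :: "real^'d" assume "y \<in> space torus"
      then have y: "y \<in> cbox 0 (\<chi> i. 2 * pi)" using cell_subset_cbox by (auto simp: space_restrict_space)
      have "norm (f (y + h n *\<^sub>R ?a) - f (y + 0 *\<^sub>R ?a)) \<le> C * norm (h n - 0)"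
      proof (rule differentiable_bound[where S = "{0..h n}" and f = "\<lambda>t. f (y + t *\<^sub>R ?a)"
            and f' = "\<lambda>t s. s *\<^sub>R f' (y + t *\<^sub>R ?a)"])
        fix t assume t: "t \<in> {0..h n}"
        show "((\<lambda>t. f (y + t *\<^sub>R ?a)) has_derivative (\<lambda>s. s *\<^sub>R f' (y + t *\<^sub>R ?a))) (at t within {0..h n})"
          using deriv_t[of y t] unfolding has_vector_derivative_def by (rule has_derivative_at_withinI)
        have "y + t *\<^sub>R ?a \<in> Q"
          unfolding Q_def by (rule image_eqI[of _ _ "(y, t)"]) (use y t h[of n] in auto)
        then have "norm (f' (y + t *\<^sub>R ?a)) \<le> C" using C by auto
        then show "onorm (\<lambda>s. s *\<^sub>R f' (y + t *\<^sub>R ?a)) \<le> C"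
          by (simp add: onorm_scaleR_left[OF bounded_linear_ident] onorm_id)
      qed (use h[of n] in auto)
      then have "norm (f (y + h n *\<^sub>R ?a) - f y) / h n \<le> C"
        using h[of n] by (simp add: pos_divide_le_eq)
      then show "norm (?q n y) \<le> C"
        using h[of n] by (simp add: divide_inverse mult.commute)
    qed
  qed auto
  then show ?thesis unfolding q0 LIMSEQ_const_iff by simp
qed

lemma AE_translate:
  fixes c :: "real^'d"
  assumes "AE y in lebesgue. P y" shows "AE y in lebesgue. P (y + c)"
proof -
  obtain N where N: "N \<in> null_sets lborel" "{y. \<not> P y} \<subseteq> N"
    using assms unfolding eventually_ae_filter
    by (auto simp: null_sets_completion_iff2)
  have "{y. y - (- c) \<in> N} \<in> null_sets lborel" by (rule null_sets_translation[OF N(1)])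
  then have "{y. y - (- c) \<in> N} \<in> null_sets lebesgue" by (rule null_sets_completionI)
  then show ?thesis
    by (rule AE_I') (use N(2) in auto)
qed

lemma cell_translate_cover: "\<exists>p. (y :: real^'d) + lattice p \<in> cell"
proof
  let ?p = "(\<chi> i. - \<lfloor>y $ i / (2 * pi)\<rfloor>) :: int^'d"
  show "y + lattice ?p \<in> cell"
    unfolding cell_def
  proof (intro CollectI allI)
    fix i
    have "2 * pi * of_int \<lfloor>y $ i / (2 * pi)\<rfloor> \<le> 2 * pi * (y $ i / (2 * pi))"
      by (rule mult_left_mono[OF of_int_floor_le]) simp
    moreover have "2 * pi * (y $ i / (2 * pi)) < 2 * pi * (of_int \<lfloor>y $ i / (2 * pi)\<rfloor> + 1)"
      by (rule mult_strict_left_mono[OF real_of_int_floor_add_one_gt]) simp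
    moreover have "2 * pi * (y $ i / (2 * pi)) = y $ i" by simp
    ultimately have "2 * pi * of_int \<lfloor>y $ i / (2 * pi)\<rfloor> \<le> y $ i"
      "y $ i < 2 * pi * (of_int \<lfloor>y $ i / (2 * pi)\<rfloor> + 1)" by linarith+
    then show "0 \<le> (y + lattice ?p) $ i \<and> (y + lattice ?p) $ i < 2 * pi"
      by (simp add: lattice_def algebra_simps)
  qed
qed

lemma countable_int_vec: "countable (UNIV :: (int^'d) set)"
proof -
  have "inj (\<lambda>p::int^'d. ($) p)" by (auto intro!: injI simp: vec_eq_iff)
  moreover have "countable (range (\<lambda>p::int^'d. ($) p))"
    by (rule countable_subset[OF subset_UNIV]) simp
  ultimately show ?thesis using countable_image_inj_eq by blast
qed

lemma AE_torus_iff: "(AE y in torus. P y) \<longleftrightarrow> (AE y in lebesgue. y \<in> cell \<longrightarrow> P y)"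
  by (rule AE_restrict_space_iff) simp

text \<open>Countably many translates of the cell cover the space, and translates of null sets are null.\<close>

lemma periodic_AE_torus_zero:
  fixes u :: "real^'d \<Rightarrow> complex"
  assumes per: "periodic u" and zero: "AE y in torus. u y = 0"
  shows "AE y in lebesgue. u y = 0"
proof -
  have 0: "AE y in lebesgue. y \<in> cell \<longrightarrow> u y = 0" using zero unfolding AE_torus_iff .
  have "AE y in lebesgue. \<forall>p\<in>UNIV. (y + lattice p \<in> cell \<longrightarrow> u (y + lattice p) = 0) \<and> u (y + lattice p) = u y"
    unfolding AE_ball_countable[OF countable_int_vec]
  proof
    fix p
    show "AE y in lebesgue. (y + lattice p \<in> cell \<longrightarrow> u (y + lattice p) = 0) \<and> u (y + lattice p) = u y"
      using AE_translate[OF 0, of "lattice p"] per[unfolded periodic_def, rule_format, of p]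
      by (simp add: lattice_def)
  qed
  then show ?thesis
  proof eventually_elim
    case (elim y)
    obtain p where "y + lattice p \<in> cell" using cell_translate_cover by blast
    then show ?case using elim by fastforce
  qed
qed

section \<open>Plane waves and their totality\<close>

definition phase :: "int^'d \<Rightarrow> real^'d \<Rightarrow> real" where
  "phase k y = (\<Sum>i\<in>UNIV. of_int (k $ i) * y $ i)"

definition plane_wave :: "int^'d \<Rightarrow> real^'d \<Rightarrow> complex" where
  "plane_wave k y = exp (\<i> * of_real (phase k y))"

lemma phase_add_point: "phase k (y + z) = phase k y + phase k z"
  by (simp add: phase_def algebra_simps sum.distrib)

lemma plane_wave_mult: "plane_wave k y * plane_wave l y = plane_wave (k + l) y"
  by (simp add: plane_wave_def phase_def algebra_simps sum.distrib exp_add[symmetric])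

lemma plane_wave_cnj: "cnj (plane_wave k y) = plane_wave (- k) y"
  by (simp add: plane_wave_def phase_def exp_cnj sum_negf)

lemma plane_wave_zero [simp]: "plane_wave 0 y = 1"
  by (simp add: plane_wave_def phase_def)

lemma continuous_plane_wave [continuous_intros]: "continuous_on S (plane_wave k)"
  unfolding plane_wave_def[abs_def] phase_def by (intro continuous_intros)

lemma strictly_periodic_plane_wave: "strictly_periodic (plane_wave k)"
  unfolding strictly_periodic_def
proof (intro allI)
  fix p y
  define n where "n = (\<Sum>i\<in>UNIV. k $ i * p $ i)"
  have "phase k (lattice p) = 2 * pi * of_int n"
    by (simp add: phase_def lattice_def n_def sum_distrib_left mult_ac)
  then have "plane_wave k (y + lattice p) = plane_wave k y * exp (\<i> * of_real (2 * pi * of_int n))"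
    by (simp add: plane_wave_def phase_add_point ring_distribs exp_add)
  also have "exp (\<i> * of_real (2 * pi * of_int n)) = 1"
    using exp_integer_2pi[OF Ints_of_int[of n]] by (simp add: mult_ac)
  finally show "plane_wave k (y + lattice p) = plane_wave k y" by simp
qed

lemma plane_wave_has_vector_derivative:
  "((\<lambda>t. plane_wave k (y + t *\<^sub>R axis j 1)) has_vector_derivative \<i> * of_int (k $ j) * plane_wave k y) (at 0)"
proof -
  have "phase k (y + t *\<^sub>R axis j 1) = phase k y + t * of_int (k $ j)" for t
  proof -
    have "phase k (t *\<^sub>R axis j 1) = (\<Sum>i\<in>UNIV. if i = j then t * of_int (k $ i) else 0)"
      unfolding phase_def by (intro sum.cong) (auto simp: axis_def)
    then show ?thesis by (simp add: phase_add_point)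
  qed
  then have "(\<lambda>t. plane_wave k (y + t *\<^sub>R axis j 1))
      = (\<lambda>t. plane_wave k y * exp (\<i> * of_int (k $ j) * of_real t))"
    by (auto simp: plane_wave_def algebra_simps exp_add[symmetric])
  moreover have "((\<lambda>t. plane_wave k y * exp (\<i> * of_int (k $ j) * of_real t)) has_vector_derivative
      \<i> * of_int (k $ j) * plane_wave k y) (at 0)"
    by (rule has_vector_derivative_real_field) (auto intro!: derivative_eq_intros)
  ultimately show ?thesis by simp
qed

lemma partial_deriv_plane_wave:
  "partial_deriv j (\<lambda>y. c * plane_wave k y) = (\<lambda>y. (\<i> * of_int (k $ j) * c) * plane_wave k y)"
proof
  fix y
  have "((\<lambda>t. c * plane_wave k (y + t *\<^sub>R axis j 1)) has_vector_derivative
      c * (\<i> * of_int (k $ j) * plane_wave k y)) (at 0)"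
    by (rule has_vector_derivative_mult_right[OF plane_wave_has_vector_derivative])
  then show "partial_deriv j (\<lambda>y. c * plane_wave k y) y = (\<i> * of_int (k $ j) * c) * plane_wave k y"
    unfolding partial_deriv_def by (simp add: vector_derivative_at mult_ac)
qed

lemma smooth_plane_wave: "smooth (\<lambda>y. c * plane_wave k y)"
proof -
  have iter: "\<exists>b. foldr partial_deriv js (\<lambda>y. c * plane_wave k y) = (\<lambda>y. b * plane_wave k y)" for js
  proof (induction js)
    case (Cons j js)
    then show ?case using partial_deriv_plane_wave by fastforce
  qed auto
  show ?thesis
    unfolding smooth_def
  proof (intro allI conjI)
    fix js
    obtain b where b: "foldr partial_deriv js (\<lambda>y. c * plane_wave k y) = (\<lambda>y. b * plane_wave k y)"
      using iter by blast
    show "continuous_on UNIV (foldr partial_deriv js (\<lambda>y. c * plane_wave k y))"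
      unfolding b by (intro continuous_intros)
    fix j y
    have "(\<lambda>t. b * plane_wave k (y + t *\<^sub>R axis j 1)) differentiable at 0"
      using has_vector_derivative_mult_right[OF plane_wave_has_vector_derivative[of k y j], of b]
      unfolding has_vector_derivative_def differentiable_def by blast
    then show "(\<lambda>t. foldr partial_deriv js (\<lambda>y. c * plane_wave k y) (y + t *\<^sub>R axis j 1)) differentiable at 0"
      unfolding b .
  qed
qed

lemma integral_plane_wave:
  "integral\<^sup>L torus (plane_wave k) = (if k = 0 then of_real (cell_volume TYPE('d)) else 0)"
  for k :: "int^'d"
proof (cases "k = 0")
  case True
  then have "plane_wave k = (\<lambda>y. 1)" by auto
  then show ?thesis using True
    by (simp add: cell_volume_def measure_restrict_space space_restrict_space scaleR_conv_of_real)
next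
  case False
  then obtain j where j: "k $ j \<noteq> 0" by (auto simp: vec_eq_iff)
  have "integral\<^sup>L torus (\<lambda>y. \<i> * of_int (k $ j) * plane_wave k y) = 0"
    by (rule torus_integral_derivative[OF _ _ strictly_periodic_plane_wave plane_wave_has_vector_derivative])
      (intro continuous_intros)+
  then show ?thesis using j False by simp
qed

text \<open>The linear span of the plane waves, in the form in which products are easiest to handle.\<close>

inductive_set trig_polys :: "(real^'d \<Rightarrow> complex) set" where
  wave: "plane_wave k \<in> trig_polys"
| cmult: "f \<in> trig_polys \<Longrightarrow> (\<lambda>y. c * f y) \<in> trig_polys"
| add: "f \<in> trig_polys \<Longrightarrow> g \<in> trig_polys \<Longrightarrow> (\<lambda>y. f y + g y) \<in> trig_polys"

lemma trig_polys_mult: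
  assumes "f \<in> trig_polys" "g \<in> trig_polys" shows "(\<lambda>y. f y * g y) \<in> trig_polys"
  using assms(1)
proof induction
  case (wave k)
  show ?case using assms(2)
  proof induction
    case (wave l)
    have "(\<lambda>y. plane_wave k y * plane_wave l y) = plane_wave (k + l)" by (auto simp: plane_wave_mult)
    then show ?case by (simp add: trig_polys.wave)
  next
    case (cmult f c)
    from trig_polys.cmult[OF cmult.IH, of c] show ?case by (simp add: mult_ac)
  next
    case (add f g)
    from trig_polys.add[OF add.IH] show ?case by (simp add: ring_distribs)
  qed
next
  case (cmult f c)
  from trig_polys.cmult[OF cmult.IH, of c] show ?case by (simp add: mult_ac)
next
  case (add f g)
  from trig_polys.add[OF add.IH] show ?case by (simp add: ring_distribs)
qed

lemma trig_polys_const: "(\<lambda>y. c) \<in> trig_polys"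
  using trig_polys.cmult[OF trig_polys.wave[of 0], of c] by simp

lemma trig_polys_sum:
  "(\<And>a. a \<in> S \<Longrightarrow> f a \<in> trig_polys) \<Longrightarrow> (\<lambda>y. \<Sum>a\<in>S. f a y) \<in> trig_polys"
  by (induction S rule: infinite_finite_induct) (auto intro: trig_polys.add trig_polys_const)

text \<open>The quotient map onto the torus, realised inside \<open>complex^'d\<close>.  Real polynomials on that space pull
back to trigonometric polynomials, which makes the Stone--Weierstrass theorem available.\<close>

definition torus_point :: "real^'d \<Rightarrow> complex^'d" where
  "torus_point y = (\<chi> i. exp (\<i> * of_real (y $ i)))"

lemma continuous_torus_point: "continuous_on S torus_point"
  unfolding torus_point_def by (intro continuous_intros)

lemma trig_polys_coordinate:
  fixes i :: "'d::finite"
  shows "(\<lambda>y. torus_point y $ i) \<in> trig_polys" "(\<lambda>y. cnj (torus_point y $ i)) \<in> trig_polys"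
proof -
  have "phase (axis i 1) y = y $ i" for y :: "real^'d"
  proof -
    have "phase (axis i 1) y = (\<Sum>l\<in>UNIV. if l = i then y $ l else 0)"
      unfolding phase_def by (intro sum.cong) (auto simp: axis_def)
    then show ?thesis by simp
  qed
  then have "torus_point y $ i = plane_wave (axis i 1) y" for y
    by (simp add: torus_point_def plane_wave_def)
  then show "(\<lambda>y. torus_point y $ i) \<in> trig_polys" "(\<lambda>y. cnj (torus_point y $ i)) \<in> trig_polys"
    using trig_polys.wave by (simp_all add: plane_wave_cnj)
qed

lemma trig_polys_linear:
  fixes f :: "complex^'d \<Rightarrow> real"
  assumes "bounded_linear f" shows "(\<lambda>y. complex_of_real (f (torus_point y))) \<in> trig_polys"
proof -
  interpret bounded_linear f by fact
  have expand: "f z = (\<Sum>i\<in>UNIV. Re (z $ i) * f (axis i 1) + Im (z $ i) * f (axis i \<i>))" for z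
  proof -
    have "z = (\<Sum>i\<in>UNIV. Re (z $ i) *\<^sub>R axis i 1 + Im (z $ i) *\<^sub>R axis i \<i>)"
      by (simp add: vec_eq_iff axis_def complex_eq_iff if_distrib cong: if_cong)
    then have "f z = f (\<Sum>i\<in>UNIV. Re (z $ i) *\<^sub>R axis i 1 + Im (z $ i) *\<^sub>R axis i \<i>)" by (rule arg_cong)
    also have "\<dots> = (\<Sum>i\<in>UNIV. Re (z $ i) * f (axis i 1) + Im (z $ i) * f (axis i \<i>))"
      by (simp add: sum add scaleR)
    finally show ?thesis .
  qed
  have ReIm: "complex_of_real (Re w) = (1/2) * (w + cnj w)"
    "complex_of_real (Im w) = (- \<i> / 2) * (w + (-1) * cnj w)" for w
    by (auto simp: complex_eq_iff)
  have "(\<lambda>y. complex_of_real (f (torus_point y))) = (\<lambda>y. \<Sum>i\<in>UNIV.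
      f (axis i 1) * ((1/2) * (torus_point y $ i + cnj (torus_point y $ i)))
      + f (axis i \<i>) * ((- \<i> / 2) * (torus_point y $ i + (-1) * cnj (torus_point y $ i))))"
    unfolding expand[of "torus_point _"] of_real_sum of_real_add of_real_mult ReIm
    by (simp only: mult.commute)
  also have "\<dots> \<in> trig_polys"
    by (intro trig_polys_sum trig_polys.add trig_polys.cmult trig_polys_coordinate)
  finally show ?thesis .
qed

lemma trig_polys_polynomial:
  assumes "real_polynomial_function p" shows "(\<lambda>y. complex_of_real (p (torus_point y))) \<in> trig_polys"
  using assms
proof induction
  case (linear f)
  then show ?case by (rule trig_polys_linear)
qed (auto intro: trig_polys_const trig_polys.add trig_polys_mult)

lemma trig_polys_continuous: "f \<in> trig_polys \<Longrightarrow> continuous_on UNIV f"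
  by (induction rule: trig_polys.induct) (auto intro!: continuous_intros)

lemma bounded_mult_integrable_torus:
  fixes u :: "real^'d \<Rightarrow> complex"
  assumes u: "u \<in> L2_space torus" and f: "continuous_on UNIV f"
  shows "integrable torus (\<lambda>y. u y * f y)"
proof -
  have "integrable torus (\<lambda>y. u y * cnj (cnj (f y)))"
    by (intro L2_ip_integrable u continuous_L2_torus continuous_intros f)
  then show ?thesis by simp
qed

lemma integral_trig_poly_zero:
  fixes u :: "real^'d \<Rightarrow> complex"
  assumes u: "u \<in> L2_space torus" and zero: "\<And>k. (LINT y|torus. u y * plane_wave k y) = 0"
    and "f \<in> trig_polys"
  shows "(LINT y|torus. u y * f y) = 0"
  using assms(3)
proof induction
  case (wave k)
  show ?case by (rule zero)
next
  case (cmult f c)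
  have "(LINT y|torus. u y * (c * f y)) = (LINT y|torus. c * (u y * f y))"
    by (simp only: mult.left_commute)
  then show ?case using cmult.IH by simp
next
  case (add f g)
  have "(LINT y|torus. u y * (f y + g y)) = (LINT y|torus. u y * f y) + (LINT y|torus. u y * g y)"
    using add.hyps by (simp add: ring_distribs Bochner_Integration.integral_add
        bounded_mult_integrable_torus u trig_polys_continuous)
  then show ?case using add.IH by simp
qed

lemma L1_torus:
  assumes "u \<in> L2_space torus" shows "integrable torus u"
  using torus.L1_bound(1)[OF assms zero_less_one] L2_spaceD[OF assms] by (simp add: integrable_norm_iff)

lemma compact_range_torus_point: "compact (range torus_point :: (complex^'d) set)"
proof -
  have per: "torus_point (y + lattice p) = torus_point y" for p and y :: "real^'d"
    unfolding torus_point_def vec_eq_iff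
  proof (intro allI)
    fix i
    have "exp (\<i> * of_real (2 * pi * of_int (p $ i))) = 1"
      using exp_integer_2pi[OF Ints_of_int[of "p $ i"]] by (simp add: mult_ac)
    then show "(\<chi> i. exp (\<i> * complex_of_real ((y + lattice p) $ i))) $ i = (\<chi> i. exp (\<i> * complex_of_real (y $ i))) $ i"
      by (simp add: lattice_def ring_distribs exp_add)
  qed
  have "torus_point y \<in> (torus_point ` cbox 0 (\<chi> i. 2 * pi) :: (complex^'d) set)" for y
  proof -
    obtain p where "y + lattice p \<in> cell" using cell_translate_cover by blast
    then have "torus_point (y + lattice p) \<in> (torus_point ` cbox 0 (\<chi> i. 2 * pi) :: (complex^'d) set)"
      using cell_subset_cbox by blast
    then show ?thesis by (simp add: per)
  qed
  then have "range torus_point = (torus_point ` cbox 0 (\<chi> i. 2 * pi) :: (complex^'d) set)"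
    by auto
  then show ?thesis by (simp add: compact_continuous_image continuous_torus_point)
qed

lemma inj_on_torus_point: "inj_on (torus_point :: real^'d \<Rightarrow> _) cell"
proof (rule inj_onI)
  fix y z :: "real^'d" assume yz: "y \<in> cell" "z \<in> cell" "torus_point y = torus_point z"
  have "y $ i = z $ i" for i
  proof -
    have "exp (\<i> * of_real (y $ i)) = exp (\<i> * of_real (z $ i))"
      using arg_cong[OF yz(3), of "\<lambda>v. v $ i"] by (simp add: torus_point_def)
    then obtain n :: int where "\<i> * of_real (y $ i) = \<i> * of_real (z $ i) + (of_int (2 * n) * pi) * \<i>"
      unfolding exp_eq by blast
    then have "Im (\<i> * of_real (y $ i)) = Im (\<i> * of_real (z $ i) + (of_int (2 * n) * pi) * \<i>)"
      by (rule arg_cong)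
    then have n: "y $ i = z $ i + 2 * pi * of_int n" by simp
    have b: "0 \<le> y $ i" "y $ i < 2 * pi" "0 \<le> z $ i" "z $ i < 2 * pi"
      using yz by (auto simp: cell_def)
    have "2 * pi * of_int n < 2 * pi * 1" "2 * pi * (- 1) < 2 * pi * of_int n"
      using n b by linarith+
    then have "real_of_int n < 1" "- 1 < real_of_int n"
      by (simp_all only: mult_less_cancel_left_pos pi_gt_zero zero_less_mult_iff zero_less_numeral simp_thms)
    then have "n = 0" by linarith
    then show ?thesis using n by simp
  qed
  then show "y = z" by (simp add: vec_eq_iff)
qed

lemma integral_continuous_on_torus_zero:
  fixes u :: "real^'d \<Rightarrow> complex" and g :: "complex^'d \<Rightarrow> real"
  assumes u: "u \<in> L2_space torus" and zero: "\<And>k. (LINT y|torus. u y * plane_wave k y) = 0"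
    and g: "continuous_on UNIV g"
  shows "(LINT y|torus. u y * of_real (g (torus_point y))) = 0"
proof -
  let ?I = "LINT y|torus. cmod (u y)"
  have gE: "continuous_on UNIV (\<lambda>y::real^'d. complex_of_real (g (torus_point y)))"
    by (intro continuous_intros continuous_on_compose2[OF g] continuous_torus_point) auto
  have key: "cmod (LINT y|torus. u y * of_real (g (torus_point y))) \<le> e * ?I" if "e > 0" for e
  proof -
    obtain p where p: "real_polynomial_function p" "\<And>z. z \<in> range torus_point \<Longrightarrow> \<bar>g z - p z\<bar> < e"
      by (rule Stone_Weierstrass_real_polynomial_function[OF compact_range_torus_point
            continuous_on_subset[OF g] \<open>e > 0\<close>]) auto
    note trig = trig_polys_polynomial[OF p(1)]
    have pE: "continuous_on UNIV (\<lambda>y::real^'d. complex_of_real (p (torus_point y)))"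
      by (rule trig_polys_continuous[OF trig])
    have "(LINT y|torus. u y * of_real (g (torus_point y)))
        = (LINT y|torus. u y * of_real (g (torus_point y))) - (LINT y|torus. u y * of_real (p (torus_point y)))"
      using integral_trig_poly_zero[OF u zero trig] by simp
    also have "\<dots> = (LINT y|torus. u y * of_real (g (torus_point y)) - u y * of_real (p (torus_point y)))"
      by (intro Bochner_Integration.integral_diff[symmetric] bounded_mult_integrable_torus u gE pE)
    also have "\<dots> = (LINT y|torus. u y * of_real (g (torus_point y) - p (torus_point y)))"
      by (simp add: ring_distribs)
    also have "cmod \<dots> \<le> (LINT y|torus. cmod (u y * of_real (g (torus_point y) - p (torus_point y))))"
      by (rule integral_norm_bound)
    also have "\<dots> \<le> (LINT y|torus. e * cmod (u y))"
    proof (rule integral_mono)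
      have "integrable torus (\<lambda>y. u y * (of_real (g (torus_point y)) - of_real (p (torus_point y))))"
        by (intro bounded_mult_integrable_torus u continuous_intros gE pE)
      then show "integrable torus (\<lambda>y. cmod (u y * of_real (g (torus_point y) - p (torus_point y))))"
        by (intro integrable_norm) simp
      show "integrable torus (\<lambda>y. e * cmod (u y))"
        by (intro integrable_mult_right integrable_norm L1_torus u)
      show "cmod (u y * of_real (g (torus_point y) - p (torus_point y))) \<le> e * cmod (u y)" for y
        using mult_left_mono[OF less_imp_le[OF p(2)[of "torus_point y"]] norm_ge_zero[of "u y"]]
        by (simp only: norm_mult norm_of_real mult.commute[of e] rangeI)
    qed
    finally show ?thesis by simp
  qed
  have I: "?I \<ge> 0" by (rule Bochner_Integration.integral_nonneg) simp
  have "cmod (LINT y|torus. u y * of_real (g (torus_point y))) \<le> 0 + e" if e: "e > 0" for e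
  proof -
    have "e / (?I + 1) > 0" using I e by (intro divide_pos_pos) linarith+
    from key[OF this]
    have "cmod (LINT y|torus. u y * of_real (g (torus_point y))) \<le> e / (?I + 1) * ?I" .
    also have "\<dots> \<le> e / (?I + 1) * (?I + 1)"
      using \<open>e / (?I + 1) > 0\<close> by (intro mult_left_mono) auto
    also have "\<dots> = 0 + e"
    proof -
      have "?I + 1 \<noteq> 0" using I by linarith
      then show ?thesis by simp
    qed
    finally show ?thesis .
  qed
  then have "cmod (LINT y|torus. u y * of_real (g (torus_point y))) \<le> 0"
    by (rule field_le_epsilon)
  then show ?thesis by simp
qed

text \<open>The functions \<open>max 0 (1 - n dist(z, C))\<close> decrease to the indicator of \<open>C\<close>, the image of \<open>T\<close>.
The map \<open>torus_point\<close> is injective on the half-open cell, so the indicator pulls back to that of \<open>T\<close>.\<close>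

lemma integral_compact_zero:
  fixes u :: "real^'d \<Rightarrow> complex"
  assumes u: "u \<in> L2_space torus" and zero: "\<And>k. (LINT y|torus. u y * plane_wave k y) = 0"
    and T: "compact T" "T \<subseteq> cell" "T \<noteq> {}"
  shows "(LINT y|torus. indicat_real T y *\<^sub>R u y) = 0"
proof -
  \<comment> \<open>Nonemptiness of \<open>T\<close> matters: \<open>infdist\<close> to the empty set is zero by convention.\<close>
  define C where "C = torus_point ` T"
  have C: "compact C" "C \<noteq> {}"
    unfolding C_def using T by (auto intro!: compact_continuous_image continuous_torus_point)
  define g where "g n z = max 0 (1 - real n * infdist z C)" for n z
  have gcont: "continuous_on UNIV (g n)" for n
    unfolding g_def by (intro continuous_intros)
  have gE: "continuous_on UNIV (\<lambda>y::real^'d. complex_of_real (g n (torus_point y)))" for n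
    by (intro continuous_intros continuous_on_compose2[OF gcont] continuous_torus_point) auto
  have lim: "(\<lambda>n. g n (torus_point y)) \<longlonglongrightarrow> indicat_real T y" if y: "y \<in> cell" for y
  proof (cases "y \<in> T")
    case True
    then have "infdist (torus_point y) C = 0" unfolding C_def by (intro infdist_zero) auto
    then show ?thesis using True by (simp add: g_def)
  next
    case False
    have "torus_point y \<notin> C"
      using False inj_on_image_mem_iff[OF inj_on_torus_point y T(2)] by (simp add: C_def)
    then have pos: "infdist (torus_point y) C > 0"
      by (rule infdist_pos_not_in_closed[OF compact_imp_closed[OF C(1)] C(2)])
    from reals_Archimedean3[OF this, rule_format, of 1]
    obtain N where N: "1 < real N * infdist (torus_point y) C" by (rule exE)
    have "g n (torus_point y) = 0" if "n \<ge> N" for n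
    proof -
      have "real N * infdist (torus_point y) C \<le> real n * infdist (torus_point y) C"
        using that pos by (intro mult_right_mono) auto
      then show ?thesis using N by (simp add: g_def)
    qed
    then have "(\<lambda>n. g n (torus_point y)) \<longlonglongrightarrow> 0"
      by (intro tendsto_eventually eventually_sequentiallyI)
    then show ?thesis using False by simp
  qed
  have "(\<lambda>n. LINT y|torus. u y * of_real (g n (torus_point y))) \<longlonglongrightarrow> (LINT y|torus. u y * of_real (indicat_real T y))"
  proof (rule integral_dominated_convergence[where w = "\<lambda>y. cmod (u y)"])
    have "T \<in> sets lebesgue" using T(1) by (simp add: compact_imp_closed)
    then have "(\<lambda>y. indicat_real T y) \<in> borel_measurable torus" by (intro measurable_torus) auto
    then show "(\<lambda>y. u y * of_real (indicat_real T y)) \<in> borel_measurable torus"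
      using L2_spaceD[OF u] by measurable
    show "(\<lambda>y. u y * of_real (g n (torus_point y))) \<in> borel_measurable torus" for n
      by (intro borel_measurable_integrable bounded_mult_integrable_torus u gE)
    show "integrable torus (\<lambda>y. cmod (u y))" by (intro integrable_norm L1_torus u)
    show "AE y in torus. (\<lambda>n. u y * of_real (g n (torus_point y))) \<longlonglongrightarrow> u y * of_real (indicat_real T y)"
      by (intro AE_I2 tendsto_intros lim) (simp add: space_restrict_space)
    show "AE y in torus. norm (u y * of_real (g n (torus_point y))) \<le> cmod (u y)" for n
      by (intro AE_I2) (auto simp: norm_mult g_def infdist_nonneg intro!: mult_left_le)
  qed
  then have "(LINT y|torus. u y * of_real (indicat_real T y)) = 0"
    unfolding integral_continuous_on_torus_zero[OF u zero gcont] LIMSEQ_const_iff by simp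
  then show ?thesis by (simp add: scaleR_conv_of_real mult.commute)
qed

text \<open>By inner regularity the set where \<open>w > 0\<close> is filled up to arbitrarily small measure by compact
sets, each of which is null because a positive function has integral zero on it.\<close>

lemma AE_nonpos_if_compact_integrals_zero:
  fixes w :: "real^'d \<Rightarrow> real"
  assumes w: "integrable torus w"
    and zero: "\<And>T. \<lbrakk>compact T; T \<subseteq> cell; T \<noteq> {}\<rbrakk> \<Longrightarrow> (LINT y|torus. indicat_real T y *\<^sub>R w y) = 0"
  shows "AE y in torus. w y \<le> 0"
proof -
  define S where "S = {y \<in> cell. w y > 0}"
  have "{y \<in> space torus. w y > 0} \<in> sets torus"
    using borel_measurable_integrable[OF w] by measurable
  then have S: "S \<in> sets lebesgue"
    by (simp add: S_def space_restrict_space sets_restrict_space_iff)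
  have "emeasure lebesgue S \<le> 0 + ennreal e" if "e > 0" for e
  proof -
    obtain T where T: "closed T" "T \<subseteq> S" "emeasure lebesgue (S - T) < ennreal e"
      by (rule sets_lebesgue_inner_closed[OF S \<open>e > 0\<close>], rule that)
    have Tc: "T \<subseteq> cell" using T(2) by (auto simp: S_def)
    then have comp: "compact T" using T(1) bounded_subset[OF bounded_cell] compact_eq_bounded_closed by blast
    have Tm: "T \<in> sets lebesgue" using T(1) by simp
    have T0: "emeasure lebesgue T = 0"
    proof (cases "T = {}")
      case False
      have int: "integrable torus (\<lambda>y. indicat_real T y *\<^sub>R w y)"
        by (rule integrable_mult_indicator[OF _ w]) (use Tm Tc in \<open>auto simp: sets_restrict_space_iff\<close>)
      have "AE y in torus. indicat_real T y *\<^sub>R w y = 0"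
      proof (subst integral_nonneg_eq_0_iff_AE[OF int, symmetric])
        show "AE y in torus. 0 \<le> indicat_real T y *\<^sub>R w y"
          using T(2) by (intro AE_I2) (auto simp: indicator_def S_def less_imp_le)
      qed (rule zero[OF comp Tc False])
      then have "AE y in lebesgue. y \<notin> T"
        unfolding AE_torus_iff using T(2) by (elim eventually_mono) (auto simp: indicator_def S_def split: if_splits)
      then show ?thesis using AE_iff_measurable[of T lebesgue "\<lambda>y. y \<notin> T"] Tm by auto
    qed simp
    have "emeasure lebesgue S \<le> emeasure lebesgue (T \<union> (S - T))"
      by (intro emeasure_mono) (use S Tm in auto)
    also have "\<dots> \<le> emeasure lebesgue T + emeasure lebesgue (S - T)"
      by (intro emeasure_subadditive) (use S Tm in auto)
    also have "\<dots> \<le> 0 + ennreal e" using T0 T(3) by simp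
    finally show ?thesis .
  qed
  then have "emeasure lebesgue S \<le> 0" by (rule ennreal_le_epsilon)
  then have "emeasure lebesgue S = 0" by simp
  then have "S \<in> null_sets lebesgue" using S by auto
  then have "AE y in lebesgue. y \<notin> S" by (rule AE_not_in)
  then show ?thesis unfolding AE_torus_iff S_def by (elim eventually_mono) auto
qed

theorem plane_waves_total:
  fixes u :: "real^'d \<Rightarrow> complex"
  assumes u: "u \<in> L2_space torus" and zero: "\<And>k. (LINT y|torus. u y * plane_wave k y) = 0"
  shows "AE y in torus. u y = 0"
proof -
  note int = L1_torus[OF u]
  have T0: "(LINT y|torus. indicat_real T y *\<^sub>R u y) = 0" "integrable torus (\<lambda>y. indicat_real T y *\<^sub>R u y)"
    if "compact T" "T \<subseteq> cell" "T \<noteq> {}" for T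
    using integral_compact_zero[OF u zero that] that int
    by (auto intro!: integrable_mult_indicator simp: sets_restrict_space_iff compact_imp_closed)
  have Re0: "(LINT y|torus. indicat_real T y *\<^sub>R Re (u y)) = 0"
    and Im0: "(LINT y|torus. indicat_real T y *\<^sub>R Im (u y)) = 0" if "compact T" "T \<subseteq> cell" "T \<noteq> {}" for T
    using integral_Re[OF T0(2)[OF that]] integral_Im[OF T0(2)[OF that]] T0(1)[OF that] by simp_all
  have "AE y in torus. Re (u y) \<le> 0" "AE y in torus. - Re (u y) \<le> 0"
    "AE y in torus. Im (u y) \<le> 0" "AE y in torus. - Im (u y) \<le> 0"
    by (rule AE_nonpos_if_compact_integrals_zero; use int Re0 Im0 in simp)+
  then show ?thesis
    by eventually_elim (simp add: complex_eq_iff)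
qed

definition fourier_basis :: "int^'d \<Rightarrow> real^'d \<Rightarrow> complex" where
  "fourier_basis k y = of_real (1 / sqrt (cell_volume TYPE('d))) * plane_wave k y"

interpretation torus: orthonormal_basis "torus :: (real^'d) measure" fourier_basis
proof
  fix k l :: "int^'d"
  show L2: "fourier_basis k \<in> L2_space torus"
    unfolding fourier_basis_def[abs_def] by (intro continuous_L2_torus continuous_intros)
  have "L2_ip torus (fourier_basis k) (fourier_basis l)
      = (LINT y|torus. of_real (1 / cell_volume TYPE('d)) * plane_wave (k - l) y)"
    unfolding L2_ip_def
  proof (rule Bochner_Integration.integral_cong[OF refl])
    fix y
    have "complex_of_real (1 / sqrt (cell_volume TYPE('d))) * complex_of_real (1 / sqrt (cell_volume TYPE('d)))
        = complex_of_real (1 / cell_volume TYPE('d))"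
      unfolding of_real_mult[symmetric] using cell_volume_pos[where 'd = 'd] by simp
    then show "fourier_basis k y * cnj (fourier_basis l y) = of_real (1 / cell_volume TYPE('d)) * plane_wave (k - l) y"
      using plane_wave_mult[of k y "- l"] by (simp add: fourier_basis_def plane_wave_cnj mult_ac)
  qed
  also have "\<dots> = (if k = l then 1 else 0)"
    using cell_volume_pos[where 'd = 'd] by (simp add: integral_plane_wave)
  finally show "L2_ip torus (fourier_basis k) (fourier_basis l) = (if k = l then 1 else 0)" .
next
  fix u :: "real^'d \<Rightarrow> complex"
  assume u: "u \<in> L2_space torus" "\<And>k. L2_ip torus u (fourier_basis k) = 0"
  show "AE y in torus. u y = 0"
  proof (rule plane_waves_total[OF u(1)])
    fix k
    have "L2_ip torus u (fourier_basis (- k))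
        = (LINT y|torus. of_real (1 / sqrt (cell_volume TYPE('d))) * (u y * plane_wave k y))"
      by (simp add: L2_ip_def fourier_basis_def plane_wave_cnj mult_ac)
    then show "(LINT y|torus. u y * plane_wave k y) = 0"
      using u(2)[of "- k"] cell_volume_pos[where 'd = 'd] by simp
  qed
qed

section \<open>Sobolev spaces in Fourier coordinates\<close>

lemma L2_per_imp_L2_space: "u \<in> L2_per \<Longrightarrow> u \<in> L2_space torus"
  by (auto simp: L2_per_def set_integrable_cell intro!: L2_spaceI measurable_torus)

lemma L2_perI: "\<lbrakk>u \<in> borel_measurable lebesgue; periodic u; u \<in> L2_space torus\<rbrakk> \<Longrightarrow> u \<in> L2_per"
  by (auto simp: L2_per_def set_integrable_cell L2_space_def)

lemma L2_per_cmult: assumes "u \<in> L2_per" shows "(\<lambda>y. c * u y) \<in> L2_per"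
proof (rule L2_perI)
  show "(\<lambda>y. c * u y) \<in> borel_measurable lebesgue" using assms by (auto simp: L2_per_def)
  show "periodic (\<lambda>y. c * u y)" using assms unfolding L2_per_def periodic_def
    by (auto elim!: allE eventually_mono)
  show "(\<lambda>y. c * u y) \<in> L2_space torus" by (intro L2_space_cmult L2_per_imp_L2_space assms)
qed

lemma L2_per_add: assumes "u \<in> L2_per" "v \<in> L2_per" shows "(\<lambda>y. u y + v y) \<in> L2_per"
proof (rule L2_perI)
  show "(\<lambda>y. u y + v y) \<in> borel_measurable lebesgue" using assms by (auto simp: L2_per_def)
  show "periodic (\<lambda>y. u y + v y)" unfolding periodic_def
  proof
    fix p
    have "AE y in lebesgue. u (y + (\<chi> i. 2 * pi * real_of_int (p $ i))) = u y"
      "AE y in lebesgue. v (y + (\<chi> i. 2 * pi * real_of_int (p $ i))) = v y"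
      using assms by (auto simp: L2_per_def periodic_def)
    then show "AE y in lebesgue. u (y + (\<chi> i. 2 * pi * real_of_int (p $ i))) + v (y + (\<chi> i. 2 * pi * real_of_int (p $ i))) = u y + v y"
      by eventually_elim simp
  qed
  show "(\<lambda>y. u y + v y) \<in> L2_space torus" by (intro L2_space_add L2_per_imp_L2_space assms)
qed

lemma L2_per_diff: assumes "u \<in> L2_per" "v \<in> L2_per" shows "(\<lambda>y. u y - v y) \<in> L2_per"
  using L2_per_add[OF assms(1) L2_per_cmult[OF assms(2), of "-1"]] by simp

lemma L2_per_zero: "(\<lambda>y. 0) \<in> L2_per"
  by (rule L2_perI) (auto simp: periodic_def)

lemma L2_per_sum: "(\<And>a. a \<in> S \<Longrightarrow> u a \<in> L2_per) \<Longrightarrow> (\<lambda>y. \<Sum>a\<in>S. u a y) \<in> L2_per"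
  by (induction S rule: infinite_finite_induct) (auto intro: L2_per_add L2_per_zero)

abbreviation fourier :: "(real^'d \<Rightarrow> complex) \<Rightarrow> (int^'d) ell2" where
  "fourier \<equiv> torus.coeffs"

lemma continuous_fourier_basis: "continuous_on UNIV (fourier_basis k)"
  unfolding fourier_basis_def[abs_def] by (intro continuous_intros)

lemma fourier_surj: "\<exists>g\<in>L2_per. fourier g = x"
proof -
  obtain S where S: "\<And>n::nat. finite (S n)"
    "(\<lambda>a. lim (\<lambda>n. torus.partial_sum (coord x) (S n) a)) \<in> L2_space torus"
    "fourier (\<lambda>a. lim (\<lambda>n. torus.partial_sum (coord x) (S n) a)) = x"
    by (rule torus.synthesis[of x], rule that)
  have "(\<lambda>a. lim (\<lambda>n. torus.partial_sum (coord x) (S n) a)) \<in> L2_per"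
  proof (rule L2_perI[OF _ _ S(2)])
    show "(\<lambda>a. lim (\<lambda>n. torus.partial_sum (coord x) (S n) a)) \<in> borel_measurable lebesgue"
    proof (rule borel_measurable_lim_metric)
      show "torus.partial_sum (coord x) (S n) \<in> borel_measurable lebesgue" for n
        unfolding torus.partial_sum_def[abs_def]
        by (intro continuous_imp_measurable_lebesgue continuous_intros continuous_fourier_basis)
    qed
    show "periodic (\<lambda>a. lim (\<lambda>n. torus.partial_sum (coord x) (S n) a))"
    proof (rule strictly_periodic_imp_periodic)
      have "torus.partial_sum (coord x) (S n) (y + lattice p) = torus.partial_sum (coord x) (S n) y" for n p y
        by (simp add: torus.partial_sum_def fourier_basis_def
            strictly_periodic_plane_wave[unfolded strictly_periodic_def, rule_format])
      then show "strictly_periodic (\<lambda>a. lim (\<lambda>n. torus.partial_sum (coord x) (S n) a))"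
        by (simp add: strictly_periodic_def)
    qed
  qed
  then show ?thesis using S(3) by blast
qed

text \<open>A representative of the function class with given Fourier coefficients.\<close>

definition realize :: "(int^'d) ell2 \<Rightarrow> real^'d \<Rightarrow> complex" where
  "realize x = (SOME g. g \<in> L2_per \<and> fourier g = x)"

lemma realize_L2_per: "realize x \<in> L2_per" and fourier_realize [simp]: "fourier (realize x) = x"
  using someI_ex[of "\<lambda>g. g \<in> L2_per \<and> fourier g = x"] fourier_surj[of x]
  unfolding realize_def by blast+

lemma realize_L2_space: "realize x \<in> L2_space torus"
  by (rule L2_per_imp_L2_space[OF realize_L2_per])

lemma smoothD:
  assumes "smooth \<phi>"
  shows "continuous_on UNIV \<phi>" "continuous_on UNIV (partial_deriv j \<phi>)"
    "((\<lambda>t. \<phi> (y + t *\<^sub>R axis j 1)) has_vector_derivative partial_deriv j \<phi> y) (at 0)"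
proof -
  show "continuous_on UNIV \<phi>" "continuous_on UNIV (partial_deriv j \<phi>)"
    using assms[unfolded smooth_def, rule_format, of "[]"] assms[unfolded smooth_def, rule_format, of "[j]"] by auto
  have "(\<lambda>t. foldr partial_deriv [] \<phi> (y + t *\<^sub>R axis j 1)) differentiable at 0"
    using assms unfolding smooth_def by blast
  then show "((\<lambda>t. \<phi> (y + t *\<^sub>R axis j 1)) has_vector_derivative partial_deriv j \<phi> y) (at 0)"
    unfolding partial_deriv_def by (simp add: vector_derivative_works)
qed

text \<open>Integration by parts against a plane wave: the derivative of \<open>\<phi> * plane_wave k\<close> has integral zero.\<close>

lemma fourier_partial_deriv:
  fixes \<phi> :: "real^'d \<Rightarrow> complex"
  assumes \<phi>: "smooth \<phi>" "periodic \<phi>"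
  shows "coord (fourier (\<lambda>y. cnj (partial_deriv j \<phi> y))) k
    = \<i> * of_int (k $ j) * coord (fourier (\<lambda>y. cnj (\<phi> y))) k"
proof -
  note s = smoothD[OF \<phi>(1)]
  let ?e = "plane_wave k" and ?c = "complex_of_real (1 / sqrt (cell_volume TYPE('d)))"
  let ?d = "\<lambda>y. \<phi> y * (\<i> * of_int (k $ j) * ?e y) + partial_deriv j \<phi> y * ?e y"
  have "integral\<^sup>L torus ?d = 0"
  proof (rule torus_integral_derivative[where f = "\<lambda>y. \<phi> y * ?e y" and j = j])
    show "strictly_periodic (\<lambda>y. \<phi> y * ?e y)"
      using continuous_periodic_strict[OF s(1) \<phi>(2)] strictly_periodic_plane_wave[of k]
      by (simp add: strictly_periodic_def)
    show "((\<lambda>t. \<phi> (y + t *\<^sub>R axis j 1) * ?e (y + t *\<^sub>R axis j 1)) has_vector_derivative ?d y) (at 0)" for y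
      using has_vector_derivative_mult[OF s(3)[of y] plane_wave_has_vector_derivative[of k y j]] by simp
  qed (intro continuous_intros s)+
  moreover have "integrable torus (\<lambda>y. \<phi> y * (\<i> * of_int (k $ j) * ?e y))"
    "integrable torus (\<lambda>y. partial_deriv j \<phi> y * ?e y)"
    by (intro continuous_integrable_torus continuous_intros s)+
  ultimately have "(LINT y|torus. \<phi> y * (\<i> * of_int (k $ j) * ?e y)) + (LINT y|torus. partial_deriv j \<phi> y * ?e y) = 0"
    by (simp add: Bochner_Integration.integral_add)
  moreover have "(LINT y|torus. \<phi> y * (\<i> * of_int (k $ j) * ?e y)) = \<i> * of_int (k $ j) * (LINT y|torus. \<phi> y * ?e y)"
    by (simp add: mult.left_commute[of "\<phi> _"])
  ultimately have eq: "(LINT y|torus. partial_deriv j \<phi> y * ?e y) = - (\<i> * of_int (k $ j) * (LINT y|torus. \<phi> y * ?e y))"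
    by (simp add: add_eq_0_iff)
  have ip: "L2_ip torus (\<lambda>y. cnj (f y)) (fourier_basis k) = ?c * cnj (LINT y|torus. f y * ?e y)" for f
  proof -
    have "L2_ip torus (\<lambda>y. cnj (f y)) (fourier_basis k) = (LINT y|torus. ?c * cnj (f y * ?e y))"
      unfolding L2_ip_def fourier_basis_def by (simp add: mult_ac)
    then show ?thesis by (simp only: integral_mult_right_zero Bochner_Integration.integral_cnj)
  qed
  have "(\<lambda>y. cnj (partial_deriv j \<phi> y)) \<in> L2_space torus" "(\<lambda>y. cnj (\<phi> y)) \<in> L2_space torus"
    by (intro L2_space_cnj continuous_L2_torus s)+
  then show ?thesis
    by (simp add: torus.coord_coeffs ip eq)
qed

text \<open>Testing with plane waves determines the Fourier coefficients of a weak derivative, hence the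
derivative itself up to null sets.  Conversely, Parseval's identity reduces an arbitrary test
function to its Fourier coefficients.\<close>

theorem has_weak_partial_iff:
  fixes u :: "real^'d \<Rightarrow> complex"
  assumes u: "u \<in> L2_space torus"
  shows "has_weak_partial j u g \<longleftrightarrow>
    g \<in> L2_per \<and> (\<forall>k. coord (fourier g) k = \<i> * of_int (k $ j) * coord (fourier u) k)"
proof (intro iffI conjI allI)
  assume wp: "has_weak_partial j u g"
  then show g: "g \<in> L2_per" by (simp add: has_weak_partial_def)
  fix k :: "int^'d"
  let ?c = "complex_of_real (1 / sqrt (cell_volume TYPE('d)))"
  let ?\<phi> = "\<lambda>y. ?c * plane_wave (- k) y"
  have cnj: "cnj (fourier_basis k y) = ?\<phi> y" for y
    by (simp add: fourier_basis_def plane_wave_cnj)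
  have "periodic ?\<phi>"
    using strictly_periodic_plane_wave[of "- k"]
    by (intro strictly_periodic_imp_periodic) (simp add: strictly_periodic_def)
  then have "(LINT y|torus. u y * partial_deriv j ?\<phi> y) = - (LINT y|torus. g y * ?\<phi> y)"
    using wp smooth_plane_wave unfolding has_weak_partial_def set_integral_cell by blast
  moreover have "(LINT y|torus. u y * partial_deriv j ?\<phi> y) = (LINT y|torus. (- \<i> * of_int (k $ j)) * (u y * ?\<phi> y))"
    unfolding partial_deriv_plane_wave by (simp add: mult_ac)
  moreover have solve: "Y = \<i> * a * X" if "(- \<i> * a) * X = - Y" for a X Y :: complex
    using that by simp
  ultimately have "(- \<i> * of_int (k $ j)) * (LINT y|torus. u y * ?\<phi> y) = - (LINT y|torus. g y * ?\<phi> y)"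
    by (simp only: integral_mult_right_zero)
  then show "coord (fourier g) k = \<i> * of_int (k $ j) * coord (fourier u) k"
    unfolding torus.coord_coeffs[OF u] torus.coord_coeffs[OF L2_per_imp_L2_space[OF g]] L2_ip_def cnj
    by (rule solve)
next
  assume g: "g \<in> L2_per \<and> (\<forall>k. coord (fourier g) k = \<i> * of_int (k $ j) * coord (fourier u) k)"
  note gL2 = L2_per_imp_L2_space[OF conjunct1[OF g]]
  show "has_weak_partial j u g"
    unfolding has_weak_partial_def set_integral_cell
  proof (intro conjI allI impI)
    show "g \<in> L2_per" using g by blast
    fix \<phi> :: "real^'d \<Rightarrow> complex" assume \<phi>: "smooth \<phi> \<and> periodic \<phi>"
    have c: "(\<lambda>y. cnj (partial_deriv j \<phi> y)) \<in> L2_space torus" "(\<lambda>y. cnj (\<phi> y)) \<in> L2_space torus"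
      using smoothD[OF conjunct1[OF \<phi>]] by (auto intro!: L2_space_cnj continuous_L2_torus)
    have "(LINT y|torus. u y * partial_deriv j \<phi> y) = cinner (fourier u) (fourier (\<lambda>y. cnj (partial_deriv j \<phi> y)))"
      using torus.parseval[OF u c(1)] by (simp add: L2_ip_def)
    also have "\<dots> = (\<Sum>\<^sub>\<infinity>k. - (coord (fourier g) k * cnj (coord (fourier (\<lambda>y. cnj (\<phi> y))) k)))"
      unfolding cinner_def using g \<phi> by (intro infsum_cong) (simp add: fourier_partial_deriv)
    also have "\<dots> = - cinner (fourier g) (fourier (\<lambda>y. cnj (\<phi> y)))"
      unfolding cinner_def by (rule infsum_uminus)
    also have "\<dots> = - (LINT y|torus. g y * \<phi> y)"
      using torus.parseval[OF gL2 c(2)] by (simp add: L2_ip_def)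
    finally show "(LINT y|torus. u y * partial_deriv j \<phi> y) = - (LINT y|torus. g y * \<phi> y)" .
  qed
qed

definition freq_sq :: "int^'d \<Rightarrow> real" where "freq_sq k = (\<Sum>i\<in>UNIV. (of_int (k $ i))\<^sup>2)"

text \<open>The weight is the symbol of \<open>-\<Delta>\<close>, with the vanishing value at \<open>k = 0\<close> replaced by \<open>1\<close>.  With it,
\<open>x\<close> and \<open>-\<Delta> u\<close> have the same coefficients away from \<open>k = 0\<close>.\<close>

definition weight :: "int^'d \<Rightarrow> real" where "weight k = (if k = 0 then 1 else freq_sq k)"

lemma abs_component_le_freq_sq: "\<bar>of_int (k $ i)\<bar> \<le> freq_sq k" and component_sq_le_freq_sq: "(of_int (k $ i))\<^sup>2 \<le> freq_sq k"
proof -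
  show 1: "(of_int (k $ i))\<^sup>2 \<le> freq_sq k"
    unfolding freq_sq_def by (rule member_le_sum) auto
  have "\<bar>k $ i\<bar> \<le> (k $ i)\<^sup>2"
  proof (cases "k $ i = 0")
    case False
    then have "1 \<le> \<bar>k $ i\<bar>" by linarith
    from mult_left_mono[OF this, of "\<bar>k $ i\<bar>"] show ?thesis by (simp add: power2_eq_square)
  qed simp
  then have "\<bar>of_int (k $ i)\<bar> \<le> (of_int (k $ i) :: real)\<^sup>2"
    by (metis of_int_abs of_int_le_iff of_int_power)
  then show "\<bar>of_int (k $ i)\<bar> \<le> freq_sq k" using 1 by linarith
qed

lemma freq_sq_zero [simp]: "freq_sq 0 = 0" by (simp add: freq_sq_def)

lemma freq_sq_ge_1: assumes "k \<noteq> 0" shows "freq_sq k \<ge> 1"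
proof -
  obtain i where "k $ i \<noteq> 0" using assms by (auto simp: vec_eq_iff)
  then have "1 \<le> \<bar>k $ i\<bar>" by linarith
  then have "(1::real) \<le> \<bar>of_int (k $ i)\<bar>" by linarith
  then show ?thesis using abs_component_le_freq_sq[of k i] by linarith
qed

lemma weight_ge_1: "weight k \<ge> 1"
  using freq_sq_ge_1 by (auto simp: weight_def)

lemma weight_pos: "weight k > 0" and weight_nz: "weight k \<noteq> 0"
  using weight_ge_1[of k] by linarith+

lemma freq_sq_le_weight: "freq_sq k \<le> weight k"
  by (simp add: weight_def)

lemma weight_quotient_le:
  assumes "\<bar>a\<bar> \<le> weight k" shows "cmod (of_real (a / weight k)) \<le> 1"
  using assms weight_pos[of k] unfolding norm_of_real abs_divide by simp

text \<open>If \<open>u\<close> has coefficients \<open>smoothing_op x\<close>, then \<open>partial_op j x\<close> and \<open>second_partial_op i j x\<close> are the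
coefficients of its first and second derivatives.\<close>

definition smoothing_op :: "(int^'d) ell2 \<Rightarrow>\<^sub>L (int^'d) ell2" where
  "smoothing_op = diag (\<lambda>k. of_real (1 / weight k))"
definition partial_op :: "'d \<Rightarrow> (int^'d) ell2 \<Rightarrow>\<^sub>L (int^'d) ell2" where
  "partial_op j = diag (\<lambda>k. \<i> * of_real (of_int (k $ j) / weight k))"
definition second_partial_op :: "'d \<Rightarrow> 'd \<Rightarrow> (int^'d) ell2 \<Rightarrow>\<^sub>L (int^'d) ell2" where
  "second_partial_op i j = diag (\<lambda>k. of_real (- (of_int (k $ i) * of_int (k $ j)) / weight k))"

lemma smoothing_symbol_le: "cmod (of_real (1 / weight k)) \<le> 1"
  by (rule weight_quotient_le) (use weight_ge_1 in simp)

lemma partial_symbol_le: "cmod (\<i> * of_real (of_int (k $ j) / weight k)) \<le> 1"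
  unfolding norm_mult norm_ii mult_1
  by (rule weight_quotient_le) (use abs_component_le_freq_sq[of k j] freq_sq_le_weight[of k] in linarith)

lemma second_partial_symbol_le: "cmod (of_real (- (of_int (k $ i) * of_int (k $ j)) / weight k)) \<le> 1"
proof (rule weight_quotient_le)
  have "2 * (\<bar>of_int (k $ i)\<bar> * \<bar>of_int (k $ j)\<bar>) \<le> \<bar>of_int (k $ i)\<bar>\<^sup>2 + \<bar>of_int (k $ j) :: real\<bar>\<^sup>2"
    using sum_squares_bound[of "\<bar>of_int (k $ i) :: real\<bar>" "\<bar>of_int (k $ j)\<bar>"] by simp
  then have "\<bar>of_int (k $ i)\<bar> * \<bar>of_int (k $ j) :: real\<bar> \<le> freq_sq k"
    using component_sq_le_freq_sq[of k i] component_sq_le_freq_sq[of k j] unfolding power2_abs by linarith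
  then show "\<bar>- (of_int (k $ i) * of_int (k $ j))\<bar> \<le> weight k"
    using freq_sq_le_weight[of k] by (simp add: abs_mult)
qed

lemma coord_smoothing: "coord (smoothing_op x) k = of_real (1 / weight k) * coord x k"
  unfolding smoothing_op_def by (rule coord_diag[OF smoothing_symbol_le])
lemma coord_partial: "coord (partial_op j x) k = \<i> * of_real (of_int (k $ j) / weight k) * coord x k"
  unfolding partial_op_def by (rule coord_diag[OF partial_symbol_le])
lemma coord_second_partial:
  "coord (second_partial_op i j x) k = of_real (- (of_int (k $ i) * of_int (k $ j)) / weight k) * coord x k"
  unfolding second_partial_op_def by (rule coord_diag[OF second_partial_symbol_le])

lemma norm_diag_apply_le: "norm T \<le> 1 \<Longrightarrow> norm (blinfun_apply T x) \<le> norm x"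
  using norm_blinfun[of T x] mult_right_mono[of "norm T" 1 "norm x"] by simp

lemma norm_smoothing_le: "norm (smoothing_op x) \<le> norm x" and norm_partial_le: "norm (partial_op j x) \<le> norm x"
  and norm_second_partial_le: "norm (second_partial_op i j x) \<le> norm x"
  unfolding smoothing_op_def partial_op_def second_partial_op_def
  by (intro norm_diag_apply_le norm_diag_le smoothing_symbol_le partial_symbol_le second_partial_symbol_le)+

lemma ii_mult: "\<i> * a * (\<i> * b * z) = - (a * b * z)"
proof -
  have "\<i> * a * (\<i> * b * z) = (\<i> * \<i>) * (a * b * z)" by (simp only: mult_ac)
  then show ?thesis by simp
qed

lemma weak_partial_realize:
  assumes u: "u \<in> L2_space torus" and z: "\<And>k. coord z k = \<i> * of_int (k $ j) * coord (fourier u) k"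
  shows "has_weak_partial j u (realize z)" "weak_partial j u \<in> L2_per" "fourier (weak_partial j u) = z"
proof -
  show r: "has_weak_partial j u (realize z)"
    unfolding has_weak_partial_iff[OF u] using z by (simp add: realize_L2_per)
  have "has_weak_partial j u (weak_partial j u)"
    unfolding weak_partial_def by (rule someI[of "has_weak_partial j u", OF r])
  then show "weak_partial j u \<in> L2_per" "fourier (weak_partial j u) = z"
    unfolding has_weak_partial_iff[OF u] using z by (auto intro: ell2_eqI)
qed

lemma weak_partials:
  assumes u: "u \<in> L2_space torus" "fourier u = smoothing_op x"
  shows "weak_partial j u \<in> L2_per" "fourier (weak_partial j u) = partial_op j x"
    "weak_partial i (weak_partial j u) \<in> L2_per" "fourier (weak_partial i (weak_partial j u)) = second_partial_op i j x"
proof -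
  have 1: "coord (partial_op j x) k = \<i> * of_int (k $ j) * coord (fourier u) k" for k
    by (simp add: u(2) coord_smoothing coord_partial)
  show a: "weak_partial j u \<in> L2_per" and b: "fourier (weak_partial j u) = partial_op j x"
    by (rule weak_partial_realize[OF u(1) 1])+
  have 2: "coord (second_partial_op i j x) k = \<i> * of_int (k $ i) * coord (fourier (weak_partial j u)) k" for k
    by (simp add: b coord_partial coord_second_partial ii_mult flip: times_divide_eq_right)
  show "weak_partial i (weak_partial j u) \<in> L2_per" "fourier (weak_partial i (weak_partial j u)) = second_partial_op i j x"
    by (rule weak_partial_realize[OF L2_per_imp_L2_space[OF a] 2])+
qed

text \<open>The family \<open>x\<close> is recovered from \<open>u\<close> through its mean value and its pure second derivatives, which
together give \<open>weight k\<close> times the coefficient of \<open>u\<close>.\<close>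

theorem sobolev_2_iff: "u \<in> sobolev 2 \<longleftrightarrow> u \<in> L2_per \<and> (\<exists>x. fourier u = smoothing_op x)"
  for u :: "real^'d \<Rightarrow> complex"
proof
  assume "u \<in> sobolev 2"
  then have u: "u \<in> L2_per" and ex: "\<And>j. \<exists>g. g \<in> L2_per \<and> (\<forall>i. \<exists>h\<in>L2_per. has_weak_partial i g h) \<and> has_weak_partial j u g"
    by (auto simp: numeral_2_eq_2)
  note uL = L2_per_imp_L2_space[OF u]
  have "\<exists>h. h \<in> L2_per \<and> (\<forall>k. coord (fourier h) k = - of_real ((of_int (k $ j))\<^sup>2) * coord (fourier u) k)" for j
  proof -
    obtain g h where gh: "g \<in> L2_per" "h \<in> L2_per" "has_weak_partial j g h" "has_weak_partial j u g"
      using ex[of j] by blast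
    have "coord (fourier h) k = - of_real ((of_int (k $ j))\<^sup>2) * coord (fourier u) k" for k
      using gh(3,4) unfolding has_weak_partial_iff[OF uL] has_weak_partial_iff[OF L2_per_imp_L2_space[OF gh(1)]]
      by (simp add: power2_eq_square ii_mult)
    then show ?thesis using gh(2) by auto
  qed
  then obtain h where h: "\<And>j k. coord (fourier (h j)) k = - of_real ((of_int (k $ j))\<^sup>2) * coord (fourier u) k"
    by metis
  have b0: "cmod (if k = 0 then 1 else 0) \<le> 1" for k :: "int^'d" by simp
  define x where "x = diag (\<lambda>k. if k = 0 then 1 else 0) (fourier u) - (\<Sum>j\<in>UNIV. fourier (h j))"
  have "coord x k = of_real (weight k) * coord (fourier u) k" for k
    by (simp add: x_def coord_diag[OF b0] h weight_def freq_sq_def sum_negf sum_distrib_right)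
  then have "fourier u = smoothing_op x"
    by (intro ell2_eqI) (simp add: coord_smoothing weight_nz)
  then show "u \<in> L2_per \<and> (\<exists>x. fourier u = smoothing_op x)" using u by blast
next
  assume "u \<in> L2_per \<and> (\<exists>x. fourier u = smoothing_op x)"
  then obtain x where u: "u \<in> L2_per" "fourier u = smoothing_op x" by blast
  note uL = L2_per_imp_L2_space[OF u(1)]
  have "\<exists>g\<in>sobolev (Suc 0). has_weak_partial j u g" for j
  proof
    have 1: "coord (partial_op j x) k = \<i> * of_int (k $ j) * coord (fourier u) k" for k
      by (simp add: u(2) coord_smoothing coord_partial)
    show "has_weak_partial j u (realize (partial_op j x))" by (rule weak_partial_realize(1)[OF uL 1])
    have 2: "coord (second_partial_op i j x) k = \<i> * of_int (k $ i) * coord (fourier (realize (partial_op j x))) k" for i k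
      by (simp add: coord_partial coord_second_partial ii_mult flip: times_divide_eq_right)
    have "has_weak_partial i (realize (partial_op j x)) (realize (second_partial_op i j x))" for i
      by (rule weak_partial_realize(1)[OF realize_L2_space 2])
    then show "realize (partial_op j x) \<in> sobolev (Suc 0)"
      using realize_L2_per by auto
  qed
  then show "u \<in> sobolev 2" using u(1) by (simp add: numeral_2_eq_2)
qed

lemma torus_sq_integral: "u \<in> L2_per \<Longrightarrow> (LINT y:cell|lebesgue. (cmod (u y))\<^sup>2) = (norm (fourier u))\<^sup>2"
  unfolding set_integral_cell by (simp add: torus.parseval_norm[OF L2_per_imp_L2_space, symmetric] L2_sq_def)

lemma sobolev_norm_2_le:
  fixes u :: "real^'d \<Rightarrow> complex"
  assumes u: "u \<in> L2_per" "fourier u = smoothing_op x"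
  shows "sobolev_norm 2 u \<le> sqrt (1 + CARD('d) * (1 + CARD('d))) * norm x"
proof -
  note w = weak_partials[OF L2_per_imp_L2_space[OF u(1)] u(2)]
  let ?n = "(norm x)\<^sup>2"
  have "sobolev_norm_sq 2 u = sobolev_norm_sq (Suc (Suc 0)) u" by (simp only: numeral_2_eq_2)
  also have "\<dots> = (norm (smoothing_op x))\<^sup>2 + (\<Sum>j\<in>UNIV. (norm (partial_op j x))\<^sup>2 + (\<Sum>i\<in>UNIV. (norm (second_partial_op i j x))\<^sup>2))"
    by (simp add: torus_sq_integral w u)
  also have "\<dots> \<le> ?n + (\<Sum>j\<in>(UNIV::'d set). ?n + (\<Sum>i\<in>(UNIV::'d set). ?n))"
    by (intro add_mono sum_mono power_mono norm_smoothing_le norm_partial_le norm_second_partial_le norm_ge_zero)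
  also have "\<dots> = (1 + CARD('d) * (1 + CARD('d))) * ?n"
    by (simp add: algebra_simps)
  finally have "sobolev_norm 2 u \<le> sqrt ((1 + CARD('d) * (1 + CARD('d))) * ?n)"
    unfolding sobolev_norm_def by (rule real_sqrt_le_mono)
  then show ?thesis by (simp add: real_sqrt_mult)
qed

section \<open>Normed power series in several variables\<close>

definition degree_weight :: "real \<Rightarrow> ('d::finite \<Rightarrow> nat) \<Rightarrow> real" where
  "degree_weight r \<alpha> = r ^ (\<Sum>i\<in>UNIV. \<alpha> i)"

definition cube :: "real^'d \<Rightarrow> real \<Rightarrow> (real^'d) set" where
  "cube x0 r = {x. \<forall>i. \<bar>x $ i - x0 $ i\<bar> \<le> r}"

text \<open>The functions whose power series about \<open>x0\<close> has norm at most \<open>N\<close> in the space of series with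
\<open>\<Sum>\<^sub>\<alpha> \<parallel>c\<^sub>\<alpha>\<parallel> r\<^bsup>|\<alpha>|\<^esup> < \<infinity>\<close>.  Such a series converges on the closed cube of half-width \<open>r\<close>.  Speaking of the
functions rather than of the series keeps all recursions independent of \<open>x0\<close>.\<close>

definition power_series_bound ::
    "real^'d \<Rightarrow> real \<Rightarrow> real \<Rightarrow> (real^'d \<Rightarrow> 'b::banach) \<Rightarrow> bool" where
  "power_series_bound x0 r N f \<longleftrightarrow>
     (\<exists>c S. ((\<lambda>\<alpha>. norm (c \<alpha>) * degree_weight r \<alpha>) has_sum S) UNIV \<and> S \<le> N \<and>
        (\<forall>x\<in>cube x0 r. ((\<lambda>\<alpha>. monomial (x - x0) \<alpha> *\<^sub>R c \<alpha>) has_sum f x) UNIV))"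

lemma power_series_boundE:
  assumes "power_series_bound x0 r N f"
  obtains c S where "((\<lambda>\<alpha>. norm (c \<alpha>) * degree_weight r \<alpha>) has_sum S) UNIV" "S \<le> N"
    "\<And>x. x \<in> cube x0 r \<Longrightarrow> ((\<lambda>\<alpha>. monomial (x - x0) \<alpha> *\<^sub>R c \<alpha>) has_sum f x) UNIV"
  using assms unfolding power_series_bound_def by auto

lemma degree_weight_nonneg: "r \<ge> 0 \<Longrightarrow> degree_weight r \<alpha> \<ge> 0"
  and degree_weight_pos: "r > 0 \<Longrightarrow> degree_weight r \<alpha> > 0"
  by (auto simp: degree_weight_def)

lemma degree_weight_add: "degree_weight r (\<lambda>i. \<alpha> i + \<beta> i) = degree_weight r \<alpha> * degree_weight r \<beta>"
  by (simp add: degree_weight_def sum.distrib power_add)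

lemma monomial_add: "monomial x (\<lambda>i. \<alpha> i + \<beta> i) = monomial x \<alpha> * monomial x \<beta>"
  by (simp add: monomial_def power_add prod.distrib)

lemma abs_monomial_le:
  assumes "x \<in> cube x0 r" shows "\<bar>monomial (x - x0) \<alpha>\<bar> \<le> degree_weight r \<alpha>"
proof -
  have "\<bar>monomial (x - x0) \<alpha>\<bar> = (\<Prod>i\<in>UNIV. \<bar>x $ i - x0 $ i\<bar> ^ \<alpha> i)"
    by (simp add: monomial_def abs_prod power_abs)
  also have "\<dots> \<le> (\<Prod>i\<in>UNIV. r ^ \<alpha> i)"
    using assms by (intro prod_mono) (auto simp: cube_def intro!: power_mono)
  finally show ?thesis by (simp add: degree_weight_def power_sum)
qed

lemma monomial_family_summable:
  fixes F :: "'p \<Rightarrow> 'b::banach"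
  assumes "(\<lambda>p. norm (F p) * degree_weight r (\<phi> p)) summable_on A" "x \<in> cube x0 r"
  shows "(\<lambda>p. monomial (x - x0) (\<phi> p) *\<^sub>R F p) summable_on A"
proof (rule abs_summable_summable, rule summable_on_comparison_test[OF assms(1)])
  show "norm (monomial (x - x0) (\<phi> p) *\<^sub>R F p) \<le> norm (F p) * degree_weight r (\<phi> p)" for p
    using mult_right_mono[OF abs_monomial_le[OF assms(2), of "\<phi> p"] norm_ge_zero[of "F p"]]
    by (simp add: mult.commute)
qed auto

lemma has_sum_fibres:
  fixes F :: "'p \<Rightarrow> 'b::{topological_comm_monoid_add,t3_space}"
  assumes "(F has_sum T) UNIV" "\<And>\<gamma>. F summable_on {p. \<phi> p = \<gamma>}"
  shows "((\<lambda>\<gamma>. infsum F {p. \<phi> p = \<gamma>}) has_sum T) UNIV"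
proof -
  have bij: "bij_betw snd (Sigma UNIV (\<lambda>\<gamma>. {p. \<phi> p = \<gamma>})) UNIV"
    by (rule bij_betwI[where g = "\<lambda>p. (\<phi> p, p)"]) auto
  have "((\<lambda>q. F (snd q)) has_sum T) (Sigma UNIV (\<lambda>\<gamma>. {p. \<phi> p = \<gamma>}))"
    by (subst has_sum_reindex_bij_betw[OF bij]) (rule assms(1))
  then show ?thesis
    by (rule has_sum_SigmaD) (use assms(2) in auto)
qed

text \<open>Terms with the same multi-index may be collected afterwards, which only decreases the norm.
Products and infinite series are obtained from this by choosing the index set of the family.\<close>

lemma power_series_bound_from_family:
  fixes F :: "'p \<Rightarrow> 'b::banach" and \<phi> :: "'p \<Rightarrow> 'd::finite \<Rightarrow> nat"
  assumes r: "r > 0"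
    and S: "((\<lambda>p. norm (F p) * degree_weight r (\<phi> p)) has_sum S) UNIV" "S \<le> N"
    and f: "\<And>x. x \<in> cube x0 r \<Longrightarrow> ((\<lambda>p. monomial (x - x0) (\<phi> p) *\<^sub>R F p) has_sum f x) UNIV"
  shows "power_series_bound x0 r N f"
proof -
  let ?fib = "\<lambda>\<gamma>. {p. \<phi> p = \<gamma>}"
  let ?g = "\<lambda>p. norm (F p) * degree_weight r (\<phi> p)"
  define c where "c \<gamma> = infsum F (?fib \<gamma>)" for \<gamma>
  have gsum: "?g summable_on ?fib \<gamma>" for \<gamma>
    by (rule summable_on_subset_banach[OF has_sum_imp_summable[OF S(1)]]) auto
  have nF: "(\<lambda>p. norm (F p)) summable_on ?fib \<gamma>" for \<gamma>
  proof -
    have "(\<lambda>p. norm (F p) * degree_weight r \<gamma>) summable_on ?fib \<gamma>"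
      by (rule summable_on_cong[THEN iffD1, OF _ gsum]) auto
    then show ?thesis
      using degree_weight_pos[OF r, of \<gamma>] by (simp add: summable_on_cmult_left')
  qed
  have "((\<lambda>\<gamma>. infsum ?g (?fib \<gamma>)) has_sum S) UNIV"
    by (rule has_sum_fibres[OF S(1) gsum])
  moreover have le: "norm (c \<gamma>) * degree_weight r \<gamma> \<le> infsum ?g (?fib \<gamma>)" for \<gamma>
  proof -
    have "norm (c \<gamma>) * degree_weight r \<gamma> \<le> infsum (\<lambda>p. norm (F p)) (?fib \<gamma>) * degree_weight r \<gamma>"
      unfolding c_def
      by (intro mult_right_mono norm_infsum_bound nF degree_weight_nonneg less_imp_le[OF r])
    also have "\<dots> = infsum (\<lambda>p. norm (F p) * degree_weight r \<gamma>) (?fib \<gamma>)"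
      by (simp add: infsum_cmult_left')
    also have "\<dots> = infsum ?g (?fib \<gamma>)" by (rule infsum_cong) auto
    finally show ?thesis .
  qed
  ultimately have sm: "(\<lambda>\<gamma>. norm (c \<gamma>) * degree_weight r \<gamma>) summable_on UNIV"
    using r by (intro summable_on_comparison_test[OF has_sum_imp_summable])
      (auto intro!: mult_nonneg_nonneg degree_weight_nonneg)
  have "infsum (\<lambda>\<gamma>. norm (c \<gamma>) * degree_weight r \<gamma>) UNIV \<le> S"
    by (rule has_sum_mono[OF has_sum_infsum[OF sm] has_sum_fibres[OF S(1) gsum] le])
  moreover have "((\<lambda>\<alpha>. monomial (x - x0) \<alpha> *\<^sub>R c \<alpha>) has_sum f x) UNIV" if x: "x \<in> cube x0 r" for x
  proof -
    let ?h = "\<lambda>p. monomial (x - x0) (\<phi> p) *\<^sub>R F p"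
    have "((\<lambda>\<gamma>. infsum ?h (?fib \<gamma>)) has_sum f x) UNIV"
      by (intro has_sum_fibres f x monomial_family_summable[OF gsum x])
    moreover have "infsum ?h (?fib \<gamma>) = monomial (x - x0) \<gamma> *\<^sub>R c \<gamma>" for \<gamma>
    proof -
      have "infsum ?h (?fib \<gamma>) = infsum (\<lambda>p. monomial (x - x0) \<gamma> *\<^sub>R F p) (?fib \<gamma>)"
        by (rule infsum_cong) auto
      then show ?thesis by (simp add: c_def infsum_scaleR_right)
    qed
    ultimately show ?thesis by simp
  qed
  ultimately show ?thesis
    unfolding power_series_bound_def using has_sum_infsum[OF sm] S(2) by (meson order_trans)
qed

lemma power_series_bound_term:
  assumes "r > 0"
  shows "power_series_bound x0 r (norm b * degree_weight r \<alpha>) (\<lambda>x. monomial (x - x0) \<alpha> *\<^sub>R b)"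
  by (rule power_series_bound_from_family[OF assms, of "\<lambda>_::unit. b" "\<lambda>_. \<alpha>"])
    (auto intro!: has_sum_finiteI simp: UNIV_unit)

lemma power_series_bound_const:
  assumes "r > 0" shows "power_series_bound x0 r (norm b) (\<lambda>x. b)"
  using power_series_bound_term[OF assms, of x0 b "\<lambda>_. 0"]
  by (simp add: monomial_def degree_weight_def)

lemma power_series_bound_coordinate:
  fixes x0 :: "real^'d" and j :: 'd
  assumes "r > 0" shows "power_series_bound x0 r r (\<lambda>x. x $ j - x0 $ j)"
proof -
  have "monomial x (\<lambda>i. if i = j then 1 else 0) = x $ j" for x :: "real^'d"
    unfolding monomial_def by (subst prod.mono_neutral_right[where S="{j}"]) auto
  moreover have "(\<Sum>i\<in>UNIV. if i = j then 1 else 0 :: nat) = 1" by simp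
  ultimately show ?thesis
    using power_series_bound_term[OF assms, of x0 "1::real" "\<lambda>i. if i = j then 1 else 0"]
    by (simp add: degree_weight_def)
qed

lemma power_series_bound_cong:
  "\<lbrakk>power_series_bound x0 r N f; N \<le> N'; \<And>x. x \<in> cube x0 r \<Longrightarrow> f x = g x\<rbrakk>
    \<Longrightarrow> power_series_bound x0 r N' g"
  unfolding power_series_bound_def by (elim exE conjE) (intro exI conjI, assumption, auto)

lemma power_series_bound_mono:
  "\<lbrakk>power_series_bound x0 r N f; N \<le> N'\<rbrakk> \<Longrightarrow> power_series_bound x0 r N' f"
  by (rule power_series_bound_cong[where g = f]) auto

lemma power_series_bound_nonneg:
  fixes f :: "real^'d \<Rightarrow> 'b::banach"
  assumes "power_series_bound x0 r N f" "r > 0" shows "N \<ge> 0"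
proof -
  obtain c :: "('d \<Rightarrow> nat) \<Rightarrow> 'b" and S
    where "((\<lambda>\<alpha>. norm (c \<alpha>) * degree_weight r \<alpha>) has_sum S) UNIV" "S \<le> N"
    by (rule power_series_boundE[OF assms(1)], rule that)
  moreover from this(1) have "0 \<le> S"
    by (rule has_sum_nonneg) (use assms(2) in \<open>auto intro!: mult_nonneg_nonneg degree_weight_nonneg\<close>)
  ultimately show ?thesis by linarith
qed

lemma power_series_bound_norm_le:
  assumes "power_series_bound x0 r N f" "x \<in> cube x0 r" shows "norm (f x) \<le> N"
proof -
  obtain c S where c: "((\<lambda>\<alpha>. norm (c \<alpha>) * degree_weight r \<alpha>) has_sum S) UNIV" "S \<le> N"
    "\<And>x. x \<in> cube x0 r \<Longrightarrow> ((\<lambda>\<alpha>. monomial (x - x0) \<alpha> *\<^sub>R c \<alpha>) has_sum f x) UNIV"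
    by (rule power_series_boundE[OF assms(1)], rule that)
  have "norm (f x) \<le> S"
  proof (rule norm_infsum_le[OF c(3)[OF assms(2)] c(1)])
    show "norm (monomial (x - x0) \<alpha> *\<^sub>R c \<alpha>) \<le> norm (c \<alpha>) * degree_weight r \<alpha>" for \<alpha>
      using mult_right_mono[OF abs_monomial_le[OF assms(2), of "\<alpha>"] norm_ge_zero[of "c \<alpha>"]]
      by (simp add: mult.commute)
  qed
  with c(2) show ?thesis by linarith
qed

text \<open>Completeness of the space of normed power series; the index set consists of the pairs of a
position in the series and a multi-index.\<close>

lemma power_series_bound_series:
  fixes f :: "nat \<Rightarrow> real^'d \<Rightarrow> 'b::banach"
  assumes r: "r > 0" and f: "\<And>n. power_series_bound x0 r (N n) (f n)" and N: "summable N"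
    and g: "\<And>x. x \<in> cube x0 r \<Longrightarrow> (\<lambda>n. f n x) sums g x"
  shows "power_series_bound x0 r (suminf N) g"
proof -
  have "\<forall>n. \<exists>c S. ((\<lambda>\<alpha>. norm (c \<alpha>) * degree_weight r \<alpha>) has_sum S) UNIV \<and> S \<le> N n \<and>
      (\<forall>x\<in>cube x0 r. ((\<lambda>\<alpha>. monomial (x - x0) \<alpha> *\<^sub>R c \<alpha>) has_sum f n x) UNIV)"
    using f unfolding power_series_bound_def by (rule allI)
  from choice[OF this] obtain c where
    "\<forall>n. \<exists>S. ((\<lambda>\<alpha>. norm (c n \<alpha>) * degree_weight r \<alpha>) has_sum S) UNIV \<and> S \<le> N n \<and>
      (\<forall>x\<in>cube x0 r. ((\<lambda>\<alpha>. monomial (x - x0) \<alpha> *\<^sub>R c n \<alpha>) has_sum f n x) UNIV)" by (rule exE)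
  from choice[OF this] obtain S where
    "\<forall>n. ((\<lambda>\<alpha>. norm (c n \<alpha>) * degree_weight r \<alpha>) has_sum S n) UNIV \<and> S n \<le> N n \<and>
      (\<forall>x\<in>cube x0 r. ((\<lambda>\<alpha>. monomial (x - x0) \<alpha> *\<^sub>R c n \<alpha>) has_sum f n x) UNIV)" by (rule exE)
  then have S: "\<And>n. ((\<lambda>\<alpha>. norm (c n \<alpha>) * degree_weight r \<alpha>) has_sum S n) UNIV"
      and SN: "\<And>n. S n \<le> N n"
      and c: "\<And>n x. x \<in> cube x0 r \<Longrightarrow> ((\<lambda>\<alpha>. monomial (x - x0) \<alpha> *\<^sub>R c n \<alpha>) has_sum f n x) UNIV"
    by simp_all
  have S0: "S n \<ge> 0" for n
    by (rule has_sum_nonneg[OF S]) (use r in \<open>auto intro!: mult_nonneg_nonneg degree_weight_nonneg\<close>)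
  have sS: "summable S"
    by (rule summable_comparison_test'[OF N]) (use SN S0 in auto)
  then have hS: "(S has_sum suminf S) UNIV"
    using S0 by (intro sums_nonneg_imp_has_sum) auto
  let ?F = "\<lambda>p. c (fst p) (snd p)"
  let ?G = "\<lambda>p. norm (?F p) * degree_weight r (snd p)"
  have G: "?G summable_on UNIV \<times> UNIV"
    by (rule summable_on_SigmaI[where g = S])
      (use S hS r in \<open>auto intro!: has_sum_imp_summable mult_nonneg_nonneg degree_weight_nonneg\<close>)
  have hG: "(?G has_sum suminf S) (UNIV \<times> UNIV)"
    by (rule has_sum_SigmaI[OF _ hS G]) (use S in auto)
  show ?thesis
  proof (rule power_series_bound_from_family[OF r, where F = ?F and \<phi> = snd])
    show "(?G has_sum suminf S) UNIV" using hG by simp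
    show "suminf S \<le> suminf N" by (rule suminf_le[OF SN sS N])
    fix x assume x: "x \<in> cube x0 r"
    let ?H = "\<lambda>p. monomial (x - x0) (snd p) *\<^sub>R ?F p"
    have H: "?H summable_on UNIV \<times> UNIV"
      by (rule monomial_family_summable[OF G x])
    have "((\<lambda>n. f n x) has_sum infsum ?H (UNIV \<times> UNIV)) UNIV"
      by (rule has_sum_SigmaD[OF has_sum_infsum[OF H]]) (use c[OF x] in auto)
    then have "infsum ?H (UNIV \<times> UNIV) = g x"
      using has_sum_imp_sums g[OF x] sums_unique2 by blast
    then show "(?H has_sum g x) UNIV" using has_sum_infsum[OF H] by simp
  qed
qed

lemma power_series_bound_add:
  assumes r: "r > 0" and "power_series_bound x0 r N f" "power_series_bound x0 r M g"
  shows "power_series_bound x0 r (N + M) (\<lambda>x. f x + g x)"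
proof -
  let ?f = "\<lambda>n. if n = 0 then f else if n = Suc 0 then g else (\<lambda>_. 0)"
  let ?N = "\<lambda>n. if n = 0 then N else if n = Suc 0 then M else (0::real)"
  have *: "h sums (h 0 + h 1)" if "\<And>n. n \<ge> 2 \<Longrightarrow> h n = 0" for h :: "nat \<Rightarrow> 'z::real_normed_vector"
    using sums_finite[of "{0,1}" h] that by (simp add: numeral_2_eq_2 not_less_eq_eq)
  have N: "?N sums (N + M)" using *[of ?N] by simp
  have "power_series_bound x0 r (suminf ?N) (\<lambda>x. f x + g x)"
  proof (rule power_series_bound_series[OF r])
    show "power_series_bound x0 r (?N n) (?f n)" for n
      using assms power_series_bound_const[OF r, of x0 0] by auto
    show "summable ?N" using N by (rule sums_summable)
    show "(\<lambda>n. ?f n x) sums (f x + g x)" for x using *[of "\<lambda>n. ?f n x"] by simp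
  qed
  then show ?thesis using N by (simp add: sums_iff)
qed

text \<open>The Cauchy product, which makes the norm submultiplicative.\<close>

lemma power_series_bound_bilinear:
  fixes prod :: "'a::banach \<Rightarrow> 'b::banach \<Rightarrow> 'c::banach"
  assumes r: "r > 0" and f: "power_series_bound x0 r N f" and g: "power_series_bound x0 r M g"
    and bl: "bounded_bilinear prod" and le: "\<And>a b. norm (prod a b) \<le> norm a * norm b"
  shows "power_series_bound x0 r (N * M) (\<lambda>x. prod (f x) (g x))"
proof -
  interpret bounded_bilinear prod by fact
  obtain a S where a: "((\<lambda>\<alpha>. norm (a \<alpha>) * degree_weight r \<alpha>) has_sum S) UNIV" "S \<le> N"
    "\<And>x. x \<in> cube x0 r \<Longrightarrow> ((\<lambda>\<alpha>. monomial (x - x0) \<alpha> *\<^sub>R a \<alpha>) has_sum f x) UNIV"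
    by (rule power_series_boundE[OF f], rule that)
  obtain b T where b: "((\<lambda>\<alpha>. norm (b \<alpha>) * degree_weight r \<alpha>) has_sum T) UNIV" "T \<le> M"
    "\<And>x. x \<in> cube x0 r \<Longrightarrow> ((\<lambda>\<alpha>. monomial (x - x0) \<alpha> *\<^sub>R b \<alpha>) has_sum g x) UNIV"
    by (rule power_series_boundE[OF g], rule that)
  have wn: "norm y * degree_weight r \<alpha> \<ge> 0" for y :: "'z::real_normed_vector" and \<alpha> :: "'d \<Rightarrow> nat"
    using r by (auto intro!: mult_nonneg_nonneg degree_weight_nonneg)
  have S0: "S \<ge> 0" and T0: "T \<ge> 0"
    using has_sum_nonneg[OF a(1)] has_sum_nonneg[OF b(1)] wn by auto
  let ?F = "\<lambda>p. prod (a (fst p)) (b (snd p))"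
  let ?\<phi> = "\<lambda>p i. fst p i + snd p i"
  let ?P = "\<lambda>p. (norm (a (fst p)) * degree_weight r (fst p)) * (norm (b (snd p)) * degree_weight r (snd p))"
  have inner: "((\<lambda>\<beta>. ?P (\<alpha>, \<beta>)) has_sum (norm (a \<alpha>) * degree_weight r \<alpha>) * T) UNIV" for \<alpha>
    unfolding fst_conv snd_conv by (intro has_sum_cmult_right b(1))
  have outer: "((\<lambda>\<alpha>. (norm (a \<alpha>) * degree_weight r \<alpha>) * T) has_sum S * T) UNIV"
    by (intro has_sum_cmult_left a(1))
  have P: "?P summable_on UNIV \<times> UNIV"
    by (rule summable_on_SigmaI[OF inner has_sum_imp_summable[OF outer]]) (intro mult_nonneg_nonneg wn)
  have hP: "(?P has_sum S * T) (UNIV \<times> UNIV)"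
    by (rule has_sum_SigmaI[OF inner outer P])
  let ?G = "\<lambda>p. norm (?F p) * degree_weight r (?\<phi> p)"
  have GP: "?G p \<le> ?P p" for p
    unfolding degree_weight_add
    using mult_right_mono[OF le[of "a (fst p)" "b (snd p)"],
        of "degree_weight r (fst p) * degree_weight r (snd p)"]
      degree_weight_nonneg[OF less_imp_le[OF r], of "fst p"]
      degree_weight_nonneg[OF less_imp_le[OF r], of "snd p"]
    by (simp add: mult_ac)
  have G: "?G summable_on UNIV \<times> UNIV"
    by (rule summable_on_comparison_test[OF P]) (use GP wn in auto)
  show ?thesis
  proof (rule power_series_bound_from_family[OF r, where F = ?F and \<phi> = ?\<phi>])
    show "(?G has_sum infsum ?G UNIV) UNIV" using G by simp
    have "infsum ?G UNIV \<le> S * T"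
      using has_sum_mono[OF has_sum_infsum[OF G] hP GP] by simp
    also have "\<dots> \<le> N * M" using a(2) b(2) S0 T0 by (intro mult_mono) auto
    finally show "infsum ?G UNIV \<le> N * M" .
    fix x assume x: "x \<in> cube x0 r"
    let ?H = "\<lambda>p. monomial (x - x0) (?\<phi> p) *\<^sub>R ?F p"
    have H: "?H summable_on UNIV \<times> UNIV"
      by (rule monomial_family_summable[OF G x])
    have Heq: "?H (\<alpha>, \<beta>) = prod (monomial (x - x0) \<alpha> *\<^sub>R a \<alpha>) (monomial (x - x0) \<beta> *\<^sub>R b \<beta>)" for \<alpha> \<beta>
      by (simp add: monomial_add scaleR_left scaleR_right)
    have "(?H has_sum prod (f x) (g x)) (UNIV \<times> UNIV)"
    proof (rule has_sum_SigmaI[OF _ _ H])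
      show "((\<lambda>\<beta>. ?H (\<alpha>, \<beta>)) has_sum prod (monomial (x - x0) \<alpha> *\<^sub>R a \<alpha>) (g x)) UNIV" for \<alpha>
        unfolding Heq by (intro has_sum_bounded_linear[OF bounded_linear_right] b(3) x)
      show "((\<lambda>\<alpha>. prod (monomial (x - x0) \<alpha> *\<^sub>R a \<alpha>) (g x)) has_sum prod (f x) (g x)) UNIV"
        by (intro has_sum_bounded_linear[OF bounded_linear_left] a(3) x)
    qed
    then show "(?H has_sum prod (f x) (g x)) UNIV" by simp
  qed
qed

lemma cube_add: "x0 \<in> cube 0 r \<Longrightarrow> x \<in> cube x0 s \<Longrightarrow> x \<in> cube 0 (r + s)"
proof -
  assume "x0 \<in> cube 0 r" "x \<in> cube x0 s"
  then have *: "\<bar>x0 $ i\<bar> \<le> r" "\<bar>x $ i - x0 $ i\<bar> \<le> s" for i by (auto simp: cube_def)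
  have "\<bar>x $ i\<bar> \<le> r + s" for i using *[of i] by linarith
  then show ?thesis by (simp add: cube_def)
qed

lemma power_series_bound_blinfun_apply:
  fixes f :: "real^'d \<Rightarrow> 'a::banach \<Rightarrow>\<^sub>L 'b::banach"
  assumes "r > 0" "power_series_bound x0 r N f" "power_series_bound x0 r M g"
  shows "power_series_bound x0 r (N * M) (\<lambda>x. blinfun_apply (f x) (g x))"
  by (rule power_series_bound_bilinear[OF assms bounded_bilinear_blinfun_apply norm_blinfun])

lemma power_series_bound_scaleR:
  fixes f :: "real^'d \<Rightarrow> real" and g :: "real^'d \<Rightarrow> 'b::banach"
  assumes "r > 0" "power_series_bound x0 r N f" "power_series_bound x0 r M g"
  shows "power_series_bound x0 r (N * M) (\<lambda>x. f x *\<^sub>R g x)"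
  by (rule power_series_bound_bilinear[OF assms bounded_bilinear_scaleR]) simp

lemma power_series_bound_sum_lessThan:
  fixes f :: "nat \<Rightarrow> real^'d \<Rightarrow> 'b::banach"
  assumes "r > 0" "\<And>k. k < n \<Longrightarrow> power_series_bound x0 r (N k) (f k)"
  shows "power_series_bound x0 r (\<Sum>k<n. N k) (\<lambda>x. \<Sum>k<n. f k x)"
  using assms(2)
proof (induction n)
  case 0
  then show ?case using power_series_bound_const[OF assms(1), of x0 "0::'b"] by simp
next
  case (Suc n)
  have "power_series_bound x0 r ((\<Sum>k<n. N k) + N n) (\<lambda>x. (\<Sum>k<n. f k x) + f n x)"
    by (rule power_series_bound_add[OF assms(1)]) (use Suc in auto)
  then show ?case by simp
qed

text \<open>Power series about all points close to the origin, on a neighbourhood of comparable size, whose norm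
after subtraction of the value at the origin is proportional to that size.  This is the form of
analyticity that yields perturbation estimates uniform in the base point.\<close>

definition small_increment :: "(real^'d \<Rightarrow> 'b::banach) \<Rightarrow> bool" where
  "small_increment f \<longleftrightarrow> (\<exists>C\<ge>0. \<forall>\<delta> x0. 0 < \<delta> \<and> \<delta> \<le> 1 \<and> (\<forall>i. \<bar>x0 $ i\<bar> \<le> \<delta>) \<longrightarrow>
     power_series_bound x0 \<delta> (C * \<delta>) (\<lambda>x. f x - f 0))"

lemma small_increment_const [simp]: "small_increment (\<lambda>x. b)"
  unfolding small_increment_def using power_series_bound_const[of _ _ 0] by (auto intro!: exI[of _ 0])

lemma small_increment_coordinate: "small_increment (\<lambda>x::real^'d. x $ j)"
  unfolding small_increment_def
proof (intro exI[of _ 2] conjI allI impI)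
  fix \<delta> :: real and x0 :: "real^'d"
  assume \<delta>: "0 < \<delta> \<and> \<delta> \<le> 1 \<and> (\<forall>i. \<bar>x0 $ i\<bar> \<le> \<delta>)"
  then have "power_series_bound x0 \<delta> (\<delta> + norm (x0 $ j)) (\<lambda>x. (x $ j - x0 $ j) + x0 $ j)"
    by (intro power_series_bound_add power_series_bound_coordinate power_series_bound_const) auto
  then show "power_series_bound x0 \<delta> (2 * \<delta>) (\<lambda>x. x $ j - (0::real^'d) $ j)"
    by (rule power_series_bound_cong) (use \<delta> in auto)
qed auto

lemma small_increment_add:
  fixes f g :: "real^'d \<Rightarrow> 'b::banach"
  assumes "small_increment f" "small_increment g" shows "small_increment (\<lambda>x. f x + g x)"
proof -
  obtain C where C: "C \<ge> 0" "\<forall>\<delta> x0. 0 < \<delta> \<and> \<delta> \<le> 1 \<and> (\<forall>i. \<bar>x0 $ i\<bar> \<le> \<delta>) \<longrightarrow> power_series_bound x0 \<delta> (C * \<delta>) (\<lambda>x. f x - f 0)"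
    using assms(1) unfolding small_increment_def by (elim exE conjE)
  note C = C(1) C(2)[rule_format]
  obtain D where D: "D \<ge> 0" "\<forall>\<delta> x0. 0 < \<delta> \<and> \<delta> \<le> 1 \<and> (\<forall>i. \<bar>x0 $ i\<bar> \<le> \<delta>) \<longrightarrow> power_series_bound x0 \<delta> (D * \<delta>) (\<lambda>x. g x - g 0)"
    using assms(2) unfolding small_increment_def by (elim exE conjE)
  note D = D(1) D(2)[rule_format]
  show ?thesis
    unfolding small_increment_def
  proof (intro exI[of _ "C + D"] conjI allI impI)
    fix \<delta> :: real and x0 :: "real^'d"
    assume \<delta>: "0 < \<delta> \<and> \<delta> \<le> 1 \<and> (\<forall>i. \<bar>x0 $ i\<bar> \<le> \<delta>)"
    then have "power_series_bound x0 \<delta> (C * \<delta> + D * \<delta>) (\<lambda>x. (f x - f 0) + (g x - g 0))"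
      by (intro power_series_bound_add C D) auto
    then show "power_series_bound x0 \<delta> ((C + D) * \<delta>) (\<lambda>x. f x + g x - (f 0 + g 0))"
      by (rule power_series_bound_cong) (auto simp: algebra_simps)
  qed (use C D in auto)
qed

text \<open>Expand \<open>prod (f x) (g x)\<close> about \<open>prod (f 0) (g 0)\<close>; the quadratic term is absorbed since
\<open>\<delta> \<le> 1\<close>.\<close>

lemma small_increment_bilinear:
  fixes prod :: "'a::banach \<Rightarrow> 'b::banach \<Rightarrow> 'c::banach"
    and f :: "real^'d \<Rightarrow> 'a" and g :: "real^'d \<Rightarrow> 'b"
  assumes bl: "bounded_bilinear prod" and le: "\<And>a b. norm (prod a b) \<le> norm a * norm b"
    and "small_increment f" "small_increment g"
  shows "small_increment (\<lambda>x. prod (f x) (g x))"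
proof -
  interpret bounded_bilinear prod by fact
  obtain C where C: "C \<ge> 0" "\<forall>\<delta> x0. 0 < \<delta> \<and> \<delta> \<le> 1 \<and> (\<forall>i. \<bar>x0 $ i\<bar> \<le> \<delta>) \<longrightarrow> power_series_bound x0 \<delta> (C * \<delta>) (\<lambda>x. f x - f 0)"
    using assms(3) unfolding small_increment_def by (elim exE conjE)
  note C = C(1) C(2)[rule_format]
  obtain D where D: "D \<ge> 0" "\<forall>\<delta> x0. 0 < \<delta> \<and> \<delta> \<le> 1 \<and> (\<forall>i. \<bar>x0 $ i\<bar> \<le> \<delta>) \<longrightarrow> power_series_bound x0 \<delta> (D * \<delta>) (\<lambda>x. g x - g 0)"
    using assms(4) unfolding small_increment_def by (elim exE conjE)
  note D = D(1) D(2)[rule_format]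
  show ?thesis
    unfolding small_increment_def
  proof (intro exI[of _ "C * D + (C * norm (g 0) + norm (f 0) * D)"] conjI allI impI)
    fix \<delta> :: real and x0 :: "real^'d"
    assume \<delta>: "0 < \<delta> \<and> \<delta> \<le> 1 \<and> (\<forall>i. \<bar>x0 $ i\<bar> \<le> \<delta>)"
    then have f: "power_series_bound x0 \<delta> (C * \<delta>) (\<lambda>x. f x - f 0)"
      and g: "power_series_bound x0 \<delta> (D * \<delta>) (\<lambda>x. g x - g 0)"
      and const: "\<And>a::'a. power_series_bound x0 \<delta> (norm a) (\<lambda>x. a)"
        "\<And>b::'b. power_series_bound x0 \<delta> (norm b) (\<lambda>x. b)"
      using C D power_series_bound_const by auto
    note mult = power_series_bound_bilinear[OF _ _ _ bl le]
    have "power_series_bound x0 \<delta> ((C * \<delta>) * (D * \<delta>) + ((C * \<delta>) * norm (g 0) + norm (f 0) * (D * \<delta>)))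
      (\<lambda>x. prod (f x - f 0) (g x - g 0) + (prod (f x - f 0) (g 0) + prod (f 0) (g x - g 0)))"
      using \<delta> by (intro power_series_bound_add mult[OF _ f g] mult[OF _ f const(2)] mult[OF _ const(1) g]) auto
    then show "power_series_bound x0 \<delta> ((C * D + (C * norm (g 0) + norm (f 0) * D)) * \<delta>)
        (\<lambda>x. prod (f x) (g x) - prod (f 0) (g 0))"
    proof (rule power_series_bound_cong)
      have "C * D * (\<delta> * \<delta>) \<le> C * D * (1 * \<delta>)"
        using C(1) D(1) \<delta> by (intro mult_left_mono mult_right_mono) auto
      then show "(C * \<delta>) * (D * \<delta>) + ((C * \<delta>) * norm (g 0) + norm (f 0) * (D * \<delta>))
          \<le> (C * D + (C * norm (g 0) + norm (f 0) * D)) * \<delta>"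
        by (simp add: algebra_simps)
    qed (simp add: diff_left diff_right)
  qed (use C D in auto)
qed

lemma small_increment_blinfun_apply:
  fixes f :: "real^'d \<Rightarrow> 'a::banach \<Rightarrow>\<^sub>L 'b::banach"
  assumes "small_increment f" "small_increment g" shows "small_increment (\<lambda>x. blinfun_apply (f x) (g x))"
  by (rule small_increment_bilinear[OF bounded_bilinear_blinfun_apply norm_blinfun assms])

lemma small_increment_compose:
  fixes f :: "real^'d \<Rightarrow> 'a::banach \<Rightarrow>\<^sub>L 'b::banach" and g :: "real^'d \<Rightarrow> 'c::banach \<Rightarrow>\<^sub>L 'a"
  assumes "small_increment f" "small_increment g" shows "small_increment (\<lambda>x. f x o\<^sub>L g x)"
  by (rule small_increment_bilinear[OF bounded_bilinear_blinfun_compose norm_blinfun_compose assms])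

lemma small_increment_scaleR:
  fixes f :: "real^'d \<Rightarrow> real" and g :: "real^'d \<Rightarrow> 'a::banach"
  assumes "small_increment f" "small_increment g" shows "small_increment (\<lambda>x. f x *\<^sub>R g x)"
  by (rule small_increment_bilinear[OF bounded_bilinear_scaleR _ assms]) simp

lemma small_increment_sum:
  assumes "\<And>a. a \<in> A \<Longrightarrow> small_increment (f a)" shows "small_increment (\<lambda>x. \<Sum>a\<in>A. f a x)"
  using assms
proof (induction A rule: infinite_finite_induct)
  case (insert a A)
  have "small_increment (\<lambda>x. f a x + (\<Sum>a\<in>A. f a x))"
    by (rule small_increment_add) (use insert in auto)
  then show ?case using insert by simp
qed simp_all

lemma small_increment_uminus:
  assumes "small_increment f" shows "small_increment (\<lambda>x. - f x)"
proof -
  have "small_increment (\<lambda>x. (-1) *\<^sub>R f x)" by (rule small_increment_scaleR[OF small_increment_const assms])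
  then show ?thesis by simp
qed

lemma small_incrementE:
  fixes f :: "real^'d \<Rightarrow> 'b::banach"
  assumes "small_increment f"
  obtains C where "C \<ge> 0"
    "\<And>\<delta> x0. \<lbrakk>0 < \<delta>; \<delta> \<le> 1; x0 \<in> cube 0 \<delta>\<rbrakk> \<Longrightarrow> power_series_bound x0 \<delta> (C * \<delta>) (\<lambda>x. f x - f 0)"
proof -
  obtain C where C: "C \<ge> 0" "\<forall>\<delta> x0. 0 < \<delta> \<and> \<delta> \<le> 1 \<and> (\<forall>i. \<bar>x0 $ i\<bar> \<le> \<delta>) \<longrightarrow>
     power_series_bound x0 \<delta> (C * \<delta>) (\<lambda>x. f x - f 0)"
    using assms unfolding small_increment_def by (elim exE conjE)
  show ?thesis
    by (rule that[OF C(1)], rule C(2)[rule_format]) (auto simp: cube_def)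
qed

section \<open>Analytic perturbation of a simple eigenvalue\<close>

text \<open>The Lyapunov--Schmidt equation: \<open>l w + m\<close> will be the eigenvalue belonging to the correction \<open>w\<close>.\<close>

definition quadratic_map ::
    "('b::banach \<Rightarrow>\<^sub>L 'b) \<Rightarrow> 'b \<Rightarrow> ('b \<Rightarrow>\<^sub>L real) \<Rightarrow> real \<Rightarrow> ('b \<Rightarrow>\<^sub>L 'b) \<Rightarrow> 'b \<Rightarrow> 'b" where
  "quadratic_map R b l m K w = R w + b + (l w + m) *\<^sub>R K w"

lemma quadratic_map_diff:
  "quadratic_map R b l m K v - quadratic_map R b l m K w
     = R (v - w) + (l (v - w) *\<^sub>R K v + (l w + m) *\<^sub>R K (v - w))"
  by (simp add: quadratic_map_def blinfun.diff_right algebra_simps)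

lemma quadratic_map_contraction:
  assumes "norm R \<le> NR" "norm l \<le> Nl" "\<bar>m\<bar> \<le> Nm" "norm v \<le> 1" "norm w \<le> 1"
  shows "norm (quadratic_map R b l m K v - quadratic_map R b l m K w)
    \<le> (NR + (2 * Nl + Nm) * norm K) * norm (v - w)"
proof -
  have bd: "norm (blinfun_apply A x) \<le> a * y" if "norm A \<le> a" "norm x \<le> y"
    for A :: "'p::real_normed_vector \<Rightarrow>\<^sub>L 'q::real_normed_vector" and x a y
  proof -
    have "norm (blinfun_apply A x) \<le> norm A * norm x" by (rule norm_blinfun)
    also have "\<dots> \<le> a * y" using that order_trans[OF norm_ge_zero that(1)] by (intro mult_mono) auto
    finally show ?thesis .
  qed
  have Nl0: "0 \<le> Nl" by (rule order_trans[OF norm_ge_zero assms(2)])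
  have 1: "norm (R (v - w)) \<le> NR * norm (v - w)" by (rule bd) (use assms in auto)
  have lv: "norm (l (v - w)) \<le> Nl * norm (v - w)" by (rule bd) (use assms in auto)
  have lw: "norm (l w) \<le> Nl * 1" by (rule bd) (use assms in auto)
  have Kv: "norm (K v) \<le> norm K * 1" by (rule bd) (use assms in auto)
  have Kd: "norm (K (v - w)) \<le> norm K * norm (v - w)" by (rule bd) auto
  have "norm (l (v - w) *\<^sub>R K v) \<le> (Nl * norm (v - w)) * (norm K * 1)"
    unfolding norm_scaleR using lv Kv Nl0 by (intro mult_mono) auto
  moreover have "norm ((l w + m) *\<^sub>R K (v - w)) \<le> (Nl + Nm) * (norm K * norm (v - w))"
    unfolding norm_scaleR using lw Kd assms(3) Nl0 by (intro mult_mono) auto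
  ultimately have "norm (R (v - w) + (l (v - w) *\<^sub>R K v + (l w + m) *\<^sub>R K (v - w)))
      \<le> NR * norm (v - w) + ((Nl * norm (v - w)) * (norm K * 1) + (Nl + Nm) * (norm K * norm (v - w)))"
    using 1 by (intro norm_triangle_mono)
  then show ?thesis unfolding quadratic_map_diff by (simp add: algebra_simps)
qed

text \<open>The contraction principle in the space of normed power series.  The iterates are defined pointwise
and do not refer to a base point; about each base point \<open>x0\<close> their differences decay
geometrically in the norm of power series, so their limit has an expansion about every \<open>x0\<close>.\<close>

theorem analytic_fixed_point:
  fixes R :: "real^'d \<Rightarrow> 'b::banach \<Rightarrow>\<^sub>L 'b" and l :: "real^'d \<Rightarrow> 'b \<Rightarrow>\<^sub>L real"
  assumes r: "r > 0"
    and psb: "\<And>x0. x0 \<in> S \<Longrightarrow> power_series_bound x0 r NR R"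
      "\<And>x0. x0 \<in> S \<Longrightarrow> power_series_bound x0 r Nb b"
      "\<And>x0. x0 \<in> S \<Longrightarrow> power_series_bound x0 r Nl l"
      "\<And>x0. x0 \<in> S \<Longrightarrow> power_series_bound x0 r Nm m"
    and contr: "NR + (2 * Nl + Nm) * norm K \<le> \<theta>" "\<theta> < 1" "Nb \<le> 1 - \<theta>"
  obtains w where
    "\<And>x0. x0 \<in> S \<Longrightarrow> power_series_bound x0 r 1 w"
    "\<And>x0 x. x0 \<in> S \<Longrightarrow> x \<in> cube x0 r \<Longrightarrow> quadratic_map (R x) (b x) (l x) (m x) K (w x) = w x"
proof (cases "S = {}")
  case True
  then show ?thesis using that by blast
next
  case False
  then obtain s where s: "s \<in> S" by blast
  note nonneg = power_series_bound_nonneg[OF psb(1)[OF s] r] power_series_bound_nonneg[OF psb(2)[OF s] r]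
    power_series_bound_nonneg[OF psb(3)[OF s] r] power_series_bound_nonneg[OF psb(4)[OF s] r]
  have \<theta>0: "\<theta> \<ge> 0" by (rule order_trans[OF _ contr(1)]) (use nonneg in auto)
  define W where "W n x = ((quadratic_map (R x) (b x) (l x) (m x) K) ^^ n) 0" for n x
  define D where "D n x = W (Suc n) x - W n x" for n x
  have W_Suc: "W (Suc n) x = quadratic_map (R x) (b x) (l x) (m x) K (W n x)" for n x
    by (simp add: W_def)
  have W0: "W 0 x = 0" for x by (simp add: W_def)
  have WD: "W n x = (\<Sum>k<n. D k x)" for n x
    by (induction n) (simp_all add: D_def W0)
  have geo: "summable (\<lambda>n. Nb * \<theta> ^ n)" and geo_sum: "(\<Sum>n. Nb * \<theta> ^ n) \<le> 1"
    and geo_part: "(\<Sum>k<n. Nb * \<theta> ^ k) \<le> 1" for n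
  proof -
    show sm: "summable (\<lambda>n. Nb * \<theta> ^ n)"
      using \<theta>0 contr by (intro summable_mult summable_geometric) auto
    have "(\<Sum>n. Nb * \<theta> ^ n) = Nb / (1 - \<theta>)"
      using \<theta>0 contr by (simp add: suminf_mult suminf_geometric summable_geometric)
    then show le: "(\<Sum>n. Nb * \<theta> ^ n) \<le> 1" using contr by simp
    have "(\<Sum>k<n. Nb * \<theta> ^ k) \<le> (\<Sum>n. Nb * \<theta> ^ n)"
      by (rule sum_le_suminf[OF sm]) (use nonneg \<theta>0 in auto)
    then show "(\<Sum>k<n. Nb * \<theta> ^ k) \<le> 1" using le by linarith
  qed
  have Dbound: "power_series_bound x0 r (Nb * \<theta> ^ n) (D n)" if x0: "x0 \<in> S" for x0 n
  proof (induction n rule: less_induct)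
    case (less n)
    show ?case
    proof (cases n)
      case 0
      have "D 0 = b"
        by (rule ext) (simp add: D_def W_def quadratic_map_def)
      then show ?thesis using 0 psb(2)[OF x0] by simp
    next
      case (Suc k)
      have W: "power_series_bound x0 r 1 (W j)" if "j \<le> n" for j
      proof -
        have "power_series_bound x0 r (\<Sum>k<j. Nb * \<theta> ^ k) (\<lambda>x. \<Sum>k<j. D k x)"
          by (rule power_series_bound_sum_lessThan[OF r]) (use less that in auto)
        then show ?thesis
          by (rule power_series_bound_cong) (use geo_part WD in auto)
      qed
      let ?d = "Nb * \<theta> ^ k"
      have Dk: "power_series_bound x0 r ?d (D k)" using less Suc by auto
      have Dn: "D n x = R x (D k x) + (l x (D k x) *\<^sub>R K (W n x) + (l x (W k x) + m x) *\<^sub>R K (D k x))" for x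
      proof -
        let ?T = "quadratic_map (R x) (b x) (l x) (m x) K"
        have "D n x = ?T (W n x) - ?T (W k x)" using Suc by (simp add: D_def W_Suc)
        also have "\<dots> = R x (W n x - W k x)
            + (l x (W n x - W k x) *\<^sub>R K (W n x) + (l x (W k x) + m x) *\<^sub>R K (W n x - W k x))"
          by (rule quadratic_map_diff)
        finally show ?thesis using Suc by (simp add: D_def)
      qed
      have K: "power_series_bound x0 r (norm K) (\<lambda>x. K)" by (rule power_series_bound_const[OF r])
      have "power_series_bound x0 r (NR * ?d + ((Nl * ?d) * (norm K * 1) + (Nl * 1 + Nm) * (norm K * ?d)))
          (\<lambda>x. R x (D k x) + (l x (D k x) *\<^sub>R K (W n x) + (l x (W k x) + m x) *\<^sub>R K (D k x)))"
        using W[of n] W[of k] Suc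
        by (intro power_series_bound_add power_series_bound_blinfun_apply power_series_bound_scaleR
            psb x0 Dk K r) auto
      then show ?thesis
      proof (rule power_series_bound_cong)
        have "NR * ?d + ((Nl * ?d) * (norm K * 1) + (Nl * 1 + Nm) * (norm K * ?d))
            = (NR + (2 * Nl + Nm) * norm K) * ?d"
          by (simp add: algebra_simps)
        also have "\<dots> \<le> \<theta> * ?d"
          using nonneg \<theta>0 by (intro mult_right_mono contr) auto
        finally show "NR * ?d + ((Nl * ?d) * (norm K * 1) + (Nl * 1 + Nm) * (norm K * ?d)) \<le> Nb * \<theta> ^ n"
          using Suc by (simp add: mult_ac)
      qed (simp add: Dn)
    qed
  qed
  define w where "w x = (\<Sum>n. D n x)" for x
  have sums: "(\<lambda>n. D n x) sums w x" if "x0 \<in> S" "x \<in> cube x0 r" for x0 x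
    unfolding w_def
  proof (rule summable_sums, rule summable_comparison_test'[OF geo, of 0])
    show "norm (D n x) \<le> Nb * \<theta> ^ n" for n
      by (rule power_series_bound_norm_le[OF Dbound[OF that(1)] that(2)])
  qed
  show ?thesis
  proof (rule that)
    fix x0 assume x0: "x0 \<in> S"
    have "power_series_bound x0 r (\<Sum>n. Nb * \<theta> ^ n) w"
      by (rule power_series_bound_series[OF r Dbound[OF x0] geo sums[OF x0]])
    then show "power_series_bound x0 r 1 w"
      by (rule power_series_bound_mono) (rule geo_sum)
    fix x assume x: "x \<in> cube x0 r"
    have lim: "(\<lambda>n. W n x) \<longlonglongrightarrow> w x"
      using sums[OF x0 x] unfolding sums_def WD .
    have "(\<lambda>n. W (Suc n) x) \<longlonglongrightarrow> quadratic_map (R x) (b x) (l x) (m x) K (w x)"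
      unfolding W_Suc quadratic_map_def by (intro tendsto_intros lim)
    then show "quadratic_map (R x) (b x) (l x) (m x) K (w x) = w x"
      using LIMSEQ_unique LIMSEQ_Suc[OF lim] by blast
  qed
qed

text \<open>Expanding the square gives \<open>1 - 2 \<tau> c + \<tau>\<^sup>2 M\<^sup>2\<close>, and \<open>\<tau> = c / M\<^sup>2\<close> minimises this.\<close>

lemma norm_id_minus_coercive:
  fixes T :: "'a::real_inner \<Rightarrow>\<^sub>L 'a"
  assumes c: "c > 0" and M: "norm T \<le> M" "c \<le> M" and x: "inner (T x) x \<ge> c * (norm x)\<^sup>2"
  shows "norm (x - (c / M\<^sup>2) *\<^sub>R T x) \<le> sqrt (1 - (c / M)\<^sup>2) * norm x"
proof -
  have M0: "M > 0" using c M by linarith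
  have q0: "0 \<le> 1 - (c / M)\<^sup>2" using c M M0 by (simp add: power_divide divide_le_eq power_mono)
  have nT: "(norm (T x))\<^sup>2 \<le> (M * norm x)\<^sup>2"
    by (intro power_mono order_trans[OF norm_blinfun] mult_right_mono M) auto
  have "(norm (x - (c / M\<^sup>2) *\<^sub>R T x))\<^sup>2
      = (norm x)\<^sup>2 - 2 * (c / M\<^sup>2) * inner (T x) x + (c / M\<^sup>2)\<^sup>2 * (norm (T x))\<^sup>2"
    unfolding power2_norm_eq_inner
    by (simp add: inner_diff_left inner_diff_right inner_commute[of x "T x"] power2_eq_square algebra_simps)
  also have "\<dots> \<le> (norm x)\<^sup>2 - 2 * (c / M\<^sup>2) * (c * (norm x)\<^sup>2) + (c / M\<^sup>2)\<^sup>2 * (M * norm x)\<^sup>2"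
    using x nT c by (intro add_mono diff_mono mult_left_mono) auto
  also have "\<dots> = (sqrt (1 - (c / M)\<^sup>2) * norm x)\<^sup>2"
    using M0 q0 by (simp add: power_mult_distrib power2_eq_square field_simps)
  finally show ?thesis
    by (rule power2_le_imp_le) (use q0 in auto)
qed

text \<open>The operators \<open>B x\<close> and \<open>K\<close> describe the generalised eigenvalue problem \<open>B x v = \<mu> K v\<close>; \<open>P\<close> projects onto a
complement of the eigenvector \<open>e\<close> of \<open>B 0\<close>, on which \<open>B 0\<close> is coercive.  The equation for
\<open>e + w\<close> is split into its part in the range of \<open>P\<close> and its component along \<open>e\<close>, and the latter
defines \<open>lam\<close>.  The last two conclusions exclude further eigenvalues between \<open>0\<close> and \<open>lam\<close>: by
coercivity an eigenvector in the range of \<open>P\<close> vanishes, and one of the form \<open>e + v\<close> has \<open>v\<close> in the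
unit ball, where the fixed point is unique.\<close>

theorem simple_eigenvalue_analytic:
  fixes B :: "real^'d \<Rightarrow> 'a::{real_inner,banach} \<Rightarrow>\<^sub>L 'a" and P K :: "'a \<Rightarrow>\<^sub>L 'a" and e :: 'a
  assumes B: "small_increment B" and Be: "B 0 e = 0" and eB: "\<And>x. inner (B 0 x) e = 0"
    and c: "c > 0" and coercive: "\<And>x. P x = x \<Longrightarrow> inner (B 0 x) x \<ge> c * (norm x)\<^sup>2"
    and PP: "\<And>x. P (P x) = P x" and Pn: "\<And>x. norm (P x) \<le> norm x"
    and Psym: "\<And>x y. inner (P x) y = inner x (P y)" and Pe: "P e = 0"
    and Kn: "\<And>x. norm (K x) \<le> norm x"
  obtains \<delta> N w lam where "\<delta> > 0"
    "\<And>x0. x0 \<in> cube 0 \<delta> \<Longrightarrow> power_series_bound x0 \<delta> N w"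
    "\<And>x0. x0 \<in> cube 0 \<delta> \<Longrightarrow> power_series_bound x0 \<delta> N lam"
    "\<And>x. x \<in> cube 0 (2 * \<delta>) \<Longrightarrow> P (w x) = w x"
    "\<And>x. x \<in> cube 0 (2 * \<delta>) \<Longrightarrow> P (B x (e + w x)) = lam x *\<^sub>R P (K (w x))"
    "\<And>x. x \<in> cube 0 (2 * \<delta>) \<Longrightarrow> lam x = inner (B x (e + w x)) e"
    "\<And>x v \<mu>. \<lbrakk>x \<in> cube 0 (2 * \<delta>); P v = v; 0 \<le> \<mu>; \<mu> \<le> lam x;
       P (B x (e + v)) = \<mu> *\<^sub>R P (K v); \<mu> = inner (B x (e + v)) e\<rbrakk> \<Longrightarrow> \<mu> = lam x"
    "\<And>x v \<mu>. \<lbrakk>x \<in> cube 0 (2 * \<delta>); P v = v; 0 \<le> \<mu>; \<mu> \<le> lam x;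
       P (B x v) = \<mu> *\<^sub>R P (K v)\<rbrakk> \<Longrightarrow> v = 0"
proof -
  define M where "M = norm (B 0) + c"
  have M: "norm (B 0) \<le> M" "c \<le> M" "M > 0" using c by (auto simp: M_def add_nonneg_pos)
  define \<tau> where "\<tau> = c / M\<^sup>2"
  have \<tau>: "\<tau> > 0" using c M by (simp add: \<tau>_def)
  define q where "q = sqrt (1 - (c / M)\<^sup>2)"
  have q: "0 \<le> q" "q < 1"
    using c M by (auto simp: q_def power_divide divide_le_eq power_mono)
  \<comment> \<open>With these coefficients \<open>quadratic_map\<close> is
    \<open>v \<mapsto> P (P v - \<tau> (B x (e + P v) - \<lambda> K (P v)))\<close> with \<open>\<lambda> = \<langle>B x (e + P v), e\<rangle>\<close>.
    It is defined on the whole space, and its fixed points lie in the range of \<open>P\<close>.\<close>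
  define R where "R x = (P o\<^sub>L P) + (-\<tau>) *\<^sub>R (P o\<^sub>L (B x o\<^sub>L P))" for x
  define b where "b x = (-\<tau>) *\<^sub>R P (B x e)" for x
  define l where "l x = blinfun_inner_right e o\<^sub>L (B x o\<^sub>L P)" for x
  define m where "m x = blinfun_apply (blinfun_inner_right e) (B x e)" for x
  define K' where "K' = \<tau> *\<^sub>R (P o\<^sub>L (K o\<^sub>L P))"
  define g where "g x = B x e" for x
  have small_increment_R: "small_increment R" unfolding R_def
    by (intro small_increment_add small_increment_scaleR small_increment_compose small_increment_const B)
  have small_increment_b: "small_increment b" unfolding b_def
    by (intro small_increment_scaleR small_increment_blinfun_apply small_increment_const B)
  have small_increment_l: "small_increment l" unfolding l_def by (intro small_increment_compose small_increment_const B)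
  have small_increment_m: "small_increment m" unfolding m_def by (intro small_increment_blinfun_apply small_increment_const B)
  have small_increment_g: "small_increment g" unfolding g_def by (intro small_increment_blinfun_apply small_increment_const B)
  have zero: "b 0 = 0" "l 0 = 0" "m 0 = 0" "g 0 = 0"
    by (auto simp: b_def l_def m_def g_def Be eB inner_commute[of e] intro!: blinfun_eqI)
  have R0: "norm (R 0) \<le> q"
  proof (rule norm_blinfun_bound[OF q(1)])
    fix x
    have "R 0 x = P (P x - \<tau> *\<^sub>R B 0 (P x))"
      by (simp add: R_def blinfun.add_left blinfun.diff_left blinfun.diff_right blinfun.scaleR_left blinfun.scaleR_right)
    then have "norm (R 0 x) \<le> norm (P x - \<tau> *\<^sub>R B 0 (P x))" using Pn by simp
    also have "\<dots> \<le> q * norm (P x)"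
      unfolding q_def \<tau>_def by (rule norm_id_minus_coercive[OF c M(1,2) coercive[OF PP]])
    also have "\<dots> \<le> q * norm x" by (intro mult_left_mono Pn q)
    finally show "norm (R 0 x) \<le> q * norm x" .
  qed
  obtain CR where CR: "CR \<ge> 0" "\<And>\<delta> x0. \<lbrakk>0 < \<delta>; \<delta> \<le> 1; x0 \<in> cube 0 \<delta>\<rbrakk> \<Longrightarrow> power_series_bound x0 \<delta> (CR * \<delta>) (\<lambda>x. R x - R 0)"
    by (rule small_incrementE[OF small_increment_R], rule that)
  obtain Cb where Cb: "Cb \<ge> 0" "\<And>\<delta> x0. \<lbrakk>0 < \<delta>; \<delta> \<le> 1; x0 \<in> cube 0 \<delta>\<rbrakk> \<Longrightarrow> power_series_bound x0 \<delta> (Cb * \<delta>) (\<lambda>x. b x - b 0)"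
    by (rule small_incrementE[OF small_increment_b], rule that)
  obtain Cl where Cl: "Cl \<ge> 0" "\<And>\<delta> x0. \<lbrakk>0 < \<delta>; \<delta> \<le> 1; x0 \<in> cube 0 \<delta>\<rbrakk> \<Longrightarrow> power_series_bound x0 \<delta> (Cl * \<delta>) (\<lambda>x. l x - l 0)"
    by (rule small_incrementE[OF small_increment_l], rule that)
  obtain Cm where Cm: "Cm \<ge> 0" "\<And>\<delta> x0. \<lbrakk>0 < \<delta>; \<delta> \<le> 1; x0 \<in> cube 0 \<delta>\<rbrakk> \<Longrightarrow> power_series_bound x0 \<delta> (Cm * \<delta>) (\<lambda>x. m x - m 0)"
    by (rule small_incrementE[OF small_increment_m], rule that)
  obtain Cg where Cg: "Cg \<ge> 0" "\<And>\<delta> x0. \<lbrakk>0 < \<delta>; \<delta> \<le> 1; x0 \<in> cube 0 \<delta>\<rbrakk> \<Longrightarrow> power_series_bound x0 \<delta> (Cg * \<delta>) (\<lambda>x. g x - g 0)"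
    by (rule small_incrementE[OF small_increment_g], rule that)
  obtain CB where CB: "CB \<ge> 0" "\<And>\<delta> x0. \<lbrakk>0 < \<delta>; \<delta> \<le> 1; x0 \<in> cube 0 \<delta>\<rbrakk> \<Longrightarrow> power_series_bound x0 \<delta> (CB * \<delta>) (\<lambda>x. B x - B 0)"
    by (rule small_incrementE[OF B], rule that)
  \<comment> \<open>a common bound for all perturbation constants, and the smallness \<open>\<epsilon>\<close> required of them:
    half of the contraction gap, and a quarter of the coercivity constant\<close>
  define D where "D = CR + (2 * Cl + Cm) * norm K' + Cb + Cl + Cm + Cg + CB + 1"
  define \<epsilon> where "\<epsilon> = min ((1 - q) / 2) (c / 4)"
  define \<delta> where "\<delta> = min 1 (\<epsilon> / D)"
  have \<epsilon>: "\<epsilon> > 0" using q c by (simp add: \<epsilon>_def)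
  have nK: "(2 * Cl + Cm) * norm K' \<ge> 0" using Cl(1) Cm(1) by simp
  have D: "D > 0" unfolding D_def using CR(1) Cb(1) Cl(1) Cm(1) Cg(1) CB(1) nK by linarith
  have \<delta>: "\<delta> > 0" "\<delta> \<le> 1" using \<epsilon> D by (auto simp: \<delta>_def)
  have D\<delta>: "D * \<delta> \<le> \<epsilon>"
  proof -
    have "\<delta> \<le> \<epsilon> / D" by (simp add: \<delta>_def)
    then show ?thesis using D by (simp add: field_simps)
  qed
  have small: "t * \<delta> \<le> \<epsilon>" if "t \<le> D" for t
    using mult_right_mono[OF that less_imp_le[OF \<delta>(1)]] D\<delta> by linarith
  have s1: "CR * \<delta> + (2 * (Cl * \<delta>) + Cm * \<delta>) * norm K' \<le> \<epsilon>"
    using small[of "CR + (2 * Cl + Cm) * norm K'"] Cb(1) Cl(1) Cm(1) Cg(1) CB(1)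
    by (simp add: D_def algebra_simps)
  have s2: "Cb * \<delta> \<le> \<epsilon>" and s3: "Cl * \<delta> + Cm * \<delta> \<le> \<epsilon>" and s4: "Cg * \<delta> \<le> \<epsilon>" and s5: "CB * \<delta> \<le> \<epsilon>"
    using small[of Cb] small[of "Cl + Cm"] small[of Cg] small[of CB]
      CR(1) Cb(1) Cl(1) Cm(1) Cg(1) CB(1) nK by (auto simp: D_def algebra_simps)
  have psbR: "power_series_bound x0 \<delta> (q + CR * \<delta>) R"
    and psbb: "power_series_bound x0 \<delta> (Cb * \<delta>) b"
    and psbl: "power_series_bound x0 \<delta> (Cl * \<delta>) l"
    and psbm: "power_series_bound x0 \<delta> (Cm * \<delta>) m"
    and psbg: "power_series_bound x0 \<delta> (Cg * \<delta>) g"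
    if "x0 \<in> cube 0 \<delta>" for x0
  proof -
    have "power_series_bound x0 \<delta> (norm (R 0) + CR * \<delta>) (\<lambda>x. R 0 + (R x - R 0))"
      by (rule power_series_bound_add[OF \<delta>(1) power_series_bound_const[OF \<delta>(1)] CR(2)[OF \<delta> that]])
    then show "power_series_bound x0 \<delta> (q + CR * \<delta>) R"
      by (rule power_series_bound_cong) (use R0 in auto)
  qed (use Cb(2)[OF \<delta> that] Cl(2)[OF \<delta> that] Cm(2)[OF \<delta> that] Cg(2)[OF \<delta> that] zero in auto)
  define \<theta> where "\<theta> = q + \<epsilon>"
  have "\<epsilon> \<le> (1 - q) / 2" unfolding \<epsilon>_def by (rule min.cobounded1)
  then have "2 * \<epsilon> \<le> 1 - q" by simp
  then have \<theta>: "\<theta> < 1" "\<epsilon> \<le> 1 - \<theta>" using q unfolding \<theta>_def by linarith+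
  have contr: "(q + CR * \<delta>) + (2 * (Cl * \<delta>) + Cm * \<delta>) * norm K' \<le> \<theta>"
    using s1 by (simp add: \<theta>_def)
  obtain w where w: "\<And>x0. x0 \<in> cube 0 \<delta> \<Longrightarrow> power_series_bound x0 \<delta> 1 w"
    and fix_w: "\<And>x0 x. \<lbrakk>x0 \<in> cube 0 \<delta>; x \<in> cube x0 \<delta>\<rbrakk>
        \<Longrightarrow> quadratic_map (R x) (b x) (l x) (m x) K' (w x) = w x"
    by (rule analytic_fixed_point[OF \<delta>(1) psbR psbb psbl psbm contr \<theta>(1)])
      (use s2 \<theta>(2) in \<open>auto intro: that\<close>)
  define lam where "lam x = l x (w x) + m x" for x
  have center: "\<exists>x0\<in>cube 0 \<delta>. x \<in> cube x0 \<delta>" if "x \<in> cube 0 (2 * \<delta>)" for x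
  proof (rule bexI[of _ "(1/2) *\<^sub>R x"])
    show "x \<in> cube ((1/2) *\<^sub>R x) \<delta>" "(1/2) *\<^sub>R x \<in> cube 0 \<delta>"
      using that by (auto simp: cube_def abs_mult mult.commute[of \<delta>])
  qed
  have quad: "quadratic_map (R x) (b x) (l x) (m x) K' v
      = P (P v) - \<tau> *\<^sub>R P (B x (e + P v) - (inner (B x (e + P v)) e) *\<^sub>R K (P v))" for x v
    by (simp add: quadratic_map_def R_def b_def l_def m_def K'_def blinfun.add_left blinfun.diff_left blinfun.add_right
        blinfun.diff_right blinfun.scaleR_left blinfun.scaleR_right inner_commute[of e] inner_add_left
        algebra_simps)
  have Pw: "P (w x) = w x" if "x \<in> cube 0 (2 * \<delta>)" for x
  proof -
    from center[OF that] obtain x0 where "x0 \<in> cube 0 \<delta>" "x \<in> cube x0 \<delta>" by blast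
    from fix_w[OF this] have "w x = P (P (w x) - \<tau> *\<^sub>R (B x (e + P (w x)) - (inner (B x (e + P (w x))) e) *\<^sub>R K (P (w x))))"
      unfolding quad by (simp add: blinfun.diff_right blinfun.scaleR_right)
    then show ?thesis using PP by metis
  qed
  have lam_inner: "lam x = inner (B x (e + w x)) e" if "x \<in> cube 0 (2 * \<delta>)" for x
    using Pw[OF that]
    by (simp add: lam_def l_def m_def inner_commute[of e] blinfun.add_right inner_add_left)
  have eqn: "P (B x (e + w x)) = lam x *\<^sub>R P (K (w x))" if x: "x \<in> cube 0 (2 * \<delta>)" for x
  proof -
    from center[OF x] obtain x0 where "x0 \<in> cube 0 \<delta>" "x \<in> cube x0 \<delta>" by blast
    from fix_w[OF this] have "\<tau> *\<^sub>R P (B x (e + w x) - lam x *\<^sub>R K (w x)) = 0"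
      unfolding quad Pw[OF x] lam_inner[OF x] by simp
    then show ?thesis using \<tau> by (simp add: blinfun.diff_right blinfun.scaleR_right)
  qed
  have lam_psb: "power_series_bound x0 \<delta> \<epsilon> lam" if "x0 \<in> cube 0 \<delta>" for x0
  proof -
    have "power_series_bound x0 \<delta> (Cl * \<delta> * 1 + Cm * \<delta>) (\<lambda>x. l x (w x) + m x)"
      by (intro power_series_bound_add power_series_bound_blinfun_apply \<delta> psbl psbm w that)
    then show ?thesis
      by (rule power_series_bound_cong) (use s3 lam_def in auto)
  qed
  have coer: "norm v * (c / 2) \<le> norm y"
    if x: "x \<in> cube 0 (2 * \<delta>)" and v: "P v = v" and \<mu>: "0 \<le> \<mu>" "\<mu> \<le> lam x"
      and eq: "P (y + B x v) = \<mu> *\<^sub>R P (K v)" for x v \<mu> y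
  proof -
    from center[OF x] obtain x0 where x0: "x0 \<in> cube 0 \<delta>" "x \<in> cube x0 \<delta>" by blast
    have "norm (B x - B 0) \<le> CB * \<delta>"
      by (rule power_series_bound_norm_le[OF CB(2)[OF \<delta> x0(1)] x0(2)])
    then have "norm (B x - B 0) \<le> c / 4" using s5 by (simp add: \<epsilon>_def)
    then have nB: "norm ((B x - B 0) v) \<le> c / 4 * norm v"
      by (intro order_trans[OF norm_blinfun] mult_right_mono) auto
    have "norm (lam x) \<le> \<epsilon>" by (rule power_series_bound_norm_le[OF lam_psb[OF x0(1)] x0(2)])
    then have \<mu>4: "\<mu> \<le> c / 4" using \<mu> by (simp add: \<epsilon>_def)
    have "inner (y + B x v) v = \<mu> * inner (K v) v"
      using arg_cong[OF eq, of "\<lambda>z. inner z v"] by (simp add: Psym v)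
    moreover have "\<mu> * inner (K v) v \<le> c / 4 * (norm v)\<^sup>2"
    proof -
      have "inner (K v) v \<le> norm (K v) * norm v" by (rule norm_cauchy_schwarz)
      also have "\<dots> \<le> (norm v)\<^sup>2" unfolding power2_eq_square by (intro mult_right_mono Kn) auto
      finally have "\<mu> * inner (K v) v \<le> \<mu> * (norm v)\<^sup>2" using \<mu> by (intro mult_left_mono)
      also have "\<dots> \<le> c / 4 * (norm v)\<^sup>2" using \<mu>4 by (intro mult_right_mono) auto
      finally show ?thesis .
    qed
    moreover have "inner (B x v) v = inner (B 0 v) v + inner ((B x - B 0) v) v"
      by (simp add: blinfun.diff_left inner_diff_left)
    moreover have "inner ((B x - B 0) v) v \<ge> - (c / 4 * (norm v)\<^sup>2)"
    proof -
      have "\<bar>inner ((B x - B 0) v) v\<bar> \<le> norm ((B x - B 0) v) * norm v" by (rule Cauchy_Schwarz_ineq2)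
      also have "\<dots> \<le> (c / 4 * norm v) * norm v" by (intro mult_right_mono nB) auto
      finally show ?thesis by (simp add: power2_eq_square)
    qed
    moreover have "inner y v \<ge> - (norm y * norm v)"
      using Cauchy_Schwarz_ineq2[of y v] by linarith
    ultimately have "norm v * (c / 2) * norm v \<le> norm y * norm v"
      using coercive[OF v] by (simp add: inner_add_left power2_eq_square algebra_simps)
    then show ?thesis
      by (cases "v = 0") (auto simp: mult_le_cancel_right mult.commute)
  qed
  show ?thesis
  proof (rule that[OF \<delta>(1), of "1 + \<epsilon>" w lam])
    show "power_series_bound x0 \<delta> (1 + \<epsilon>) w" if "x0 \<in> cube 0 \<delta>" for x0
      by (rule power_series_bound_mono[OF w[OF that]]) (use \<epsilon> in auto)
    show "power_series_bound x0 \<delta> (1 + \<epsilon>) lam" if "x0 \<in> cube 0 \<delta>" for x0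
      by (rule power_series_bound_mono[OF lam_psb[OF that]]) auto
    show "v = 0" if "x \<in> cube 0 (2 * \<delta>)" "P v = v" "0 \<le> \<mu>" "\<mu> \<le> lam x" "P (B x v) = \<mu> *\<^sub>R P (K v)"
      for x v \<mu>
    proof -
      have "norm v * (c / 2) \<le> norm (0::'a)" by (rule coer[OF that(1-4)]) (use that in simp)
      then have "norm v * (c / 2) \<le> 0" by simp
      then show ?thesis using c by (simp add: mult_le_0_iff)
    qed
    show "\<mu> = lam x" if x: "x \<in> cube 0 (2 * \<delta>)" and v: "P v = v" and \<mu>: "0 \<le> \<mu>" "\<mu> \<le> lam x"
      and eq: "P (B x (e + v)) = \<mu> *\<^sub>R P (K v)" and \<mu>_eq: "\<mu> = inner (B x (e + v)) e" for x v \<mu>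
    proof -
      from center[OF x] obtain x0 where x0: "x0 \<in> cube 0 \<delta>" "x \<in> cube x0 \<delta>" by blast
      note nle = power_series_bound_norm_le[OF _ x0(2)]
      have "norm v * (c / 2) \<le> norm (B x e)"
        by (rule coer[OF x v \<mu>]) (use eq in \<open>simp add: blinfun.add_right\<close>)
      also have "\<dots> \<le> c / 4"
        using nle[OF psbg[OF x0(1)]] s4 by (simp add: g_def \<epsilon>_def)
      finally have v1: "norm v \<le> 1" using c by (simp add: field_simps)
      have w1: "norm (w x) \<le> 1" by (rule nle[OF w[OF x0(1)]])
      have fix_v: "quadratic_map (R x) (b x) (l x) (m x) K' v = v"
        unfolding quad using v eq \<mu>_eq by (simp add: blinfun.diff_right blinfun.scaleR_right)
      have "norm (v - w x) \<le> (q + CR * \<delta> + (2 * (Cl * \<delta>) + Cm * \<delta>) * norm K') * norm (v - w x)"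
        using quadratic_map_contraction[of "R x" "q + CR * \<delta>" "l x" "Cl * \<delta>" "m x" "Cm * \<delta>" v "w x" "b x" K']
          nle[OF psbR[OF x0(1)]] nle[OF psbl[OF x0(1)]] nle[OF psbm[OF x0(1)]] v1 w1
        unfolding fix_v fix_w[OF x0] by simp
      also have "\<dots> \<le> \<theta> * norm (v - w x)" by (intro mult_right_mono contr) auto
      finally have "v = w x" using \<theta>(1)
        by (smt (verit) mult_less_cancel_right2 norm_le_zero_iff right_minus_eq)
      then show ?thesis using lam_inner[OF x] \<mu>_eq by simp
    qed
  qed (fact Pw eqn lam_inner)+
qed

section \<open>The shifted form as an operator on Fourier coordinates\<close>

lemma cinner_diff_left: "cinner (x - y) z = cinner x z - cinner y z"
  using cinner_add_left[of "x - y" y z] by simp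

lemma cinner_uminus_left: "cinner (- x) z = - cinner x z"
  unfolding uminus_ell2_def by (simp add: cinner_cscale_left)

lemma cinner_scaleR_left: "cinner (r *\<^sub>R x) z = of_real r * cinner x z"
  unfolding scaleR_ell2_def by (rule cinner_cscale_left)

lemma cinner_zero_left [simp]: "cinner 0 z = 0" and cinner_zero_right [simp]: "cinner z 0 = 0"
  by (simp_all add: cinner_def)

lemma cinner_sum_left: "cinner (sum f S) z = (\<Sum>a\<in>S. cinner (f a) z)"
  by (induction S rule: infinite_finite_induct) (auto simp: cinner_add_left)

lemma inner_Re_cinner: "inner x y = Re (cinner x y)"
  by (simp add: inner_ell2_def)

text \<open>Moving a Fourier multiplier across the inner product conjugates its symbol.\<close>

lemma cinner_multiplier:
  assumes "\<And>i. coord x' i = m i * coord x i" "\<And>i. coord y' i = cnj (m i) * coord y i"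
  shows "cinner x' y = cinner x y'"
  unfolding cinner_def assms by (simp add: mult_ac)

text \<open>Multiplication by a bounded function; \<open>fourier_real_mult\<close> shows that the chosen representative does
not matter.\<close>

definition mult_op :: "(real^'d \<Rightarrow> real) \<Rightarrow> (int^'d) ell2 \<Rightarrow>\<^sub>L (int^'d) ell2" where
  "mult_op a = Blinfun (\<lambda>x. fourier (\<lambda>y. of_real (a y) * realize x y))"

lemma L2_space_real_mult:
  assumes a: "a \<in> borel_measurable lebesgue" "AE y in lebesgue. \<bar>a y\<bar> \<le> C" and w: "w \<in> L2_space torus"
  shows "(\<lambda>y. of_real (a y) * w y) \<in> L2_space torus"
    "L2_sq torus (\<lambda>y. of_real (a y) * w y) \<le> C\<^sup>2 * L2_sq torus w"
proof -
  have "(\<lambda>y. complex_of_real (a y)) \<in> borel_measurable torus"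
    using measurable_torus[OF a(1)] by measurable
  moreover have "AE y in torus. cmod (of_real (a y)) \<le> C"
    unfolding AE_torus_iff using a(2) by (auto elim: eventually_mono)
  ultimately show "(\<lambda>y. of_real (a y) * w y) \<in> L2_space torus"
    "L2_sq torus (\<lambda>y. of_real (a y) * w y) \<le> C\<^sup>2 * L2_sq torus w"
    by (rule L2_space_bounded_mult[OF w])+
qed

lemma fourier_real_mult:
  assumes a: "a \<in> borel_measurable lebesgue" "AE y in lebesgue. \<bar>a y\<bar> \<le> C" and w: "w \<in> L2_space torus"
  shows "fourier (\<lambda>y. of_real (a y) * w y) = mult_op a (fourier w)"
proof -
  let ?T = "\<lambda>x. fourier (\<lambda>y. of_real (a y) * realize x y)"
  note am = L2_space_real_mult[OF a]
  have eq: "fourier (\<lambda>y. of_real (a y) * v y) = ?T (fourier v)" if v: "v \<in> L2_space torus" for v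
  proof -
    have "AE y in torus. v y = realize (fourier v) y"
      using torus.coeffs_eq_iff[OF v realize_L2_space, of "fourier v"] by simp
    then have "AE y in torus. of_real (a y) * v y = of_real (a y) * realize (fourier v) y"
      by eventually_elim simp
    then show ?thesis
      using torus.coeffs_eq_iff[OF am(1)[OF v] am(1)[OF realize_L2_space]] by simp
  qed
  have bl: "bounded_linear ?T"
  proof (rule bounded_linear_intro)
    fix x z
    have "?T (x + z) = fourier (\<lambda>y. of_real (a y) * (realize x y + realize z y))"
      by (subst eq) (auto intro!: L2_space_add realize_L2_space simp: torus.coeffs_add realize_L2_space)
    also have "\<dots> = ?T x + ?T z"
      by (simp add: ring_distribs torus.coeffs_add am(1) realize_L2_space)
    finally show "?T (x + z) = ?T x + ?T z" .
  next
    fix r x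
    have "?T (r *\<^sub>R x) = fourier (\<lambda>y. of_real (a y) * (of_real r * realize x y))"
      by (subst eq) (auto intro!: L2_space_cmult realize_L2_space simp: torus.coeffs_cmult realize_L2_space scaleR_ell2_def)
    also have "\<dots> = fourier (\<lambda>y. of_real r * (of_real (a y) * realize x y))" by (simp only: mult.left_commute)
    also have "\<dots> = r *\<^sub>R ?T x"
      by (simp only: torus.coeffs_cmult[OF am(1)[OF realize_L2_space]] scaleR_ell2_def)
    finally show "?T (r *\<^sub>R x) = r *\<^sub>R ?T x" .
  next
    fix x
    have "(norm (?T x))\<^sup>2 \<le> C\<^sup>2 * (norm x)\<^sup>2"
      using am(2)[OF realize_L2_space, of x] torus.parseval_norm[OF am(1)[OF realize_L2_space, of x]]
        torus.parseval_norm[OF realize_L2_space, of x] by simp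
    also have "\<dots> = (norm x * \<bar>C\<bar>)\<^sup>2" by (simp add: power_mult_distrib)
    finally show "norm (?T x) \<le> norm x * \<bar>C\<bar>" by (rule power2_le_imp_le) simp
  qed
  show ?thesis
    unfolding mult_op_def bounded_linear_Blinfun_apply[OF bl] by (rule eq[OF w])
qed

definition i_smoothing_op :: "(int^'d) ell2 \<Rightarrow>\<^sub>L (int^'d) ell2" where
  "i_smoothing_op = diag (\<lambda>k. \<i> * of_real (1 / weight k))"

definition i_partial_op :: "'d \<Rightarrow> (int^'d) ell2 \<Rightarrow>\<^sub>L (int^'d) ell2" where
  "i_partial_op j = diag (\<lambda>k. \<i> * (\<i> * of_real (of_int (k $ j) / weight k)))"

lemma coord_i_smoothing: "coord (i_smoothing_op x) k = \<i> * of_real (1 / weight k) * coord x k"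
  unfolding i_smoothing_op_def
  by (rule coord_diag[of _ 1]) (use smoothing_symbol_le in \<open>simp only: norm_mult norm_ii mult_1\<close>)

lemma coord_i_partial: "coord (i_partial_op j x) k = \<i> * (\<i> * of_real (of_int (k $ j) / weight k)) * coord x k"
  unfolding i_partial_op_def
proof (rule coord_diag[of _ 1])
  show "cmod (\<i> * (\<i> * of_real (of_int (k $ j) / weight k))) \<le> 1" for k
    using partial_symbol_le[of k j] by (simp only: norm_mult norm_ii mult_1)
qed

text \<open>These operators are written as polynomials in \<open>\<eta>\<close> with constant coefficients, the form required for
analyticity.  The resulting symbols are \<open>\<i> (k + \<eta>) / weight k\<close> and \<open>- |k + \<eta>|\<^sup>2 / weight k\<close>, see
\<open>coord_shifted_grad\<close> and \<open>coord_shifted_laplacian\<close>.\<close>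

definition shifted_grad_op :: "real^'d \<Rightarrow> 'd \<Rightarrow> (int^'d) ell2 \<Rightarrow>\<^sub>L (int^'d) ell2" where
  "shifted_grad_op \<eta> j = partial_op j + (\<eta> $ j) *\<^sub>R i_smoothing_op"

definition shifted_laplacian_op :: "real^'d \<Rightarrow> (int^'d) ell2 \<Rightarrow>\<^sub>L (int^'d) ell2" where
  "shifted_laplacian_op \<eta> = (\<Sum>j\<in>UNIV. second_partial_op j j + ((\<eta> $ j) *\<^sub>R (2 *\<^sub>R i_partial_op j) + (\<eta> $ j) *\<^sub>R ((- (\<eta> $ j)) *\<^sub>R smoothing_op)))"

lemma coord_shifted_grad: "coord (shifted_grad_op \<eta> j x) k = \<i> * of_real ((of_int (k $ j) + \<eta> $ j) / weight k) * coord x k"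
  by (simp add: shifted_grad_op_def blinfun.add_left blinfun.scaleR_left coord_partial coord_i_smoothing algebra_simps add_divide_distrib)

lemma coord_shifted_laplacian:
  "coord (shifted_laplacian_op \<eta> x) k = of_real (- (\<Sum>j\<in>UNIV. (of_int (k $ j) + \<eta> $ j)\<^sup>2) / weight k) * coord x k"
proof -
  have "coord ((second_partial_op j j + ((\<eta> $ j) *\<^sub>R (2 *\<^sub>R i_partial_op j) + (\<eta> $ j) *\<^sub>R ((- (\<eta> $ j)) *\<^sub>R smoothing_op))) x) k
      = of_real (- ((of_int (k $ j) + \<eta> $ j)\<^sup>2) / weight k) * coord x k" for j
  proof -
    have ii: "\<i> * (\<i> * z) = - z" for z by (simp flip: mult.assoc)
    show ?thesis
      unfolding blinfun.add_left blinfun.scaleR_left coord_add coord_scaleR coord_second_partial coord_i_partial coord_smoothing ii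
      by (simp add: power2_eq_square field_simps weight_nz)
  qed
  then show ?thesis
    by (simp add: shifted_laplacian_op_def blinfun.sum_left sum_distrib_right sum_divide_distrib sum_negf)
qed

lemma fourier_shifted_grad:
  fixes u :: "real^'d \<Rightarrow> complex"
  assumes u: "u \<in> L2_space torus" "fourier u = smoothing_op x"
  shows "shifted_grad \<eta> j u \<in> L2_space torus" "fourier (shifted_grad \<eta> j u) = shifted_grad_op \<eta> j x"
proof -
  note w = weak_partials(1,2)[OF u]
  have 1: "(\<lambda>y. \<i> * of_real (\<eta> $ j) * u y) \<in> L2_space torus" by (rule L2_space_cmult[OF u(1)])
  show "shifted_grad \<eta> j u \<in> L2_space torus"
    unfolding shifted_grad_def[abs_def] by (intro L2_space_add L2_per_imp_L2_space w 1)
  have "fourier (shifted_grad \<eta> j u) = partial_op j x + cscale (\<i> * of_real (\<eta> $ j)) (smoothing_op x)"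
    unfolding shifted_grad_def[abs_def]
    by (simp only: torus.coeffs_add[OF L2_per_imp_L2_space[OF w(1)] 1] w(2) torus.coeffs_cmult[OF u(1)] u(2))
  also have "\<dots> = shifted_grad_op \<eta> j x"
    by (rule ell2_eqI) (simp add: shifted_grad_op_def blinfun.add_left blinfun.scaleR_left coord_i_smoothing coord_smoothing)
  finally show "fourier (shifted_grad \<eta> j u) = shifted_grad_op \<eta> j x" .
qed

lemma fourier_shifted_laplacian:
  fixes u :: "real^'d \<Rightarrow> complex"
  assumes u: "u \<in> L2_space torus" "fourier u = smoothing_op x"
  shows "shifted_laplacian \<eta> u \<in> L2_space torus" "fourier (shifted_laplacian \<eta> u) = shifted_laplacian_op \<eta> x"
proof -
  note w = weak_partials[OF u]
  note wL = L2_per_imp_L2_space[OF w(1)] L2_per_imp_L2_space[OF w(3)]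
  let ?a = "\<lambda>y. \<Sum>j\<in>UNIV. weak_partial j (weak_partial j u) y"
  let ?s = "\<lambda>y. \<Sum>j\<in>UNIV. of_real (\<eta> $ j) * weak_partial j u y"
  let ?b = "\<lambda>y. 2 * \<i> * ?s y"
  let ?c = "\<lambda>y. of_real ((norm \<eta>)\<^sup>2) * u y"
  have m: "?a \<in> L2_space torus" "?s \<in> L2_space torus" "?b \<in> L2_space torus" "?c \<in> L2_space torus"
    by (intro L2_space_sum L2_space_cmult wL u)+
  have ab: "(\<lambda>y. ?a y + ?b y) \<in> L2_space torus" by (rule L2_space_add[OF m(1,3)])
  have eq: "shifted_laplacian \<eta> u = (\<lambda>y. (?a y + ?b y) - ?c y)"
    unfolding shifted_laplacian_def[abs_def] ..
  show "shifted_laplacian \<eta> u \<in> L2_space torus"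
    unfolding eq by (rule L2_space_diff[OF ab m(4)])
  have fa: "fourier ?a = (\<Sum>j\<in>UNIV. second_partial_op j j x)"
    by (simp add: torus.coeffs_sum wL w)
  have fs: "fourier ?s = (\<Sum>j\<in>UNIV. cscale (of_real (\<eta> $ j)) (partial_op j x))"
    by (simp add: torus.coeffs_sum L2_space_cmult wL w torus.coeffs_cmult)
  have "fourier (shifted_laplacian \<eta> u)
      = (fourier ?a + cscale (2 * \<i>) (fourier ?s)) - cscale (of_real ((norm \<eta>)\<^sup>2)) (fourier u)"
    unfolding eq by (simp only: torus.coeffs_diff[OF ab m(4)] torus.coeffs_add[OF m(1,3)]
        torus.coeffs_cmult[OF m(2)] torus.coeffs_cmult[OF u(1)])
  also have "\<dots> = shifted_laplacian_op \<eta> x"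
  proof (rule ell2_eqI)
    fix k
    have n: "(norm \<eta>)\<^sup>2 = (\<Sum>j\<in>UNIV. (\<eta> $ j)\<^sup>2)"
      unfolding power2_norm_eq_inner inner_vec_def by (simp add: power2_eq_square)
    have "coord ((fourier ?a + cscale (2 * \<i>) (fourier ?s)) - cscale (of_real ((norm \<eta>)\<^sup>2)) (fourier u)) k
        = (\<Sum>j\<in>UNIV. of_real (- (of_int (k $ j) * of_int (k $ j)) / weight k) * coord x k)
          + 2 * \<i> * (\<Sum>j\<in>UNIV. of_real (\<eta> $ j) * (\<i> * of_real (of_int (k $ j) / weight k) * coord x k))
          - of_real (\<Sum>j\<in>UNIV. (\<eta> $ j)\<^sup>2) * (of_real (1 / weight k) * coord x k)"
      unfolding fa fs u(2) n by (simp only: coord_diff coord_add coord_sum coord_cscale coord_second_partial coord_partial coord_smoothing)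
    also have "\<dots> = (\<Sum>j\<in>UNIV. of_real (- (of_int (k $ j) * of_int (k $ j)) / weight k) * coord x k
          + 2 * \<i> * (of_real (\<eta> $ j) * (\<i> * of_real (of_int (k $ j) / weight k) * coord x k))
          - of_real ((\<eta> $ j)\<^sup>2) * (of_real (1 / weight k) * coord x k))"
      by (simp only: sum.distrib sum_subtractf sum_distrib_left sum_distrib_right of_real_sum)
    also have "\<dots> = (\<Sum>j\<in>UNIV. of_real (- ((of_int (k $ j) + \<eta> $ j)\<^sup>2) / weight k) * coord x k)"
    proof (rule sum.cong[OF refl])
      fix j
      have ii: "2 * \<i> * (r * (\<i> * s * z)) = - (2 * r * s * z)" for r s z
      proof -
        have "2 * \<i> * (r * (\<i> * s * z)) = (\<i> * \<i>) * (2 * r * s * z)" by (simp only: mult_ac)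
        then show ?thesis by simp
      qed
      show "of_real (- (of_int (k $ j) * of_int (k $ j)) / weight k) * coord x k
          + 2 * \<i> * (of_real (\<eta> $ j) * (\<i> * of_real (of_int (k $ j) / weight k) * coord x k))
          - of_real ((\<eta> $ j)\<^sup>2) * (of_real (1 / weight k) * coord x k)
          = of_real (- ((of_int (k $ j) + \<eta> $ j)\<^sup>2) / weight k) * coord x k"
        unfolding ii by (simp add: power2_eq_square field_simps weight_nz)
    qed
    also have "\<dots> = coord (shifted_laplacian_op \<eta> x) k"
      by (simp add: coord_shifted_laplacian sum_distrib_right sum_divide_distrib sum_negf)
    finally show "coord ((fourier ?a + cscale (2 * \<i>) (fourier ?s)) - cscale (of_real ((norm \<eta>)\<^sup>2)) (fourier u)) k
        = coord (shifted_laplacian_op \<eta> x) k" .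
  qed
  finally show "fourier (shifted_laplacian \<eta> u) = shifted_laplacian_op \<eta> x" .
qed

lemma cinner_shifted_grad_adjoint: "cinner z (shifted_grad_op \<eta> i y) = - cinner (shifted_grad_op \<eta> i z) y"
proof -
  have "cinner (- shifted_grad_op \<eta> i z) y = cinner z (shifted_grad_op \<eta> i y)"
    by (rule cinner_multiplier[where m = "\<lambda>k. - (\<i> * of_real ((of_int (k $ i) + \<eta> $ i) / weight k))"])
      (simp_all add: coord_shifted_grad)
  then show ?thesis by (simp add: cinner_uminus_left)
qed

lemma cinner_shifted_laplacian_adjoint: "cinner z (shifted_laplacian_op \<eta> y) = cinner (shifted_laplacian_op \<eta> z) y"
  by (rule cinner_multiplier[symmetric, OF coord_shifted_laplacian]) (simp add: coord_shifted_laplacian)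

lemma real_symmetric_hermitian:
  fixes a :: "real^'d^'d" and w :: "'d \<Rightarrow> complex"
  defines "S \<equiv> \<Sum>i\<in>UNIV. (\<Sum>j\<in>UNIV. of_real (a $ i $ j) * w j) * cnj (w i)"
  assumes sym: "transpose a = a" and pos: "\<And>\<xi>. (a *v \<xi>) \<bullet> \<xi> \<ge> 0"
  shows "Im S = 0" "Re S \<ge> 0"
proof -
  have s: "a $ i $ j = a $ j $ i" for i j
    using arg_cong[OF sym, of "\<lambda>b. b $ j $ i"] by (simp add: transpose_def)
  have "Im S = (\<Sum>i\<in>UNIV. \<Sum>j\<in>UNIV. a $ i $ j * (Im (w j) * Re (w i)) - a $ i $ j * (Re (w j) * Im (w i)))"
    unfolding S_def Im_sum sum_distrib_right by (intro sum.cong refl) (simp add: algebra_simps)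
  also have "\<dots> = (\<Sum>i\<in>UNIV. \<Sum>j\<in>UNIV. a $ i $ j * (Im (w j) * Re (w i))) - (\<Sum>i\<in>UNIV. \<Sum>j\<in>UNIV. a $ i $ j * (Re (w j) * Im (w i)))"
    by (simp add: sum_subtractf)
  also have "(\<Sum>i\<in>UNIV. \<Sum>j\<in>UNIV. a $ i $ j * (Re (w j) * Im (w i))) = (\<Sum>i\<in>UNIV. \<Sum>j\<in>UNIV. a $ i $ j * (Im (w j) * Re (w i)))"
    by (subst sum.swap) (simp add: s[of _ _] mult_ac)
  finally show "Im S = 0" by simp
  have "Re S = (a *v (\<chi> i. Re (w i))) \<bullet> (\<chi> i. Re (w i)) + (a *v (\<chi> i. Im (w i))) \<bullet> (\<chi> i. Im (w i))"
  proof -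
    have "Re S = (\<Sum>i\<in>UNIV. \<Sum>j\<in>UNIV. a $ i $ j * Re (w j) * Re (w i) + a $ i $ j * Im (w j) * Im (w i))"
      unfolding S_def Re_sum sum_distrib_right by (intro sum.cong refl) (simp add: algebra_simps)
    then show ?thesis by (simp add: inner_vec_def matrix_vector_mult_def sum_distrib_right sum.distrib)
  qed
  then show "Re S \<ge> 0" using pos by simp
qed

locale coefficient_matrix =
  fixes A :: "real^'d \<Rightarrow> real^'d^'d"
  assumes meas: "\<And>i j. (\<lambda>y. A y $ i $ j) \<in> borel_measurable lebesgue"
    and bounded_entries: "\<exists>M. AE y in lebesgue. \<forall>i j. \<bar>A y $ i $ j\<bar> \<le> M"
    and symmetric: "AE y in lebesgue. transpose (A y) = A y"
    and nonneg: "AE y in lebesgue. \<forall>\<xi>. (A y *v \<xi>) \<bullet> \<xi> \<ge> 0"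
begin

definition entry_op :: "'d \<Rightarrow> 'd \<Rightarrow> (int^'d) ell2 \<Rightarrow>\<^sub>L (int^'d) ell2" where
  "entry_op i j = mult_op (\<lambda>y. A y $ i $ j)"

lemma entry_mult:
  assumes w: "w \<in> L2_space torus"
  shows "(\<lambda>y. of_real (A y $ i $ j) * w y) \<in> L2_space torus"
    "fourier (\<lambda>y. of_real (A y $ i $ j) * w y) = entry_op i j (fourier w)"
proof -
  obtain M where "AE y in lebesgue. \<forall>i j. \<bar>A y $ i $ j\<bar> \<le> M" using bounded_entries by blast
  then have M: "AE y in lebesgue. \<bar>A y $ i $ j\<bar> \<le> M" by (rule eventually_mono) blast
  show "(\<lambda>y. of_real (A y $ i $ j) * w y) \<in> L2_space torus"
    by (rule L2_space_real_mult(1)[OF meas M w])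
  show "fourier (\<lambda>y. of_real (A y $ i $ j) * w y) = entry_op i j (fourier w)"
    unfolding entry_op_def by (rule fourier_real_mult[OF meas M w])
qed

lemma entry_op_cscale: "entry_op i j (cscale c x) = cscale c (entry_op i j x)"
proof -
  have "entry_op i j (cscale c x) = fourier (\<lambda>y. of_real (A y $ i $ j) * (c * realize x y))"
    using entry_mult(2)[OF L2_space_cmult[OF realize_L2_space, of c x], of i j]
    by (simp add: torus.coeffs_cmult realize_L2_space)
  also have "\<dots> = fourier (\<lambda>y. c * (of_real (A y $ i $ j) * realize x y))" by (simp only: mult.left_commute)
  also have "\<dots> = cscale c (entry_op i j x)"
    using torus.coeffs_cmult[OF entry_mult(1)[OF realize_L2_space]] entry_mult(2)[OF realize_L2_space] by simp
  finally show ?thesis .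
qed

lemma matrix_form:
  fixes w v :: "'d \<Rightarrow> real^'d \<Rightarrow> complex"
  assumes w: "\<And>j. w j \<in> L2_space torus" and v: "\<And>j. v j \<in> L2_space torus"
  shows "integrable torus (\<lambda>y. \<Sum>i\<in>UNIV. (\<Sum>j\<in>UNIV. of_real (A y $ i $ j) * w j y) * cnj (v i y))"
    "(LINT y|torus. (\<Sum>i\<in>UNIV. (\<Sum>j\<in>UNIV. of_real (A y $ i $ j) * w j y) * cnj (v i y)))
      = (\<Sum>i\<in>UNIV. \<Sum>j\<in>UNIV. cinner (entry_op i j (fourier (w j))) (fourier (v i)))"
proof -
  have Aw: "(\<lambda>y. \<Sum>j\<in>UNIV. of_real (A y $ i $ j) * w j y) \<in> L2_space torus" for i
    by (intro L2_space_sum entry_mult w)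
  note int = L2_ip_integrable[OF Aw v]
  show "integrable torus (\<lambda>y. \<Sum>i\<in>UNIV. (\<Sum>j\<in>UNIV. of_real (A y $ i $ j) * w j y) * cnj (v i y))"
    by (intro Bochner_Integration.integrable_sum int)
  have "(LINT y|torus. (\<Sum>i\<in>UNIV. (\<Sum>j\<in>UNIV. of_real (A y $ i $ j) * w j y) * cnj (v i y)))
      = (\<Sum>i\<in>UNIV. L2_ip torus (\<lambda>y. \<Sum>j\<in>UNIV. of_real (A y $ i $ j) * w j y) (v i))"
    unfolding L2_ip_def by (intro Bochner_Integration.integral_sum int)
  also have "\<dots> = (\<Sum>i\<in>UNIV. cinner (\<Sum>j\<in>UNIV. entry_op i j (fourier (w j))) (fourier (v i)))"
    by (simp add: torus.parseval[OF Aw v] torus.coeffs_sum entry_mult w)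
  finally show "(LINT y|torus. (\<Sum>i\<in>UNIV. (\<Sum>j\<in>UNIV. of_real (A y $ i $ j) * w j y) * cnj (v i y)))
      = (\<Sum>i\<in>UNIV. \<Sum>j\<in>UNIV. cinner (entry_op i j (fourier (w j))) (fourier (v i)))"
    by (simp add: cinner_sum_left)
qed

text \<open>The sign in the second-order part is due to the shifted gradient being skew-adjoint.\<close>

definition bloch_op :: "real \<Rightarrow> real^'d \<Rightarrow> (int^'d) ell2 \<Rightarrow>\<^sub>L (int^'d) ell2" where
  "bloch_op \<rho> \<eta> = \<rho>\<^sup>2 *\<^sub>R (shifted_laplacian_op \<eta> o\<^sub>L shifted_laplacian_op \<eta>)
     + (\<Sum>i\<in>UNIV. \<Sum>j\<in>UNIV. - (shifted_grad_op \<eta> i o\<^sub>L (entry_op i j o\<^sub>L shifted_grad_op \<eta> j)))"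

lemma cinner_bloch_op:
  "cinner (bloch_op \<rho> \<eta> x) y = (\<Sum>i\<in>UNIV. \<Sum>j\<in>UNIV. cinner (entry_op i j (shifted_grad_op \<eta> j x)) (shifted_grad_op \<eta> i y))
     + of_real (\<rho>\<^sup>2) * cinner (shifted_laplacian_op \<eta> x) (shifted_laplacian_op \<eta> y)"
  by (simp add: bloch_op_def blinfun.add_left blinfun.scaleR_left blinfun.sum_left blinfun.minus_left
      cinner_add_left cinner_scaleR_left cinner_sum_left cinner_uminus_left cinner_shifted_grad_adjoint cinner_shifted_laplacian_adjoint)

theorem bloch_form_eq:
  assumes u: "u \<in> L2_space torus" "fourier u = smoothing_op x" and v: "v \<in> L2_space torus" "fourier v = smoothing_op y"
  shows "bloch_form A \<rho> \<eta> u v = cinner (bloch_op \<rho> \<eta> x) y"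
proof -
  note gu = fourier_shifted_grad[OF u] and gv = fourier_shifted_grad[OF v]
  note lu = fourier_shifted_laplacian[OF u] and lv = fourier_shifted_laplacian[OF v]
  have "(LINT y|torus. shifted_laplacian \<eta> u y * cnj (shifted_laplacian \<eta> v y)) = cinner (shifted_laplacian_op \<eta> x) (shifted_laplacian_op \<eta> y)"
    using torus.parseval[OF lu(1) lv(1)] by (simp add: L2_ip_def lu(2) lv(2))
  then show ?thesis
    unfolding bloch_form_def set_integral_cell cinner_bloch_op matrix_form(2)[OF gu(1) gv(1)] gu(2) gv(2) by simp
qed

text \<open>Pointwise, the quadratic form of a real symmetric matrix at a complex vector is the sum of its
values at the real and imaginary parts, hence real and nonnegative.\<close>

lemma bloch_op_hermitian: "Im (cinner (bloch_op \<rho> \<eta> x) x) = 0"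
  and bloch_op_lower_bound: "Re (cinner (bloch_op \<rho> \<eta> x) x) \<ge> \<rho>\<^sup>2 * (norm (shifted_laplacian_op \<eta> x))\<^sup>2"
proof -
  let ?w = "\<lambda>j. realize (shifted_grad_op \<eta> j x)"
  let ?S = "\<lambda>y. \<Sum>i\<in>UNIV. (\<Sum>j\<in>UNIV. of_real (A y $ i $ j) * ?w j y) * cnj (?w i y)"
  note S = matrix_form[of ?w ?w, OF realize_L2_space realize_L2_space, unfolded fourier_realize]
  have "AE y in lebesgue. Im (?S y) = 0 \<and> Re (?S y) \<ge> 0"
    using symmetric nonneg
  proof eventually_elim
    case (elim y)
    then show ?case using real_symmetric_hermitian[of "A y" "\<lambda>j. ?w j y"] by blast
  qed
  then have "AE y in torus. Im (?S y) = 0" "AE y in torus. Re (?S y) \<ge> 0"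
    unfolding AE_torus_iff by (auto elim: eventually_mono)
  then have "(LINT y|torus. Im (?S y)) = 0" "(LINT y|torus. Re (?S y)) \<ge> 0"
    by (auto intro: integral_eq_zero_AE integral_nonneg_AE)
  then have ImRe: "Im (integral\<^sup>L torus ?S) = 0" "Re (integral\<^sup>L torus ?S) \<ge> 0"
    using integral_Im[OF S(1)] integral_Re[OF S(1)] by simp_all
  have L: "cinner (shifted_laplacian_op \<eta> x) (shifted_laplacian_op \<eta> x) = of_real ((norm (shifted_laplacian_op \<eta> x))\<^sup>2)"
    by (simp add: cinner_self norm_ell2_sq del: of_real_power)
  show "Im (cinner (bloch_op \<rho> \<eta> x) x) = 0" "Re (cinner (bloch_op \<rho> \<eta> x) x) \<ge> \<rho>\<^sup>2 * (norm (shifted_laplacian_op \<eta> x))\<^sup>2"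
    using ImRe unfolding cinner_bloch_op L S(2)[symmetric] by (simp_all del: of_real_power)
qed

lemma bloch_op_cscale: "bloch_op \<rho> \<eta> (cscale c x) = cscale c (bloch_op \<rho> \<eta> x)"
proof -
  have E: "shifted_grad_op \<eta> i (cscale c z) = cscale c (shifted_grad_op \<eta> i z)" for i z
    by (rule ell2_eqI) (simp add: coord_shifted_grad)
  have L: "shifted_laplacian_op \<eta> (cscale c z) = cscale c (shifted_laplacian_op \<eta> z)" for z
    by (rule ell2_eqI) (simp add: coord_shifted_laplacian)
  show ?thesis
    by (rule ell2_eqI) (simp add: bloch_op_def blinfun.add_left blinfun.scaleR_left blinfun.sum_left
        blinfun.minus_left E L entry_op_cscale ring_distribs sum_distrib_left mult_ac)
qed

lemma small_increment_bloch_op: "small_increment (bloch_op \<rho>)"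
proof -
  have E: "small_increment (\<lambda>\<eta>. shifted_grad_op \<eta> j)" for j
    unfolding shifted_grad_op_def by (intro small_increment_add small_increment_scaleR small_increment_const small_increment_coordinate)
  have L: "small_increment shifted_laplacian_op"
    unfolding shifted_laplacian_op_def[abs_def]
    by (intro small_increment_sum small_increment_add small_increment_scaleR small_increment_const small_increment_coordinate small_increment_uminus)
  show ?thesis
    unfolding bloch_op_def[abs_def]
    by (intro small_increment_add small_increment_sum small_increment_uminus small_increment_compose small_increment_scaleR small_increment_const E L)
qed

end

section \<open>The first Bloch eigenvalue\<close>

definition mean_free_proj :: "(int^'d) ell2 \<Rightarrow>\<^sub>L (int^'d) ell2" where
  "mean_free_proj = diag (\<lambda>k. if k = 0 then 0 else 1)"

definition constant_mode :: "(int^'d) ell2" where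
  "constant_mode = fourier (fourier_basis 0)"

lemma coord_mean_free: "coord (mean_free_proj x) k = (if k = 0 then 0 else coord x k)"
  unfolding mean_free_proj_def by (subst coord_diag[of _ 1]) auto

lemma norm_mean_free_le: "norm (mean_free_proj x) \<le> norm x"
  unfolding mean_free_proj_def by (intro norm_diag_apply_le norm_diag_le) auto

lemma coord_constant_mode: "coord constant_mode k = (if k = 0 then 1 else 0)"
  unfolding constant_mode_def by (auto simp: torus.coord_coeffs torus.e_L2 torus.orthonormal)

lemma cinner_constant_mode: "cinner z constant_mode = coord z 0"
  using torus.parseval[OF realize_L2_space torus.e_L2, of z 0]
    torus.coord_coeffs[OF realize_L2_space, of z 0] by (simp add: constant_mode_def)

lemma mean_free_decomposition: "cscale (coord x 0) constant_mode + mean_free_proj x = x"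
  by (rule ell2_eqI) (simp add: coord_mean_free coord_constant_mode)

lemma cinner_mean_free_adjoint: "cinner (mean_free_proj x) y = cinner x (mean_free_proj y)"
  by (rule cinner_multiplier[where m = "\<lambda>k. if k = 0 then 0 else 1"]) (auto simp: coord_mean_free)

lemma cinner_smoothing_adjoint: "cinner (smoothing_op x) y = cinner x (smoothing_op y)"
  by (rule cinner_multiplier[OF coord_smoothing]) (simp add: coord_smoothing)

lemma norm_smoothing_twice_le: "norm ((smoothing_op o\<^sub>L smoothing_op) x) \<le> norm x"
  using order_trans[OF norm_smoothing_le norm_smoothing_le] by simp

lemma smoothing_constant_mode: "smoothing_op (smoothing_op constant_mode) = constant_mode"
  by (rule ell2_eqI) (simp add: coord_smoothing coord_constant_mode weight_def)

text \<open>This is the identity \<open>\<parallel>\<Delta> u\<parallel> = \<parallel>x\<parallel>\<close> behind the spectral gap.\<close>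

lemma shifted_laplacian_mean_free:
  assumes "mean_free_proj x = x" shows "shifted_laplacian_op 0 x = - x"
proof (rule ell2_eqI)
  fix k
  have "coord x 0 = 0" using arg_cong[OF assms, of "\<lambda>z. coord z 0"] by (simp add: coord_mean_free)
  then show "coord (shifted_laplacian_op 0 x) k = coord (- x) k"
    using weight_nz[of k] by (cases "k = 0") (simp_all add: coord_shifted_laplacian weight_def freq_sq_def)
qed

lemma shifted_grad_constant_mode: "shifted_grad_op 0 j constant_mode = 0"
  by (rule ell2_eqI) (simp add: coord_shifted_grad coord_constant_mode)

lemma shifted_laplacian_constant_mode: "shifted_laplacian_op 0 constant_mode = 0"
  by (rule ell2_eqI) (simp add: coord_shifted_laplacian coord_constant_mode)

lemma fourier_zero_iff: "u \<in> L2_per \<Longrightarrow> (AE y in lebesgue. u y = 0) \<longleftrightarrow> fourier u = 0"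
  for u :: "real^'d \<Rightarrow> complex"
proof -
  assume u: "u \<in> L2_per"
  have f0: "fourier (\<lambda>y::real^'d. 0) = 0"
    by (rule ell2_eqI) (simp add: torus.coord_coeffs L2_ip_def)
  have "(AE y in lebesgue. u y = 0) \<longleftrightarrow> (AE y in torus. u y = 0)"
  proof
    show "AE y in lebesgue. u y = 0 \<Longrightarrow> AE y in torus. u y = 0"
      unfolding AE_torus_iff by (auto elim: eventually_mono)
  qed (use periodic_AE_torus_zero[of u] u in \<open>simp add: L2_per_def\<close>)
  then show ?thesis
    using torus.coeffs_eq_iff[OF L2_per_imp_L2_space[OF u] L2_space_zero] f0 by simp
qed

lemma smoothing_op_eq_0_iff: "smoothing_op x = 0 \<longleftrightarrow> x = 0"
proof
  assume "smoothing_op x = 0"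
  then have "coord (smoothing_op x) k = 0" for k by simp
  then show "x = 0" by (intro ell2_eqI) (simp add: coord_smoothing weight_nz)
qed simp

context coefficient_matrix
begin

lemma bloch_op_constant_mode: "bloch_op \<rho> 0 constant_mode = 0"
  by (simp add: bloch_op_def blinfun.add_left blinfun.scaleR_left blinfun.sum_left blinfun.minus_left
      shifted_grad_constant_mode shifted_laplacian_constant_mode)

lemma bloch_op_orthogonal_constant_mode: "inner (bloch_op \<rho> 0 x) constant_mode = 0"
  by (simp add: inner_Re_cinner cinner_bloch_op shifted_grad_constant_mode shifted_laplacian_constant_mode)

lemma bloch_op_coercive: "mean_free_proj x = x \<Longrightarrow> inner (bloch_op \<rho> 0 x) x \<ge> \<rho>\<^sup>2 * (norm x)\<^sup>2"
  using bloch_op_lower_bound[of \<rho> 0 x] by (simp add: inner_Re_cinner shifted_laplacian_mean_free)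

text \<open>Since every \<open>y\<close> describes a test function, the weak eigenvalue equation is an identity between
vectors.\<close>

lemma bloch_operator_iff:
  assumes u: "u \<in> L2_per" "fourier u = smoothing_op x"
  shows "bloch_operator A \<rho> \<eta> u (\<lambda>y. of_real \<mu> * u y) \<longleftrightarrow> bloch_op \<rho> \<eta> x = \<mu> *\<^sub>R smoothing_op (smoothing_op x)"
proof -
  note uL = L2_per_imp_L2_space[OF u(1)]
  have inner: "L2_inner (\<lambda>y. of_real \<mu> * u y) v = cinner (\<mu> *\<^sub>R smoothing_op (smoothing_op x)) y"
    if v: "v \<in> L2_space torus" "fourier v = smoothing_op y" for v y
    using torus.parseval[OF L2_space_cmult[OF uL, of "of_real \<mu>"] v(1)]
    by (simp add: L2_inner_def set_integral_cell L2_ip_def torus.coeffs_cmult uL u(2) v(2)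
        cinner_cscale_left cinner_scaleR_left cinner_smoothing_adjoint)
  have usob: "u \<in> sobolev 2" using u sobolev_2_iff by blast
  show ?thesis
  proof
    assume op: "bloch_operator A \<rho> \<eta> u (\<lambda>y. of_real \<mu> * u y)"
    define z where "z = bloch_op \<rho> \<eta> x - \<mu> *\<^sub>R smoothing_op (smoothing_op x)"
    have "realize (smoothing_op z) \<in> sobolev 2"
      using sobolev_2_iff realize_L2_per fourier_realize by blast
    then have "bloch_form A \<rho> \<eta> u (realize (smoothing_op z)) = L2_inner (\<lambda>y. of_real \<mu> * u y) (realize (smoothing_op z))"
      using op by (simp add: bloch_operator_def)
    then have "cinner (bloch_op \<rho> \<eta> x) z = cinner (\<mu> *\<^sub>R smoothing_op (smoothing_op x)) z"
      by (simp add: bloch_form_eq[OF uL u(2) realize_L2_space fourier_realize]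
          inner[OF realize_L2_space fourier_realize])
    then have "cinner z z = 0" by (simp add: z_def cinner_diff_left)
    then have "inner z z = 0" by (simp add: inner_Re_cinner)
    then show "bloch_op \<rho> \<eta> x = \<mu> *\<^sub>R smoothing_op (smoothing_op x)" by (simp add: z_def)
  next
    assume eq: "bloch_op \<rho> \<eta> x = \<mu> *\<^sub>R smoothing_op (smoothing_op x)"
    have "bloch_form A \<rho> \<eta> u v = L2_inner (\<lambda>y. of_real \<mu> * u y) v" if v: "v \<in> sobolev 2" for v
    proof -
      obtain y where y: "v \<in> L2_per" "fourier v = smoothing_op y" using v sobolev_2_iff by blast
      note vL = L2_per_imp_L2_space[OF y(1)]
      show ?thesis by (simp only: bloch_form_eq[OF uL u(2) vL y(2)] inner[OF vL y(2)] eq)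
    qed
    then show "bloch_operator A \<rho> \<eta> u (\<lambda>y. of_real \<mu> * u y)"
      unfolding bloch_operator_def using usob L2_per_cmult[OF u(1)] by blast
  qed
qed

lemma bloch_eigenfunction_iff:
  "bloch_eigenfunction A \<rho> \<eta> \<mu> u \<longleftrightarrow>
    u \<in> L2_per \<and> (\<exists>x. fourier u = smoothing_op x \<and> x \<noteq> 0 \<and> bloch_op \<rho> \<eta> x = \<mu> *\<^sub>R smoothing_op (smoothing_op x))"
proof
  assume ef: "bloch_eigenfunction A \<rho> \<eta> \<mu> u"
  then have "u \<in> sobolev 2" by (simp add: bloch_eigenfunction_def bloch_operator_def)
  then obtain x where x: "u \<in> L2_per" "fourier u = smoothing_op x" using sobolev_2_iff by blast
  have "x \<noteq> 0"
    using ef fourier_zero_iff[OF x(1)] x(2) unfolding bloch_eigenfunction_def by auto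
  then show "u \<in> L2_per \<and> (\<exists>x. fourier u = smoothing_op x \<and> x \<noteq> 0 \<and> bloch_op \<rho> \<eta> x = \<mu> *\<^sub>R smoothing_op (smoothing_op x))"
    using ef bloch_operator_iff[OF x] x unfolding bloch_eigenfunction_def by auto
next
  assume "u \<in> L2_per \<and> (\<exists>x. fourier u = smoothing_op x \<and> x \<noteq> 0 \<and> bloch_op \<rho> \<eta> x = \<mu> *\<^sub>R smoothing_op (smoothing_op x))"
  then obtain x where x: "u \<in> L2_per" "fourier u = smoothing_op x" "x \<noteq> 0" "bloch_op \<rho> \<eta> x = \<mu> *\<^sub>R smoothing_op (smoothing_op x)"
    by blast
  then show "bloch_eigenfunction A \<rho> \<eta> \<mu> u"
    unfolding bloch_eigenfunction_def bloch_operator_iff[OF x(1,2)] fourier_zero_iff[OF x(1)]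
    by (simp add: smoothing_op_eq_0_iff)
qed

lemma eigenvalue_nonneg:
  assumes "x \<noteq> 0" "bloch_op \<rho> \<eta> x = \<mu> *\<^sub>R smoothing_op (smoothing_op x)" shows "\<mu> \<ge> 0"
proof -
  have "cinner (bloch_op \<rho> \<eta> x) x = of_real (\<mu> * (norm (smoothing_op x))\<^sup>2)"
    unfolding assms(2) cinner_scaleR_left cinner_smoothing_adjoint[of "smoothing_op x" x]
    by (simp add: cinner_self norm_ell2_sq)
  then have "0 \<le> \<mu> * (norm (smoothing_op x))\<^sup>2"
    using bloch_op_lower_bound[of \<rho> \<eta> x] order_trans[of 0 "\<rho>\<^sup>2 * (norm (shifted_laplacian_op \<eta> x))\<^sup>2"] by simp
  moreover have "(norm (smoothing_op x))\<^sup>2 > 0" using assms(1) by (simp add: smoothing_op_eq_0_iff)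
  ultimately show ?thesis by (simp add: zero_le_mult_iff)
qed

text \<open>The two conditions only fix the mean-free part and the real part of the zeroth coefficient.  The
imaginary part of that coefficient vanishes because the form is real on the diagonal.\<close>

lemma eigen_equation_from_projection:
  assumes w: "mean_free_proj w = w" and eq: "mean_free_proj (bloch_op \<rho> \<eta> (constant_mode + w)) = \<mu> *\<^sub>R mean_free_proj (smoothing_op (smoothing_op w))"
    and \<mu>: "\<mu> = inner (bloch_op \<rho> \<eta> (constant_mode + w)) constant_mode"
  shows "bloch_op \<rho> \<eta> (constant_mode + w) = \<mu> *\<^sub>R smoothing_op (smoothing_op (constant_mode + w))"
proof -
  define z where "z = bloch_op \<rho> \<eta> (constant_mode + w)"
  have Re0: "Re (coord z 0) = \<mu>"
    by (simp add: \<mu> inner_Re_cinner cinner_constant_mode z_def)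
  have add_right: "cinner a (b + c) = cinner a b + cinner a c" for a b c :: "(int^'d) ell2"
  proof -
    have "cinner a (b + c) = cnj (cinner (b + c) a)" by (rule cinner_commute)
    also have "\<dots> = cnj (cinner b a) + cnj (cinner c a)" by (simp only: cinner_add_left complex_cnj_add)
    finally show ?thesis by (simp only: cinner_commute[symmetric])
  qed
  have "cinner z (constant_mode + w) = coord z 0 + cinner z (mean_free_proj w)"
    by (simp add: add_right cinner_constant_mode w)
  also have "cinner z (mean_free_proj w) = of_real \<mu> * cinner (smoothing_op (smoothing_op w)) (mean_free_proj w)"
    unfolding cinner_mean_free_adjoint[symmetric] z_def eq cinner_scaleR_left by (simp add: cinner_mean_free_adjoint)
  also have "\<dots> = of_real (\<mu> * (norm (smoothing_op w))\<^sup>2)"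
    unfolding w cinner_smoothing_adjoint[of "smoothing_op w" w] by (simp add: cinner_self norm_ell2_sq)
  finally have "Im (coord z 0) = 0"
    using bloch_op_hermitian[of \<rho> \<eta> "constant_mode + w"] by (simp add: z_def)
  then have z0: "coord z 0 = of_real \<mu>" using Re0 by (simp add: complex_eq_iff)
  have "z = cscale (coord z 0) constant_mode + mean_free_proj z" by (simp add: mean_free_decomposition)
  also have "\<dots> = \<mu> *\<^sub>R (constant_mode + mean_free_proj (smoothing_op (smoothing_op w)))"
    unfolding z0 using eq by (simp add: z_def scaleR_ell2_def[symmetric] scaleR_add_right)
  also have "mean_free_proj (smoothing_op (smoothing_op w)) = smoothing_op (smoothing_op w)"
  proof -
    have "coord w 0 = 0" using arg_cong[OF w, of "\<lambda>z. coord z 0"] by (simp add: coord_mean_free)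
    then show ?thesis by (intro ell2_eqI) (simp add: coord_mean_free coord_smoothing)
  qed
  finally show ?thesis by (simp add: z_def blinfun.add_right smoothing_constant_mode)
qed

text \<open>The ground state \<open>constant_mode + w\<close> is transported back to a function by \<open>realize\<close>.  Each of the
expansions is centred in the ball of radius \<open>\<delta>\<close> and converges at distance \<open>\<delta>\<close> from its centre, so all
statements about \<open>lam\<close> and \<open>w\<close> are used on the cube of half-width \<open>2 * \<delta>\<close>.\<close>

theorem bloch_ground_state_analytic:
  assumes \<rho>: "\<rho> > 0"
  shows "\<exists>\<delta>>0. \<exists>U. U = {\<eta> \<in> dual_cell. norm \<eta> < \<delta>} \<and>
    real_analytic_on (bloch_eigenvalue A \<rho> 1) U \<and>
    (\<exists>\<phi>. (\<forall>\<eta>\<in>U. bloch_eigenfunction A \<rho> \<eta> (bloch_eigenvalue A \<rho> 1 \<eta>) (\<phi> \<eta>)) \<and>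
         sobolev_analytic_on 2 \<phi> U)"
proof -
  let ?K = "smoothing_op o\<^sub>L smoothing_op :: (int^'d) ell2 \<Rightarrow>\<^sub>L (int^'d) ell2"
  have \<rho>2: "\<rho>\<^sup>2 > 0" using \<rho> by simp
  have PP: "mean_free_proj (mean_free_proj x) = mean_free_proj x" for x :: "(int^'d) ell2"
    by (rule ell2_eqI) (simp add: coord_mean_free)
  have Psym: "inner (mean_free_proj x) y = inner x (mean_free_proj y)" for x y :: "(int^'d) ell2"
    by (simp add: inner_Re_cinner cinner_mean_free_adjoint)
  have Pe: "mean_free_proj (constant_mode :: (int^'d) ell2) = 0"
    by (rule ell2_eqI) (simp add: coord_mean_free coord_constant_mode)
  note perturbation = simple_eigenvalue_analytic[OF small_increment_bloch_op bloch_op_constant_mode bloch_op_orthogonal_constant_mode \<rho>2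
          bloch_op_coercive PP norm_mean_free_le Psym Pe norm_smoothing_twice_le]
  obtain \<delta> N w lam where \<delta>: "\<delta> > 0"
    and w_psb: "\<And>x0. x0 \<in> cube 0 \<delta> \<Longrightarrow> power_series_bound x0 \<delta> N w"
    and lam_psb: "\<And>x0. x0 \<in> cube 0 \<delta> \<Longrightarrow> power_series_bound x0 \<delta> N lam"
    and Pw: "\<And>\<eta>. \<eta> \<in> cube 0 (2 * \<delta>) \<Longrightarrow> mean_free_proj (w \<eta>) = w \<eta>"
    and proj: "\<And>\<eta>. \<eta> \<in> cube 0 (2 * \<delta>) \<Longrightarrow> mean_free_proj (bloch_op \<rho> \<eta> (constant_mode + w \<eta>)) = lam \<eta> *\<^sub>R mean_free_proj (?K (w \<eta>))"
    and lam: "\<And>\<eta>. \<eta> \<in> cube 0 (2 * \<delta>) \<Longrightarrow> lam \<eta> = inner (bloch_op \<rho> \<eta> (constant_mode + w \<eta>)) constant_mode"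
    and unique: "\<And>\<eta> v \<mu>. \<lbrakk>\<eta> \<in> cube 0 (2 * \<delta>); mean_free_proj v = v; 0 \<le> \<mu>; \<mu> \<le> lam \<eta>;
       mean_free_proj (bloch_op \<rho> \<eta> (constant_mode + v)) = \<mu> *\<^sub>R mean_free_proj (?K v);
       \<mu> = inner (bloch_op \<rho> \<eta> (constant_mode + v)) constant_mode\<rbrakk> \<Longrightarrow> \<mu> = lam \<eta>"
    and no_mean_free: "\<And>\<eta> v \<mu>. \<lbrakk>\<eta> \<in> cube 0 (2 * \<delta>); mean_free_proj v = v; 0 \<le> \<mu>; \<mu> \<le> lam \<eta>;
       mean_free_proj (bloch_op \<rho> \<eta> v) = \<mu> *\<^sub>R mean_free_proj (?K v)\<rbrakk> \<Longrightarrow> v = 0"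
    by (rule perturbation, assumption, rule that)
  define X where "X \<eta> = constant_mode + w \<eta>" for \<eta>
  define \<phi> where "\<phi> \<eta> = realize (smoothing_op (X \<eta>))" for \<eta>
  have X_nz: "X \<eta> \<noteq> 0" if "\<eta> \<in> cube 0 (2 * \<delta>)" for \<eta>
  proof -
    have "coord (w \<eta>) 0 = 0" using arg_cong[OF Pw[OF that], of "\<lambda>z. coord z 0"] by (simp add: coord_mean_free)
    then have "coord (X \<eta>) 0 = 1" by (simp add: X_def coord_constant_mode)
    then show ?thesis by auto
  qed
  have ef: "bloch_eigenfunction A \<rho> \<eta> (lam \<eta>) (\<phi> \<eta>)" if "\<eta> \<in> cube 0 (2 * \<delta>)" for \<eta>
  proof -
    have "bloch_op \<rho> \<eta> (X \<eta>) = lam \<eta> *\<^sub>R smoothing_op (smoothing_op (X \<eta>))"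
      unfolding X_def by (rule eigen_equation_from_projection[OF Pw _ lam]) (use proj that in auto)
    then show ?thesis
      unfolding bloch_eigenfunction_iff \<phi>_def using X_nz[OF that] realize_L2_per by auto
  qed
  have smallest: "lam \<eta> \<le> \<nu>" if \<eta>: "\<eta> \<in> cube 0 (2 * \<delta>)" and u: "bloch_eigenfunction A \<rho> \<eta> \<nu> u" for \<eta> \<nu> u
  proof (rule ccontr)
    assume "\<not> lam \<eta> \<le> \<nu>"
    then have less: "\<nu> < lam \<eta>" by simp
    obtain x where x: "x \<noteq> 0" "bloch_op \<rho> \<eta> x = \<nu> *\<^sub>R smoothing_op (smoothing_op x)"
      using u unfolding bloch_eigenfunction_iff by blast
    have \<nu>: "0 \<le> \<nu>" by (rule eigenvalue_nonneg[OF x])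
    show False
    proof (cases "coord x 0 = 0")
      case True
      then have Px: "mean_free_proj x = x" by (intro ell2_eqI) (simp add: coord_mean_free)
      have "x = 0"
        by (rule no_mean_free[OF \<eta> Px \<nu> less_imp_le[OF less]]) (simp add: x(2) blinfun.scaleR_right)
      then show False using x(1) by simp
    next
      case False
      \<comment> \<open>Multiples by complex scalars are again eigenvectors, so the mean value may be normalised.\<close>
      define x' where "x' = cscale (1 / coord x 0) x"
      have x'0: "coord x' 0 = 1" using False by (simp add: x'_def)
      have x'_eq: "constant_mode + mean_free_proj x' = x'"
        by (rule ell2_eqI) (simp add: coord_mean_free coord_constant_mode x'0)
      have Bx': "bloch_op \<rho> \<eta> x' = \<nu> *\<^sub>R smoothing_op (smoothing_op x')"
        unfolding x'_def bloch_op_cscale x(2) by (rule ell2_eqI) (simp add: coord_smoothing)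
      have PJJ: "mean_free_proj (smoothing_op (smoothing_op x')) = mean_free_proj (smoothing_op (smoothing_op (mean_free_proj x')))"
        by (rule ell2_eqI) (simp add: coord_mean_free coord_smoothing)
      have "\<nu> = lam \<eta>"
      proof (rule unique[OF \<eta> PP \<nu> less_imp_le[OF less], of x'])
        show "mean_free_proj (bloch_op \<rho> \<eta> (constant_mode + mean_free_proj x')) = \<nu> *\<^sub>R mean_free_proj (?K (mean_free_proj x'))"
          unfolding x'_eq Bx' by (simp add: blinfun.scaleR_right PJJ)
        show "\<nu> = inner (bloch_op \<rho> \<eta> (constant_mode + mean_free_proj x')) constant_mode"
          unfolding x'_eq Bx' by (simp add: inner_Re_cinner cinner_constant_mode coord_smoothing x'0 weight_def)
      qed
      then show False using less by simp
    qed
  qed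
  have eigenvalue: "bloch_eigenvalue A \<rho> 1 \<eta> = lam \<eta>" if \<eta>: "\<eta> \<in> cube 0 (2 * \<delta>)" for \<eta>
    unfolding bloch_eigenvalue_def
  proof (rule cInf_eq_minimum)
    have "c 0 = 0" if "AE y in lebesgue. (\<Sum>k<1. c k * \<phi> \<eta> y) = 0" for c :: "nat \<Rightarrow> complex"
    proof (rule ccontr)
      assume "c 0 \<noteq> 0"
      then have "AE y in lebesgue. \<phi> \<eta> y = 0" using that by simp
      then show False using ef[OF \<eta>] by (simp add: bloch_eigenfunction_def)
    qed
    then show "lam \<eta> \<in> {\<mu>. \<exists>u :: nat \<Rightarrow> real^'d \<Rightarrow> complex.
       (\<forall>k<1. \<exists>\<nu>\<le>\<mu>. bloch_eigenfunction A \<rho> \<eta> \<nu> (u k)) \<and>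
       (\<forall>c :: nat \<Rightarrow> complex.
          (AE y in lebesgue. (\<Sum>k<1. c k * u k y) = 0) \<longrightarrow> (\<forall>k<1. c k = 0))}"
      using ef[OF \<eta>] by (intro CollectI exI[of _ "\<lambda>_. \<phi> \<eta>"]) auto
  next
    fix \<mu> assume "\<mu> \<in> {\<mu>. \<exists>u :: nat \<Rightarrow> real^'d \<Rightarrow> complex.
       (\<forall>k<1. \<exists>\<nu>\<le>\<mu>. bloch_eigenfunction A \<rho> \<eta> \<nu> (u k)) \<and>
       (\<forall>c :: nat \<Rightarrow> complex.
          (AE y in lebesgue. (\<Sum>k<1. c k * u k y) = 0) \<longrightarrow> (\<forall>k<1. c k = 0))}"
    then obtain u :: "nat \<Rightarrow> real^'d \<Rightarrow> complex" and \<nu> where "\<nu> \<le> \<mu>" "bloch_eigenfunction A \<rho> \<eta> \<nu> (u 0)"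
      by auto
    then show "lam \<eta> \<le> \<mu>" using smallest[OF \<eta>] order_trans by blast
  qed
  define U :: "(real^'d) set" where "U = {\<eta> \<in> dual_cell. norm \<eta> < \<delta>}"
  have U: "x0 \<in> cube 0 \<delta>" if "x0 \<in> U" for x0
  proof -
    have "\<bar>x0 $ i\<bar> \<le> \<delta>" for i
      using component_le_norm_cart[of x0 i] that by (simp add: U_def)
    then show ?thesis by (simp add: cube_def)
  qed
  have ball: "x \<in> cube x0 \<delta>" if "x \<in> ball x0 \<delta>" for x x0 :: "real^'d"
  proof -
    have "\<bar>(x - x0) $ i\<bar> \<le> \<delta>" for i
      using component_le_norm_cart[of "x - x0" i] that by (simp add: dist_norm norm_minus_commute)
    then show ?thesis by (simp add: cube_def)
  qed
  have big: "x \<in> cube 0 (2 * \<delta>)" if "x0 \<in> U" "x \<in> cube x0 \<delta>" for x x0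
    using cube_add[OF U[OF that(1)] that(2)] by simp
  have big': "x0 \<in> cube 0 (2 * \<delta>)" if "x0 \<in> U" for x0
    by (rule big[OF that]) (use \<delta> in \<open>simp add: cube_def\<close>)
  have "real_analytic_on (bloch_eigenvalue A \<rho> 1) U"
    unfolding real_analytic_on_def
  proof
    fix x0 assume x0: "x0 \<in> U"
    obtain c S where "((\<lambda>\<alpha>. norm (c \<alpha>) * degree_weight \<delta> \<alpha>) has_sum S) UNIV" "S \<le> N"
      and c: "\<And>x. x \<in> cube x0 \<delta> \<Longrightarrow> ((\<lambda>\<alpha>. monomial (x - x0) \<alpha> *\<^sub>R c \<alpha>) has_sum lam x) UNIV"
      by (rule power_series_boundE[OF lam_psb[OF U[OF x0]]], rule that)
    show "\<exists>r>0. \<exists>c. \<forall>x\<in>ball x0 r. ((\<lambda>\<alpha>. monomial (x - x0) \<alpha> * c \<alpha>) has_sum bloch_eigenvalue A \<rho> 1 x) UNIV"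
      using \<delta> c ball eigenvalue big[OF x0] by (intro exI[of _ \<delta>] conjI exI[of _ c] ballI) simp_all
  qed
  moreover have "bloch_eigenfunction A \<rho> \<eta> (bloch_eigenvalue A \<rho> 1 \<eta>) (\<phi> \<eta>)" if "\<eta> \<in> U" for \<eta>
    using ef eigenvalue big'[OF that] by simp
  moreover have "sobolev_analytic_on 2 \<phi> U"
    unfolding sobolev_analytic_on_def
  proof
    fix x0 assume x0: "x0 \<in> U"
    have X_psb: "power_series_bound x0 \<delta> (norm (constant_mode :: (int^'d) ell2) + N) X"
      unfolding X_def[abs_def]
      by (rule power_series_bound_add[OF \<delta> power_series_bound_const[OF \<delta>] w_psb[OF U[OF x0]]])
    obtain c S where "((\<lambda>\<alpha>. norm (c \<alpha>) * degree_weight \<delta> \<alpha>) has_sum S) UNIV"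
      "S \<le> norm (constant_mode :: (int^'d) ell2) + N"
      and c: "\<And>x. x \<in> cube x0 \<delta> \<Longrightarrow> ((\<lambda>\<alpha>. monomial (x - x0) \<alpha> *\<^sub>R c \<alpha>) has_sum X x) UNIV"
      by (rule power_series_boundE[OF X_psb], rule that)
    define c' where "c' \<alpha> = realize (smoothing_op (c \<alpha>))" for \<alpha>
    have c': "c' \<alpha> \<in> L2_per" "fourier (c' \<alpha>) = smoothing_op (c \<alpha>)" for \<alpha>
      by (simp_all add: c'_def realize_L2_per)
    have \<phi>: "\<phi> x \<in> L2_per" "fourier (\<phi> x) = smoothing_op (X x)" for x
      by (simp_all add: \<phi>_def realize_L2_per)
    let ?C = "sqrt (1 + CARD('d) * (1 + CARD('d)))"
    have conv: "((\<lambda>F. sobolev_norm 2 (\<lambda>y. \<phi> x y - (\<Sum>\<alpha>\<in>F. of_real (monomial (x - x0) \<alpha>) * c' \<alpha> y)))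
        \<longlongrightarrow> 0) (finite_subsets_at_top UNIV)" if x: "x \<in> ball x0 \<delta>" for x
    proof (rule tendsto_sandwich[where f = "\<lambda>_. 0"])
      let ?s = "\<lambda>F. \<Sum>\<alpha>\<in>F. monomial (x - x0) \<alpha> *\<^sub>R c \<alpha>"
      have "(?s \<longlongrightarrow> X x) (finite_subsets_at_top UNIV)"
        using c[OF ball[OF x]] unfolding has_sum_def .
      then have "((\<lambda>F. ?C * norm (X x - ?s F)) \<longlongrightarrow> ?C * norm (X x - X x)) (finite_subsets_at_top UNIV)"
        by (intro tendsto_intros)
      then show "((\<lambda>F. ?C * norm (X x - ?s F)) \<longlongrightarrow> 0) (finite_subsets_at_top UNIV)" by simp
      have "sobolev_norm 2 (\<lambda>y. \<phi> x y - (\<Sum>\<alpha>\<in>F. of_real (monomial (x - x0) \<alpha>) * c' \<alpha> y)) \<le> ?C * norm (X x - ?s F)" for F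
      proof (rule sobolev_norm_2_le)
        let ?p = "\<lambda>y. \<Sum>\<alpha>\<in>F. of_real (monomial (x - x0) \<alpha>) * c' \<alpha> y"
        have p: "?p \<in> L2_per" by (intro L2_per_sum L2_per_cmult c')
        show "(\<lambda>y. \<phi> x y - ?p y) \<in> L2_per" by (intro L2_per_diff p \<phi>)
        have "fourier ?p = (\<Sum>\<alpha>\<in>F. cscale (of_real (monomial (x - x0) \<alpha>)) (smoothing_op (c \<alpha>)))"
          by (simp add: torus.coeffs_sum L2_space_cmult L2_per_imp_L2_space c' torus.coeffs_cmult)
        also have "\<dots> = smoothing_op (?s F)"
          by (simp add: blinfun.sum_right blinfun.scaleR_right flip: scaleR_ell2_def)
        finally have fp: "fourier ?p = smoothing_op (?s F)" .
        show "fourier (\<lambda>y. \<phi> x y - ?p y) = smoothing_op (X x - ?s F)"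
          using torus.coeffs_diff[OF L2_per_imp_L2_space[OF \<phi>(1)] L2_per_imp_L2_space[OF p], of x]
          unfolding fp \<phi>(2) by (simp add: blinfun.diff_right)
      qed
      then show "\<forall>\<^sub>F F in finite_subsets_at_top UNIV. sobolev_norm 2 (\<lambda>y. \<phi> x y - (\<Sum>\<alpha>\<in>F. of_real (monomial (x - x0) \<alpha>) * c' \<alpha> y)) \<le> ?C * norm (X x - ?s F)"
        by (intro always_eventually allI)
      have "sobolev_norm 2 u \<ge> 0" for u :: "real^'d \<Rightarrow> complex"
      proof -
        have "sobolev_norm_sq s v \<ge> 0" for s and v :: "real^'d \<Rightarrow> complex"
        proof (induction s arbitrary: v)
          case 0
          show ?case unfolding sobolev_norm_sq.simps set_lebesgue_integral_def by (intro Bochner_Integration.integral_nonneg) simp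
        next
          case (Suc s)
          have "(LINT y:cell|lebesgue. (cmod (v y))\<^sup>2) \<ge> 0"
            unfolding set_lebesgue_integral_def by (intro Bochner_Integration.integral_nonneg) simp
          then show ?case using Suc by (simp add: sum_nonneg)
        qed
        then show ?thesis by (simp add: sobolev_norm_def)
      qed
      then show "\<forall>\<^sub>F F in finite_subsets_at_top UNIV. 0 \<le> sobolev_norm 2 (\<lambda>y. \<phi> x y - (\<Sum>\<alpha>\<in>F. of_real (monomial (x - x0) \<alpha>) * c' \<alpha> y))"
        by (intro always_eventually allI)
    qed simp
    have "\<phi> x \<in> sobolev 2" "c' \<alpha> \<in> sobolev 2" for x \<alpha>
      unfolding sobolev_2_iff using \<phi> c' by blast+
    with conv show "\<exists>r>0. \<exists>c. (\<forall>\<alpha>. c \<alpha> \<in> sobolev 2) \<and>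
        (\<forall>x\<in>ball x0 r. \<phi> x \<in> sobolev 2 \<and>
           ((\<lambda>F. sobolev_norm 2 (\<lambda>y. \<phi> x y - (\<Sum>\<alpha>\<in>F. of_real (monomial (x - x0) \<alpha>) * c \<alpha> y)))
              \<longlongrightarrow> 0) (finite_subsets_at_top UNIV))"
      using \<delta> by (intro exI[of _ \<delta>] conjI exI[of _ c'] allI ballI) auto
  qed
  ultimately show ?thesis
    using \<delta> U_def by (intro exI[of _ \<delta>] conjI exI[of _ U] exI[of _ \<phi>] ballI) auto
qed

end

theorem theorem3p1:
  fixes A :: "real^'d \<Rightarrow> real^'d^'d" and \<alpha> :: real
  assumes "\<And>i j. (\<lambda>y. A y $ i $ j) \<in> borel_measurable lebesgue"
    and "\<exists>M. AE y in lebesgue. \<forall>i j. \<bar>A y $ i $ j\<bar> \<le> M"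
    and "AE y in lebesgue. transpose (A y) = A y"
    and "periodic A"
    and "\<alpha> > 0"
    and "AE y in lebesgue. \<forall>\<xi>. (A y *v \<xi>) \<bullet> \<xi> \<ge> \<alpha> * (norm \<xi>)\<^sup>2"
  shows "\<forall>\<rho>>0. \<exists>\<delta>>0. \<exists>U. U = {\<eta> \<in> dual_cell. norm \<eta> < \<delta>} \<and>
    real_analytic_on (bloch_eigenvalue A \<rho> 1) U \<and>
    (\<exists>\<phi>. (\<forall>\<eta>\<in>U. bloch_eigenfunction A \<rho> \<eta> (bloch_eigenvalue A \<rho> 1 \<eta>) (\<phi> \<eta>)) \<and>
         sobolev_analytic_on 2 \<phi> U)"
proof -
  interpret coefficient_matrix A
  proof
    show "AE y in lebesgue. \<forall>\<xi>. (A y *v \<xi>) \<bullet> \<xi> \<ge> 0"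
      using assms(6)
    proof eventually_elim
      case (elim y)
      have "0 \<le> \<alpha> * (norm \<xi>)\<^sup>2" for \<xi> :: "real^'d" using \<open>\<alpha> > 0\<close> by simp
      then show ?case using elim order_trans by blast
    qed
  qed (fact assms)+
  show ?thesis using bloch_ground_state_analytic by blast
qed

end
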